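(* Let $s\in\frac12\mathbb{N}$, let $(\Lambda,\mathcal{E})$ be a finite graph with perimeter constant $\gamma$, and let $$H_\Lambda=-\sum_{\langle x,y\rangle\in\mathcal{E}}\ \sum_{k=1}^{2s}c_k(x,y)\,\bigl(\vec{\mathcal{S}}_x\cdot\vec{\mathcal{S}}_y\bigr)^k,$$ where the coupling constants satisfy $\sum_{k}|c_k(x,y)|(3s^2)^k\le 1$ for all $x,y\in\Lambda$. Let $\langle\cdot\rangle$ be the Gibbs state of $H_\Lambda$ at inverse temperature $\beta$. There exist constants $C>0$ and $\xi(\beta)>0$, the latter depending on $\beta,\gamma,s$ but not on $x,y\in\Lambda$, such that $$|\langle\mathcal{S}^j_x\mathcal{S}^j_y\rangle|\le C\,(d(x,y)+1)^{-\xi(\beta)},\qquad j=1,2,3.$$ More generally, for $\mathcal{O}_y\in\mathcal{B}_y$, $$|\langle\mathcal{S}^+_x\mathcal{O}_y\rangle|\le C\,(d(x,y)+1)^{-\xi(\beta)}.$$ The exponent $\xi(\beta)$ is proportional to $\beta^{-1}$; more precisely, $$\lim_{\beta\to\infty}\beta\,\xi(\beta)=(32\,s\,\gamma^2)^{-1}.$$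
   Context: Graph: $d:\Lambda\times\Lambda\to\mathbb{N}_0$ is the graph distance (length of the shortest connected path between two vertices); the perimeter constant is $\gamma=\max_{x\in\Lambda}\max_{\ell\in\mathbb{N}}\frac1\ell|\{y\in\Lambda:d(x,y)=\ell\}|$ (with $\ell\ge1$). Graphs of arbitrary size are considered, with bounded $\gamma$. Spins: $\vec{\mathcal{S}}=(\mathcal{S}^1,\mathcal{S}^2,\mathcal{S}^3)$ is the vector of spin-$s$ matrices on $\mathbb{C}^{2s+1}$, satisfying $[\mathcal{S}^1,\mathcal{S}^2]=\mathrm{i}\mathcal{S}^3$ together with all cyclic permutations, and $\sum_{i=1}^3(\mathcal{S}^i)^2=s(s+1)$; $\mathcal{S}^\pm=\mathcal{S}^1\pm\mathrm{i}\mathcal{S}^2$. On $\mathcal{H}_\Lambda=\bigotimes_{x\in\Lambda}\mathbb{C}^{2s+1}$, $\mathcal{S}^i_x$ denotes $\mathcal{S}^i$ acting on the factor at $x$ tensored with the identity on the other factors (and similarly for $\mathcal{S}^\pm_x$), $\vec{\mathcal{S}}_x\cdot\vec{\mathcal{S}}_y=\sum_{i=1}^3\mathcal{S}^i_x\mathcal{S}^i_y$, and $\mathcal{B}_y$ is the algebra of operators acting on the factor at site $y$ (tensored with the identity elsewhere). The numbers $c_k(x,y)$ are the coupling constants. The Gibbs state is $\langle a\rangle=\mathrm{Tr}(a\,e^{-\beta H_\Lambda})/\mathrm{Tr}(e^{-\beta H_\Lambda})$. *)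

theory Defs
  imports "HOL-Library.Extended_Real" "Jordan_Normal_Form.Schur_Decomposition"
begin

text \<open>A simple graph with vertex set \<open>{..<n}\<close> is given by its set \<open>E\<close> of edges, which are
  two-element sets of vertices. Up to relabelling these are all finite simple graphs; having all of
  them over one type makes it possible to state bounds that are uniform in the graph.\<close>

definition finite_graph :: "nat \<Rightarrow> nat set set \<Rightarrow> bool" where
  "finite_graph n E \<longleftrightarrow> (\<forall>e\<in>E. \<exists>x<n. \<exists>y<n. x \<noteq> y \<and> e = {x, y})"

text \<open>\<open>R ^^ l\<close> relates the end points of walks of length \<open>l\<close>. Distances are natural numbers, as for
  connected graphs; vertices in different components get the value 0, so they never count towards
  a sphere of positive radius.\<close>

definition graph_dist :: "nat set set \<Rightarrow> nat \<Rightarrow> nat \<Rightarrow> nat" where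
  "graph_dist E x y =
     (let L = {l. (x, y) \<in> {(u, v). {u, v} \<in> E} ^^ l} in if L = {} then 0 else LEAST l. l \<in> L)"

text \<open>The inner supremum is over infinitely many radii, but only finitely many of them (those below
  \<open>n\<close>) give a non-zero value, so for \<open>n > 0\<close> both suprema are maxima.\<close>

definition perimeter_constant :: "nat \<Rightarrow> nat set set \<Rightarrow> real" where
  "perimeter_constant n E =
     (SUP x\<in>{..<n}. SUP l\<in>{1..}. real (card {y. y < n \<and> graph_dist E x y = l}) / real l)"

text \<open>The spin is \<open>s = t / 2\<close> with \<open>t\<close> a positive natural number. The three matrices are indexed by
  1, 2, 3.\<close>

definition spin_matrices :: "nat \<Rightarrow> (nat \<Rightarrow> complex mat) \<Rightarrow> bool" where
  "spin_matrices t S \<longleftrightarrow>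
     (\<forall>j\<in>{1, 2, 3}. S j \<in> carrier_mat (t + 1) (t + 1) \<and> mat_adjoint (S j) = S j) \<and>
     S 1 * S 2 - S 2 * S 1 = \<i> \<cdot>\<^sub>m S 3 \<and>
     S 2 * S 3 - S 3 * S 2 = \<i> \<cdot>\<^sub>m S 1 \<and>
     S 3 * S 1 - S 1 * S 3 = \<i> \<cdot>\<^sub>m S 2 \<and>
     S 1 * S 1 + S 2 * S 2 + S 3 * S 3 =
       complex_of_real (real t / 2 * (real t / 2 + 1)) \<cdot>\<^sub>m 1\<^sub>m (t + 1)"

definition spin_raising :: "(nat \<Rightarrow> complex mat) \<Rightarrow> complex mat" where
  "spin_raising S = S 1 + \<i> \<cdot>\<^sub>m S 2"

text \<open>The standard basis of the \<open>n\<close>-fold tensor power of the \<open>d\<close>-dimensional space is enumerated by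
  the numbers \<open>i < d ^ n\<close>: the basis vector number \<open>i\<close> is the tensor product over the sites
  \<open>x < n\<close> of the local basis vectors numbered by the base-\<open>d\<close> digits of \<open>i\<close>.\<close>

definition digit :: "nat \<Rightarrow> nat \<Rightarrow> nat \<Rightarrow> nat" where
  "digit d x i = i div d ^ x mod d"

definition site_op :: "nat \<Rightarrow> nat \<Rightarrow> nat \<Rightarrow> complex mat \<Rightarrow> complex mat" where
  "site_op d n x A = mat (d ^ n) (d ^ n) (\<lambda>(i, j).
     if \<forall>y<n. y \<noteq> x \<longrightarrow> digit d y i = digit d y j then A $$ (digit d x i, digit d x j) else 0)"

definition spin_dot :: "nat \<Rightarrow> nat \<Rightarrow> (nat \<Rightarrow> complex mat) \<Rightarrow> nat \<Rightarrow> nat \<Rightarrow> complex mat" where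
  "spin_dot t n S x y =
     site_op (t + 1) n x (S 1) * site_op (t + 1) n y (S 1) +
     site_op (t + 1) n x (S 2) * site_op (t + 1) n y (S 2) +
     site_op (t + 1) n x (S 3) * site_op (t + 1) n y (S 3)"

text \<open>Each unordered edge contributes once, through the pair of its end points in increasing order;
  the sum of matrices is written entrywise.\<close>

definition hamiltonian ::
  "nat \<Rightarrow> nat \<Rightarrow> nat set set \<Rightarrow> (nat \<Rightarrow> complex mat) \<Rightarrow> (nat \<Rightarrow> nat \<Rightarrow> nat \<Rightarrow> real) \<Rightarrow> complex mat" where
  "hamiltonian t n E S c = mat ((t + 1) ^ n) ((t + 1) ^ n) (\<lambda>(i, j).
     - (\<Sum>(x, y)\<in>{(x, y). x < y \<and> {x, y} \<in> E}. \<Sum>k=1..t.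
          complex_of_real (c k x y) * (spin_dot t n S x y ^\<^sub>m k) $$ (i, j)))"

definition trace_mat :: "complex mat \<Rightarrow> complex" where
  "trace_mat A = (\<Sum>i<dim_row A. A $$ (i, i))"

definition exp_mat :: "complex mat \<Rightarrow> complex mat" where
  "exp_mat A = mat (dim_row A) (dim_row A) (\<lambda>(i, j). \<Sum>k. (A ^\<^sub>m k) $$ (i, j) / fact k)"

definition gibbs_state :: "real \<Rightarrow> complex mat \<Rightarrow> complex mat \<Rightarrow> complex" where
  "gibbs_state \<beta> H A =
     trace_mat (A * exp_mat (complex_of_real (- \<beta>) \<cdot>\<^sub>m H)) /
     trace_mat (exp_mat (complex_of_real (- \<beta>) \<cdot>\<^sub>m H))"

text \<open>The admissible data: a graph with perimeter constant \<open>\<gamma>\<close> and real coupling constants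
  \<open>c k x y\<close>, symmetric in \<open>x\<close>, \<open>y\<close> because edges are undirected.\<close>

definition admissible ::
  "nat \<Rightarrow> real \<Rightarrow> nat \<Rightarrow> nat set set \<Rightarrow> (nat \<Rightarrow> nat \<Rightarrow> nat \<Rightarrow> real) \<Rightarrow> bool" where
  "admissible t \<gamma> n E c \<longleftrightarrow>
     finite_graph n E \<and> perimeter_constant n E = \<gamma> \<and>
     (\<forall>x<n. \<forall>y<n. (\<forall>k\<in>{1..t}. c k x y = c k y x) \<and>
        (\<Sum>k=1..t. \<bar>c k x y\<bar> * (3 * (real t / 2)\<^sup>2) ^ k) \<le> 1)"

end

theory Submission
  imports "HOL-Analysis.L2_Norm" "HOL-Analysis.Uniform_Limit"
    "Jordan_Normal_Form.Jordan_Normal_Form_Existence" Defs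
begin

text \<open>The idea is the complex rotation of McBryan and Spencer. Rotating the spin at each site \<open>z\<close> about
  the third axis by an imaginary angle \<open>\<i> \<theta> z\<close>, with \<open>\<theta> y = 0\<close>, multiplies the correlation by
  \<open>exp (- \<theta> x)\<close> and turns \<open>H\<close> into a similar, non-Hermitian matrix \<open>H'\<close>. If the Hermitian part of
  \<open>H'\<close> is at least \<open>H - \<epsilon>\<close>, then \<open>\<bar>Tr (O e\<^sup>-\<^sup>\<beta>\<^sup>H\<^sup>')\<bar> \<le> \<parallel>O\<parallel> e\<^sup>\<beta>\<^sup>\<epsilon> Tr e\<^sup>-\<^sup>\<beta>\<^sup>H\<close>, which follows from the Hoelder
  inequality for traces applied to the factors of \<open>(1 - \<beta> H' / m)\<^sup>m\<close>, \<open>m\<close> a power of two.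
  Here \<open>\<epsilon>\<close> is at most \<open>8 s\<close> times the sum of \<open>(\<theta> u - \<theta> v)\<^sup>2\<close> over the edges.
  For \<open>\<theta> z = K ln ((d(x,y) + 1) / (d(x,z) + 1))\<close>, cut off at 0, that sum is at most
  \<open>\<gamma>\<^sup>2 K\<^sup>2 ln (d(x,y) + 1)\<close>, so the correlation decays with exponent \<open>K - 8 s \<gamma>\<^sup>2 \<beta> K\<^sup>2\<close>, which is
  \<open>1 / (32 s \<gamma>\<^sup>2 \<beta>)\<close> at the optimal \<open>K = 1 / (16 s \<gamma>\<^sup>2 \<beta>)\<close>.\<close>

text \<open>The obstacle is that \<open>H'\<close> is not Hermitian, so its spectrum says little
  about the size of its exponential. Only its Hermitian part is controlled, and the finite powers
  are compared with the spectrum of \<open>H\<close> instead. Hoelder's inequality for exponents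
  that are powers of two follows by doubling from Cauchy-Schwarz, without singular values; hence the
  choice of \<open>m\<close>. The error is quadratic in the differences of \<theta> because the
  first-order term of a rotated interaction is anti-Hermitian. This is what makes a logarithmic
  profile affordable: its squared step at radius l is of order 1 / l^2, while at most \<gamma> l
  vertices of degree at most \<gamma> lie on that sphere, so the energy is a harmonic sum. The
  factor 8 s leaves room: k^2 (s (s + 1))^k exceeds the weight (3 s^2)^k of the couplings at most by
  the factor 4. The components of the spin are reduced to the raising operator by symmetry: cyclic
  permutations and a rotation by pi leave the Hamiltonian unchanged, and the first component is the
  mean of the raising and the lowering operator.\<close>

unbundle no vec_syntax

section \<open>Matrices, norms and traces\<close>

declare index_mult_mat(1) [simp del] index_mult_mat_vec [simp del]

definition vinner :: "complex vec \<Rightarrow> complex vec \<Rightarrow> complex" where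
  "vinner u v = (\<Sum>i<dim_vec u. cnj (u $ i) * v $ i)"

definition vnorm :: "complex vec \<Rightarrow> real" where
  "vnorm v = L2_set (\<lambda>i. cmod (v $ i)) {..<dim_vec v}"

text \<open>\<open>b\<close> is an upper bound for the operator norm. Only such bounds enter the
  estimates, so no supremum has to be taken.\<close>

definition op_bounded :: "complex mat \<Rightarrow> real \<Rightarrow> bool" where
  "op_bounded A b \<longleftrightarrow> (\<forall>v\<in>carrier_vec (dim_col A). vnorm (A *\<^sub>v v) \<le> b * vnorm v)"

text \<open>The Hilbert-Schmidt norm. As an \<open>L2_set\<close> over index pairs it inherits
  Cauchy-Schwarz from \<open>L2_set_mult_ineq\<close>.\<close>

definition frobenius :: "complex mat \<Rightarrow> real" where
  "frobenius A = L2_set (\<lambda>(i, j). cmod (A $$ (i, j))) ({..<dim_row A} \<times> {..<dim_col A})"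

lemma mat_adjoint_dim [simp]: "dim_row (mat_adjoint A) = dim_col A" "dim_col (mat_adjoint A) = dim_row A"
  by (auto simp: mat_adjoint_def)

lemma mat_adjoint_index [simp]:
  fixes A :: "complex mat"
  shows "i < dim_col A \<Longrightarrow> j < dim_row A \<Longrightarrow> mat_adjoint A $$ (i, j) = cnj (A $$ (j, i))"
  by (auto simp: mat_adjoint_def mat_of_rows_index)

lemma mat_adjoint_carrier [simp]: "A \<in> carrier_mat n m \<Longrightarrow> mat_adjoint A \<in> carrier_mat m n"
  by (auto intro!: carrier_matI)

lemma mat_mult_index:
  fixes A B :: "complex mat"
  shows "i < dim_row A \<Longrightarrow> j < dim_col B \<Longrightarrow> dim_col A = dim_row B \<Longrightarrow>
    (A * B) $$ (i, j) = (\<Sum>k<dim_col A. A $$ (i, k) * B $$ (k, j))"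
  by (simp add: index_mult_mat(1) index_mult_mat_vec scalar_prod_def lessThan_atLeast0)

lemma mult_mat_vec_index:
  fixes A :: "complex mat"
  shows "i < dim_row A \<Longrightarrow> dim_col A = dim_vec v \<Longrightarrow> (A *\<^sub>v v) $ i = (\<Sum>k<dim_col A. A $$ (i, k) * v $ k)"
  by (simp add: index_mult_mat(1) index_mult_mat_vec scalar_prod_def lessThan_atLeast0)

lemma vnorm_nonneg [simp]: "vnorm v \<ge> 0"
  by (simp add: vnorm_def L2_set_nonneg)

lemma frobenius_nonneg [simp]: "frobenius A \<ge> 0"
  by (simp add: frobenius_def L2_set_nonneg)

lemma vnorm_smult: "vnorm (c \<cdot>\<^sub>v v) = cmod c * vnorm v"
proof -
  have "vnorm (c \<cdot>\<^sub>v v) = L2_set (\<lambda>i. cmod c * cmod (v $ i)) {..<dim_vec v}"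
    by (auto simp: vnorm_def norm_mult intro!: L2_set_cong)
  then show ?thesis
    by (simp add: vnorm_def L2_set_right_distrib)
qed

lemma vnorm_0 [simp]: "vnorm (0\<^sub>v n) = 0"
  by (simp add: vnorm_def L2_set_def)

lemma vinner_self: "vinner v v = complex_of_real ((vnorm v)\<^sup>2)"
proof -
  have "cnj z * z = complex_of_real ((cmod z)\<^sup>2)" for z
    by (metis complex_norm_square mult.commute of_real_power)
  then show ?thesis
    by (simp add: vinner_def vnorm_def L2_set_def real_sqrt_pow2 sum_nonneg)
qed

lemma frobenius_sq: "(frobenius A)\<^sup>2 = (\<Sum>i<dim_row A. \<Sum>j<dim_col A. (cmod (A $$ (i, j)))\<^sup>2)"
  by (simp add: frobenius_def L2_set_def real_sqrt_pow2 sum_nonneg sum.cartesian_product case_prod_unfold)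

context
  fixes N :: nat
begin

text \<open>The dimensions in these rules occur only in carrier premises, where rewriting cannot
  guess them. Setting all of them to \<open>N\<close> leaves premises about square matrices; outside
  the context \<open>N\<close> is supplied again by \<open>[of _ N]\<close>.\<close>

lemmas mat_assoc = assoc_mult_mat[of _ N N _ N _ N, where 'a = complex]
lemmas mat_vec_assoc = assoc_mult_mat_vec[of _ N N _ N, where 'a = complex]
lemmas mat_add_left = add_mult_distrib_mat[of _ N N _ _ N, where 'a = complex]
lemmas mat_add_right = mult_add_distrib_mat[of _ N N _ N, where 'a = complex]
lemmas mat_smult_right = mult_smult_distrib[of _ N N _ N, where 'a = complex]
lemmas mat_smult_left = mult_smult_assoc_mat[of _ N N _ N, where 'a = complex]
lemmas mat_vec_add = add_mult_distrib_mat_vec[of _ N N, where 'a = complex]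
lemmas vec_add_right = mult_add_distrib_mat_vec[of _ N N, where 'a = complex]

lemma vinner_add_right: "u \<in> carrier_vec N \<Longrightarrow> v \<in> carrier_vec N \<Longrightarrow> w \<in> carrier_vec N \<Longrightarrow>
    vinner u (v + w) = vinner u v + vinner u w"
  by (auto simp: vinner_def sum.distrib algebra_simps)

lemma vinner_smult_right: "u \<in> carrier_vec N \<Longrightarrow> v \<in> carrier_vec N \<Longrightarrow>
    vinner u (c \<cdot>\<^sub>v v) = c * vinner u v"
  by (auto simp: vinner_def sum_distrib_left algebra_simps)

lemma vinner_commute: "u \<in> carrier_vec N \<Longrightarrow> v \<in> carrier_vec N \<Longrightarrow>
    vinner v u = cnj (vinner u v)"
  by (auto simp: vinner_def mult.commute)

lemma cauchy_schwarz_vec: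
  assumes "u \<in> carrier_vec N" "v \<in> carrier_vec N"
  shows "cmod (vinner u v) \<le> vnorm u * vnorm v"
proof -
  have "cmod (vinner u v) \<le> (\<Sum>i<N. \<bar>cmod (u $ i)\<bar> * \<bar>cmod (v $ i)\<bar>)"
    using assms by (auto simp: vinner_def norm_mult intro!: sum_norm_le)
  also have "\<dots> \<le> vnorm u * vnorm v"
    using assms L2_set_mult_ineq[of "\<lambda>i. cmod (u $ i)" "\<lambda>i. cmod (v $ i)" "{..<N}"]
    by (auto simp: vnorm_def)
  finally show ?thesis .
qed

lemma vnorm_triangle:
  assumes "u \<in> carrier_vec N" "v \<in> carrier_vec N"
  shows "vnorm (u + v) \<le> vnorm u + vnorm v"
proof -
  have "vnorm (u + v) = L2_set (\<lambda>i. cmod (u $ i + v $ i)) {..<N}"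
    using assms by (auto simp: vnorm_def intro!: L2_set_cong)
  also have "\<dots> \<le> L2_set (\<lambda>i. cmod (u $ i) + cmod (v $ i)) {..<N}"
    by (intro L2_set_mono norm_triangle_ineq) auto
  also have "\<dots> \<le> vnorm u + vnorm v"
    using assms L2_set_triangle_ineq[of "\<lambda>i. cmod (u $ i)" "\<lambda>i. cmod (v $ i)" "{..<N}"]
    by (auto simp: vnorm_def)
  finally show ?thesis .
qed

lemma inner_adjoint:
  assumes "A \<in> carrier_mat N N" "u \<in> carrier_vec N" "v \<in> carrier_vec N"
  shows "vinner u (A *\<^sub>v v) = vinner (mat_adjoint A *\<^sub>v u) v"
proof -
  have "vinner u (A *\<^sub>v v) = (\<Sum>i<N. \<Sum>k<N. cnj (u $ i) * (A $$ (i, k) * v $ k))"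
    using assms by (auto simp: vinner_def mult_mat_vec_index sum_distrib_left intro!: sum.cong)
  also have "\<dots> = (\<Sum>k<N. \<Sum>i<N. cnj (u $ i) * (A $$ (i, k) * v $ k))"
    by (rule sum.swap)
  also have "\<dots> = vinner (mat_adjoint A *\<^sub>v u) v"
    using assms by (auto simp: vinner_def mult_mat_vec_index sum_distrib_right sum_distrib_left mult_ac
        intro!: sum.cong)
  finally show ?thesis .
qed

lemma mat_adjoint_adjoint [simp]: "A \<in> carrier_mat N N \<Longrightarrow> mat_adjoint (mat_adjoint A) = (A :: complex mat)"
  by (auto intro!: eq_matI)

lemma mat_adjoint_mult:
  "A \<in> carrier_mat N N \<Longrightarrow> B \<in> carrier_mat N N \<Longrightarrow>
    mat_adjoint (A * B) = mat_adjoint B * mat_adjoint (A :: complex mat)"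
  by (auto intro!: eq_matI sum.cong simp: mat_mult_index mult.commute)

lemma mat_adjoint_add: "A \<in> carrier_mat N N \<Longrightarrow> B \<in> carrier_mat N N \<Longrightarrow>
    mat_adjoint (A + B) = mat_adjoint A + mat_adjoint (B :: complex mat)"
  by (auto intro!: eq_matI)

lemma mat_adjoint_smult: "A \<in> carrier_mat N N \<Longrightarrow>
    mat_adjoint (c \<cdot>\<^sub>m A) = cnj c \<cdot>\<^sub>m mat_adjoint (A :: complex mat)"
  by (auto intro!: eq_matI)

lemma mat_adjoint_one [simp]: "mat_adjoint (1\<^sub>m N) = (1\<^sub>m N :: complex mat)"
  by (auto intro!: eq_matI)

lemma pow_mat_commute: "A \<in> carrier_mat N N \<Longrightarrow> A ^\<^sub>m k * A = A * A ^\<^sub>m k" for A :: "complex mat"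
  by (induction k) (auto simp: mat_assoc)

lemma mat_adjoint_pow: "A \<in> carrier_mat N N \<Longrightarrow>
    mat_adjoint (A ^\<^sub>m k) = mat_adjoint A ^\<^sub>m k" for A :: "complex mat"
  by (induction k) (auto simp: mat_adjoint_mult pow_mat_commute)

lemma pow_mat_add: "A \<in> carrier_mat N N \<Longrightarrow> A ^\<^sub>m (j + k) = A ^\<^sub>m j * A ^\<^sub>m k" for A :: "complex mat"
  by (induction k) (auto simp: mat_assoc)

lemma pow_mat_mult: "A \<in> carrier_mat N N \<Longrightarrow> A ^\<^sub>m (j * k) = (A ^\<^sub>m j) ^\<^sub>m k" for A :: "complex mat"
  by (induction k) (auto simp: pow_mat_add pow_mat_commute add.commute)

lemma trace_mat_mult: "A \<in> carrier_mat N N \<Longrightarrow> B \<in> carrier_mat N N \<Longrightarrow>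
    trace_mat (A * B) = (\<Sum>i<N. \<Sum>j<N. A $$ (i, j) * B $$ (j, i))"
  by (auto simp: trace_mat_def mat_mult_index)

lemma trace_mat_mult_commute:
  assumes "A \<in> carrier_mat N N" "B \<in> carrier_mat N N"
  shows "trace_mat (A * B) = trace_mat (B * A)"
  unfolding trace_mat_mult[OF assms] trace_mat_mult[OF assms(2,1)]
  by (subst sum.swap) (simp add: mult.commute)

lemma trace_mat_add: "A \<in> carrier_mat N N \<Longrightarrow> B \<in> carrier_mat N N \<Longrightarrow>
    trace_mat (A + B) = trace_mat A + trace_mat B"
  by (auto simp: trace_mat_def sum.distrib)

lemma trace_mat_smult: "A \<in> carrier_mat N N \<Longrightarrow> trace_mat (c \<cdot>\<^sub>m A) = c * trace_mat A"
  by (auto simp: trace_mat_def sum_distrib_left)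

lemma trace_mult_adjoint:
  assumes "A \<in> carrier_mat N N"
  shows "trace_mat (A * mat_adjoint A) = complex_of_real ((frobenius A)\<^sup>2)"
proof -
  have "z * cnj z = complex_of_real ((cmod z)\<^sup>2)" for z
    by (metis complex_norm_square of_real_power)
  then show ?thesis
    using assms by (subst trace_mat_mult) (auto simp: frobenius_sq intro!: sum.cong)
qed

lemma trace_adjoint_mult:
  "A \<in> carrier_mat N N \<Longrightarrow> trace_mat (mat_adjoint A * A) = complex_of_real ((frobenius A)\<^sup>2)"
  by (subst trace_mat_mult_commute) (auto simp: trace_mult_adjoint)

lemma trace_cauchy_schwarz:
  assumes A: "A \<in> carrier_mat N N" and B: "B \<in> carrier_mat N N"
  shows "cmod (trace_mat (A * B)) \<le> frobenius A * frobenius B"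
proof -
  have "cmod (trace_mat (A * B)) \<le> (\<Sum>i<N. \<Sum>j<N. cmod (A $$ (i, j)) * cmod (B $$ (j, i)))"
    unfolding trace_mat_mult[OF assms]
    by (intro sum_norm_le) (auto simp: norm_mult[symmetric] intro!: sum_norm_le)
  also have "\<dots> = (\<Sum>(i, j)\<in>{..<N} \<times> {..<N}. \<bar>cmod (A $$ (i, j))\<bar> * \<bar>cmod (B $$ (j, i))\<bar>)"
    by (simp add: sum.cartesian_product)
  also have "\<dots> \<le> L2_set (\<lambda>(i, j). cmod (A $$ (i, j))) ({..<N} \<times> {..<N}) *
      L2_set (\<lambda>(i, j). cmod (B $$ (j, i))) ({..<N} \<times> {..<N})"
    using L2_set_mult_ineq[of "\<lambda>(i, j). cmod (A $$ (i, j))" "\<lambda>(i, j). cmod (B $$ (j, i))"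
        "{..<N} \<times> {..<N}"]
    by (simp add: case_prod_unfold)
  also have "L2_set (\<lambda>(i, j). cmod (B $$ (j, i))) ({..<N} \<times> {..<N}) = frobenius B"
  proof -
    have "(\<Sum>i<N. \<Sum>j<N. (cmod (B $$ (j, i)))\<^sup>2) = (\<Sum>j<N. \<Sum>i<N. (cmod (B $$ (j, i)))\<^sup>2)"
      by (rule sum.swap)
    then show ?thesis
      using B by (auto simp: frobenius_def L2_set_def sum.cartesian_product case_prod_unfold)
  qed
  finally show ?thesis
    by (simp only: frobenius_def[of A] carrier_matD[OF A])
qed

lemma frobenius_sq_cols:
  assumes "A \<in> carrier_mat N N"
  shows "(frobenius A)\<^sup>2 = (\<Sum>j<N. (vnorm (col A j))\<^sup>2)"
proof -
  have "(frobenius A)\<^sup>2 = (\<Sum>j<N. \<Sum>i<N. (cmod (A $$ (i, j)))\<^sup>2)"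
    using assms by (subst sum.swap) (auto simp: frobenius_sq)
  also have "\<dots> = (\<Sum>j<N. (vnorm (col A j))\<^sup>2)"
    using assms by (auto simp: vnorm_def L2_set_def real_sqrt_pow2 sum_nonneg intro!: sum.cong)
  finally show ?thesis .
qed

text \<open>\<open>A\<close> acts on each column of \<open>B\<close> separately, and the squared
  Frobenius norm is the sum of the squared norms of the columns.\<close>

lemma frobenius_mult_le:
  assumes A: "A \<in> carrier_mat N N" and B: "B \<in> carrier_mat N N" and b: "op_bounded A b" "b \<ge> 0"
  shows "frobenius (A * B) \<le> b * frobenius B"
proof (rule power2_le_imp_le)
  have "(frobenius (A * B))\<^sup>2 = (\<Sum>j<N. (vnorm (A *\<^sub>v col B j))\<^sup>2)"
    unfolding frobenius_sq_cols[OF mult_carrier_mat[OF A B]]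
    by (intro sum.cong refl arg_cong[where f = "\<lambda>v. (vnorm v)\<^sup>2"] col_mult2[OF A B]) auto
  also have "\<dots> \<le> (\<Sum>j<N. (b * vnorm (col B j))\<^sup>2)"
    using A B b by (intro sum_mono power_mono) (auto simp: op_bounded_def)
  also have "\<dots> = (b * frobenius B)\<^sup>2"
    using B by (simp add: power_mult_distrib frobenius_sq_cols sum_distrib_left)
  finally show "(frobenius (A * B))\<^sup>2 \<le> (b * frobenius B)\<^sup>2" .
qed (use b in auto)

text \<open>Cauchy-Schwarz in each row. The bound is crude, but it is applied only to a term that
  disappears in the limit defining the exponential.\<close>

lemma op_bounded_frobenius:
  assumes A: "A \<in> carrier_mat N N"
  shows "op_bounded A (frobenius A)"
  unfolding op_bounded_def
proof
  fix v :: "complex vec" assume "v \<in> carrier_vec (dim_col A)"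
  then have v: "v \<in> carrier_vec N" using A by auto
  show "vnorm (A *\<^sub>v v) \<le> frobenius A * vnorm v"
  proof (rule power2_le_imp_le)
    have "(vnorm (A *\<^sub>v v))\<^sup>2 = (\<Sum>i<N. (cmod ((A *\<^sub>v v) $ i))\<^sup>2)"
      using A by (auto simp: vnorm_def L2_set_def sum_nonneg)
    also have "\<dots> \<le> (\<Sum>i<N. (\<Sum>j<N. (cmod (A $$ (i, j)))\<^sup>2) * (vnorm v)\<^sup>2)"
    proof (intro sum_mono)
      fix i assume i: "i \<in> {..<N}"
      have "cmod ((A *\<^sub>v v) $ i) \<le> (\<Sum>j<N. \<bar>cmod (A $$ (i, j))\<bar> * \<bar>cmod (v $ j)\<bar>)"
        using A v i by (subst mult_mat_vec_index) (auto simp: norm_mult intro!: sum_norm_le)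
      also have "\<dots> \<le> L2_set (\<lambda>j. cmod (A $$ (i, j))) {..<N} * vnorm v"
        using v L2_set_mult_ineq[of "\<lambda>j. cmod (A $$ (i, j))" "\<lambda>j. cmod (v $ j)" "{..<N}"]
        by (auto simp: vnorm_def)
      finally have "(cmod ((A *\<^sub>v v) $ i))\<^sup>2 \<le> (L2_set (\<lambda>j. cmod (A $$ (i, j))) {..<N} * vnorm v)\<^sup>2"
        by (intro power_mono) auto
      then show "(cmod ((A *\<^sub>v v) $ i))\<^sup>2 \<le> (\<Sum>j<N. (cmod (A $$ (i, j)))\<^sup>2) * (vnorm v)\<^sup>2"
        by (simp add: power_mult_distrib L2_set_def sum_nonneg)
    qed
    also have "\<dots> = (frobenius A * vnorm v)\<^sup>2"
      using A by (auto simp: power_mult_distrib frobenius_sq sum_distrib_right)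
    finally show "(vnorm (A *\<^sub>v v))\<^sup>2 \<le> (frobenius A * vnorm v)\<^sup>2" .
  qed auto
qed

end

section \<open>A trace inequality of Hoelder type\<close>

primrec mat_prod :: "nat \<Rightarrow> (nat \<Rightarrow> complex mat) \<Rightarrow> nat \<Rightarrow> complex mat" where
  "mat_prod N f 0 = 1\<^sub>m N"
| "mat_prod N f (Suc n) = mat_prod N f n * f n"

text \<open>The Schatten norm of exponent \<open>2 ^ (k + 1)\<close>, raised to this power so that no roots occur.\<close>

definition schatten :: "nat \<Rightarrow> complex mat \<Rightarrow> real" where
  "schatten k A = Re (trace_mat ((A * mat_adjoint A) ^\<^sub>m (2 ^ k)))"

lemma prod_pair: "(\<Prod>i<2 * n. g i) = (\<Prod>i<n. g (2 * i) * g (2 * i + 1))" for g :: "nat \<Rightarrow> real"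
  by (induction n) (auto simp: mult.assoc)

context
  fixes N :: nat
begin

lemmas [simp] = mult_carrier_mat[of _ N N _ N, where 'a = complex] pow_carrier_mat[of _ N, where 'a = complex]

lemma mat_prod_carrier [simp]: "(\<And>i. i < n \<Longrightarrow> f i \<in> carrier_mat N N) \<Longrightarrow> mat_prod N f n \<in> carrier_mat N N"
  by (induction n) auto

lemma mat_prod_pair: "(\<And>i. f i \<in> carrier_mat N N) \<Longrightarrow>
    mat_prod N f (2 * n) = mat_prod N (\<lambda>i. f (2 * i) * f (2 * i + 1)) n"
  by (induction n) (auto simp: mat_assoc[of _ N])

lemma mat_prod_add: "(\<And>i. f i \<in> carrier_mat N N) \<Longrightarrow>
    mat_prod N f (m + n) = mat_prod N f m * mat_prod N (\<lambda>i. f (m + i)) n"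
  by (induction n) (auto simp: mat_assoc[of _ N] right_mult_one_mat[of _ N N])

lemma mat_prod_const: "(\<And>i. i < n \<Longrightarrow> f i = A) \<Longrightarrow> A \<in> carrier_mat N N \<Longrightarrow> mat_prod N f n = A ^\<^sub>m n"
  by (induction n) auto

lemma pow_mat_mult_shift:
  fixes A B :: "complex mat"
  assumes "A \<in> carrier_mat N N" "B \<in> carrier_mat N N"
  shows "(A * B) ^\<^sub>m Suc q = A * ((B * A) ^\<^sub>m q * B)"
  using assms by (induction q) (auto simp: mat_assoc[of _ N])

lemma trace_pow_mult_commute:
  assumes "A \<in> carrier_mat N N" "B \<in> carrier_mat N N" "q > 0"
  shows "trace_mat ((A * B) ^\<^sub>m q) = trace_mat ((B * A) ^\<^sub>m q)"
proof -
  obtain r where r: "q = Suc r" using assms by (cases q) auto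
  have "trace_mat ((A * B) ^\<^sub>m q) = trace_mat ((B * A) ^\<^sub>m r * B * A)"
    unfolding r pow_mat_mult_shift[OF assms(1,2)]
    using assms by (intro trace_mat_mult_commute[of _ N]) auto
  then show ?thesis
    using assms by (simp add: r mat_assoc[of _ N])
qed

lemma schatten_0: "A \<in> carrier_mat N N \<Longrightarrow> schatten 0 A = (frobenius A)\<^sup>2"
  by (auto simp: schatten_def trace_mult_adjoint[of _ N])

lemma mult_adjoint_hermitian:
  "A \<in> carrier_mat N N \<Longrightarrow> mat_adjoint (A * mat_adjoint A) = A * mat_adjoint (A :: complex mat)"
  by (auto simp: mat_adjoint_mult[of _ N])

lemma schatten_hermitian:
  assumes "A \<in> carrier_mat N N" "mat_adjoint A = A"
  shows "schatten k A = Re (trace_mat (A ^\<^sub>m (2 ^ (k + 1))))"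
proof -
  have "A * A = A ^\<^sub>m 2"
    using assms by (simp add: numeral_2_eq_2)
  then show ?thesis
    using assms by (simp add: schatten_def pow_mat_mult[of _ N])
qed

text \<open>For positive \<open>k\<close> the power is \<open>W * mat_adjoint W\<close>, where
  \<open>W\<close> is the Hermitian power of half the exponent; its trace is a squared Frobenius
  norm.\<close>

lemma schatten_nonneg:
  assumes "A \<in> carrier_mat N N"
  shows "schatten k A \<ge> 0"
proof (cases k)
  case 0
  then show ?thesis using assms by (simp add: schatten_0)
next
  case (Suc j)
  define W where "W = (A * mat_adjoint A) ^\<^sub>m (2 ^ j)"
  have W: "W \<in> carrier_mat N N" "mat_adjoint W = W"
    using assms by (auto simp: W_def mat_adjoint_pow[of _ N] mult_adjoint_hermitian)
  have "(A * mat_adjoint A) ^\<^sub>m (2 ^ k) = W * mat_adjoint W"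
    unfolding W(2) unfolding W_def
    using assms by (simp add: Suc mult_2 pow_mat_add[of _ N])
  then show ?thesis
    using trace_mult_adjoint[OF W(1)] by (simp add: schatten_def)
qed

lemma schatten_adjoint:
  assumes "A \<in> carrier_mat N N"
  shows "schatten k (mat_adjoint A) = schatten k A"
  using assms by (simp add: schatten_def trace_pow_mult_commute[of A "mat_adjoint A"] mat_adjoint_adjoint[of _ N])

text \<open>The induction step pairs up the factors; the resulting norms of products are traces of
  alternating products of two Hermitian matrices, to which the induction hypothesis applies again.\<close>

lemma trace_hoelder:
  assumes "\<And>i. f i \<in> carrier_mat N N"
  shows "cmod (trace_mat (mat_prod N f (2 ^ (k + 1)))) ^ (2 ^ (k + 1)) \<le> (\<Prod>i<2 ^ (k + 1). schatten k (f i))"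
  using assms
proof (induction k arbitrary: f)
  case 0
  have "mat_prod N f 2 = f 0 * f 1"
    using 0[of 0] by (simp add: numeral_2_eq_2)
  then have "cmod (trace_mat (mat_prod N f 2)) \<le> frobenius (f 0) * frobenius (f 1)"
    using 0 by (auto intro: trace_cauchy_schwarz[of _ N])
  then have "(cmod (trace_mat (mat_prod N f 2)))\<^sup>2 \<le> (frobenius (f 0) * frobenius (f 1))\<^sup>2"
    by (intro power_mono) auto
  then show ?case
    using 0 by (simp add: schatten_0 power_mult_distrib prod.lessThan_Suc eval_nat_numeral(2)[of Num.One] power2_eq_square
        algebra_simps)
next
  case (Suc k)
  define p :: nat where "p = 2 ^ k"
  have p: "p > 0" "2 ^ (k + 1) = 2 * p" "2 ^ Suc k = 2 * p" by (auto simp: p_def)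
  \<comment> \<open>In terms of norms: the Schatten norm of \<open>A * B\<close> with exponent 2 p
    is at most the product of the norms of \<open>A\<close> and \<open>B\<close> with exponent 4
    p.\<close>
  have key: "(schatten k (A * B))\<^sup>2 \<le> schatten (Suc k) A * schatten (Suc k) B"
    if A: "A \<in> carrier_mat N N" and B: "B \<in> carrier_mat N N" for A B
  proof -
    define P where "P = mat_adjoint A * A"
    define Q where "Q = B * mat_adjoint B"
    have PQ: "P \<in> carrier_mat N N" "Q \<in> carrier_mat N N" "mat_adjoint P = P" "mat_adjoint Q = Q"
      using A B by (auto simp: P_def Q_def mat_adjoint_mult[of _ N] mat_adjoint_adjoint[of _ N])
    have "(A * B) * mat_adjoint (A * B) = A * (Q * mat_adjoint A)"
      using A B by (simp add: Q_def mat_adjoint_mult[of _ N] mat_assoc[of _ N])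
    then have "trace_mat (((A * B) * mat_adjoint (A * B)) ^\<^sub>m p) = trace_mat ((Q * P) ^\<^sub>m p)"
      using A B PQ p by (simp add: trace_pow_mult_commute[of A] P_def mat_assoc[of _ N])
    \<comment> \<open>An alternating product of 2 p = 2^(k + 1) factors, just the length that the
      induction hypothesis handles.\<close>
    also have "(Q * P) ^\<^sub>m p = mat_prod N (\<lambda>i. if even i then Q else P) (2 * p)"
      using PQ by (subst mat_prod_pair) (auto simp: mat_prod_const[where A = "Q * P"])
    finally have "schatten k (A * B) \<le> cmod (trace_mat (mat_prod N (\<lambda>i. if even i then Q else P) (2 * p)))"
      by (metis schatten_def p_def complex_Re_le_cmod)
    then have "schatten k (A * B) ^ (2 * p) \<le> cmod (trace_mat (mat_prod N (\<lambda>i. if even i then Q else P) (2 * p))) ^ (2 * p)"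
      using A B by (intro power_mono schatten_nonneg) auto
    also have "\<dots> \<le> (\<Prod>i<2 * p. schatten k (if even i then Q else P))"
      using Suc.IH[of "\<lambda>i. if even i then Q else P"] PQ unfolding p by auto
    also have "\<dots> = (schatten k Q * schatten k P) ^ p"
      by (simp add: prod_pair)
    also have "schatten k Q = schatten (Suc k) B"
      using PQ by (subst schatten_hermitian) (auto simp: schatten_def Q_def)
    also have "schatten k P = schatten (Suc k) A"
      using PQ A trace_pow_mult_commute[of A "mat_adjoint A" "2 ^ Suc k"]
      by (subst schatten_hermitian) (auto simp: schatten_def P_def)
    finally have "((schatten k (A * B))\<^sup>2) ^ p \<le> (schatten (Suc k) A * schatten (Suc k) B) ^ p"
      by (simp only: power_mult mult.commute[of "schatten (Suc k) B"])
    then show ?thesis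
      using p A B by (subst (asm) power_mono_iff) (auto intro!: mult_nonneg_nonneg schatten_nonneg)
  qed
  define g where "g = (\<lambda>i. f (2 * i) * f (2 * i + 1))"
  have g: "g i \<in> carrier_mat N N" for i using Suc.prems by (simp add: g_def)
  have "mat_prod N f (2 ^ (Suc k + 1)) = mat_prod N g (2 ^ (k + 1))"
    using mat_prod_pair[of f "2 ^ (k + 1)"] Suc.prems by (simp add: g_def)
  then have "cmod (trace_mat (mat_prod N f (2 ^ (Suc k + 1)))) ^ (2 ^ (Suc k + 1))
      = (cmod (trace_mat (mat_prod N g (2 ^ (k + 1)))) ^ (2 ^ (k + 1)))\<^sup>2"
    by (simp flip: power_mult add: mult.commute)
  also have "\<dots> \<le> (\<Prod>i<2 ^ (k + 1). schatten k (g i))\<^sup>2"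
    by (intro power_mono Suc.IH g) auto
  also have "\<dots> = (\<Prod>i<2 ^ (k + 1). (schatten k (g i))\<^sup>2)"
    by (simp add: prod_power_distrib)
  also have "\<dots> \<le> (\<Prod>i<2 ^ (k + 1). schatten (Suc k) (f (2 * i)) * schatten (Suc k) (f (2 * i + 1)))"
    using Suc.prems by (intro prod_mono) (auto simp: g_def intro!: key)
  also have "\<dots> = (\<Prod>i<2 ^ (Suc k + 1). schatten (Suc k) (f i))"
    by (simp only: power_Suc Suc_eq_plus1[symmetric] prod_pair)
  finally show ?case .
qed

text \<open>Hoelder for \<open>q\<close> factors \<open>mat_adjoint E\<close> followed by
  \<open>q\<close> factors \<open>E\<close>: the trace of this product is the squared Frobenius norm
  of \<open>E ^\<^sub>m q\<close>, and all 2 q factors have the same Schatten norm.\<close>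

lemma frobenius_pow_le:
  assumes E: "E \<in> carrier_mat N N" and q: "q = 2 ^ k"
  shows "(frobenius (E ^\<^sub>m q))\<^sup>2 \<le> Re (trace_mat ((E * mat_adjoint E) ^\<^sub>m q))"
proof -
  define f where "f = (\<lambda>i. if i < q then mat_adjoint E else E)"
  have f: "f i \<in> carrier_mat N N" for i using E by (simp add: f_def)
  have q2: "2 ^ (k + 1) = q + q" by (simp add: q)
  have "mat_prod N f (q + q) = mat_adjoint E ^\<^sub>m q * E ^\<^sub>m q"
    using E by (subst mat_prod_add[OF f])
      (auto simp: mat_prod_const[where A = "mat_adjoint E"] mat_prod_const[where A = E] f_def)
  then have "trace_mat (mat_prod N f (q + q)) = (frobenius (E ^\<^sub>m q))\<^sup>2"
    using E trace_adjoint_mult[of "E ^\<^sub>m q" N] by (simp add: mat_adjoint_pow[of _ N])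
  then have "((frobenius (E ^\<^sub>m q))\<^sup>2) ^ (q + q) \<le> (\<Prod>i<q + q. schatten k (f i))"
    using trace_hoelder[of f k, OF f] unfolding q2 by (simp add: norm_power)
  also have "\<dots> = schatten k E ^ (q + q)"
  proof -
    have "schatten k (f i) = schatten k E" for i
      using E by (simp add: f_def schatten_adjoint)
    then show ?thesis by simp
  qed
  finally show ?thesis
    using E schatten_nonneg[of E k] by (subst (asm) power_mono_iff) (auto simp: q schatten_def)
qed

text \<open>With the trace as a sum of quadratic forms of \<open>B\<close>, an inequality between
  quadratic forms turns into one between traces.\<close>

lemma trace_adjoint_mult_cols:
  assumes "V \<in> carrier_mat N N" "B \<in> carrier_mat N N"
  shows "trace_mat (mat_adjoint V * (B * V)) = (\<Sum>j<N. vinner (col V j) (B *\<^sub>v col V j))"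
proof -
  have "(B *\<^sub>v col V j) $ i = (B * V) $$ (i, j)" if "i < N" "j < N" for i j
    using assms that by (auto simp: mult_mat_vec_index mat_mult_index)
  then show ?thesis
    using assms by (auto simp: trace_mat_mult[of _ N] vinner_def intro!: sum.cong)

qed

text \<open>Powers need not preserve the operator order, but traces of powers do. With
  \<open>A = E * mat_adjoint E\<close>, replacing one factor of A^p by \<open>B\<close> does not
  decrease the trace, and Hoelder bounds the trace of A^(p - 1) B by (tr A^p)^((p - 1) / p) (tr
  B^p)^(1 / p); then the power of tr A^p cancels.\<close>

lemma trace_pow_mono:
  assumes E: "E \<in> carrier_mat N N" and B: "B \<in> carrier_mat N N" "mat_adjoint B = B"
    and le: "\<And>v. v \<in> carrier_vec N \<Longrightarrow> (vnorm (mat_adjoint E *\<^sub>v v))\<^sup>2 \<le> Re (vinner v (B *\<^sub>v v))"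
    and p: "p = 2 ^ (k + 1)"
  shows "Re (trace_mat ((E * mat_adjoint E) ^\<^sub>m p)) \<le> Re (trace_mat (B ^\<^sub>m p))"
proof -
  define A where "A = E * mat_adjoint E"
  have A: "A \<in> carrier_mat N N" "mat_adjoint A = A"
    using E by (auto simp: A_def mult_adjoint_hermitian)
  \<comment> \<open>Since \<open>p - 1 = 2 * r + 1\<close> is odd, A^(p - 1) splits as
    \<open>V * mat_adjoint V\<close> with \<open>V = A ^\<^sub>m r * E\<close>, without a square
    root of \<open>A\<close>.\<close>
  define r :: nat where "r = 2 ^ k - 1"
  have "Suc r = 2 ^ k" by (simp add: r_def)
  then have pr: "p = Suc (Suc (r + r))" unfolding p by simp
  define V where "V = A ^\<^sub>m r * E"
  have V: "V \<in> carrier_mat N N" using A E by (simp add: V_def)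
  have V_adj: "mat_adjoint V = mat_adjoint E * A ^\<^sub>m r"
    using A E by (simp add: V_def mat_adjoint_mult[of _ N] mat_adjoint_pow[of _ N])
  have "V * mat_adjoint V = A ^\<^sub>m r * (E * mat_adjoint E) * A ^\<^sub>m r"
    using A E unfolding V_adj unfolding V_def by (simp add: mat_assoc[of _ N])
  also have "\<dots> = A ^\<^sub>m r * A * A ^\<^sub>m r"
    by (simp add: A_def)
  also have "\<dots> = A ^\<^sub>m Suc (r + r)"
    using A by (simp add: pow_mat_commute[of A N]) (simp add: pow_mat_add[of _ N] mat_assoc[of _ N])
  finally have VV: "V * mat_adjoint V = A ^\<^sub>m Suc (r + r)" .
  have tr_VV: "trace_mat (A ^\<^sub>m Suc (r + r) * X) = trace_mat (mat_adjoint V * (X * V))"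
    if "X \<in> carrier_mat N N" for X
    unfolding VV[symmetric] using V that
    by (simp add: mat_assoc[of _ N] trace_mat_mult_commute[of V N])
  define a where "a = Re (trace_mat (A ^\<^sub>m p))"
  define b where "b = Re (trace_mat (B ^\<^sub>m p))"
  have a: "schatten k A = a" and b: "schatten k B = b"
    using A B by (simp_all add: schatten_hermitian a_def b_def p)
  have ab: "a \<ge> 0" "b \<ge> 0"
    using A B schatten_nonneg[of _ k] by (auto simp flip: a b)
  have "a = Re (trace_mat (mat_adjoint V * (A * V)))"
    using tr_VV[of A] A by (simp add: a_def pr)
  also have "mat_adjoint V * (A * V) = mat_adjoint (mat_adjoint E * V) * (mat_adjoint E * V)"
    using V E by (simp add: A_def mat_adjoint_mult[of _ N] mat_assoc[of _ N] mat_adjoint_adjoint[of _ N])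
  also have "Re (trace_mat \<dots>) = (\<Sum>j<N. (vnorm (mat_adjoint E *\<^sub>v col V j))\<^sup>2)"
  proof -
    have "col (mat_adjoint E * V) j = mat_adjoint E *\<^sub>v col V j" if "j < N" for j
      using E V that by (intro col_mult2[of _ N N _ N]) auto
    then show ?thesis
      using E V by (simp add: trace_adjoint_mult[of _ N] frobenius_sq_cols[of _ N] del: col_mult2)
  qed
  also have "\<dots> \<le> (\<Sum>j<N. Re (vinner (col V j) (B *\<^sub>v col V j)))"
    using V by (intro sum_mono le) auto
  also have "\<dots> = Re (trace_mat (A ^\<^sub>m Suc (r + r) * B))"
    unfolding tr_VV[OF B(1)] using V B by (simp add: trace_adjoint_mult_cols)
  also have "\<dots> \<le> cmod (trace_mat (A ^\<^sub>m Suc (r + r) * B))"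
    by (rule complex_Re_le_cmod)
  finally have "a ^ p \<le> cmod (trace_mat (A ^\<^sub>m Suc (r + r) * B)) ^ p"
    using ab by (intro power_mono) auto
  also have "A ^\<^sub>m Suc (r + r) * B = mat_prod N (\<lambda>i. if i < Suc (r + r) then A else B) p"
    unfolding pr mat_prod.simps(2)[of _ _ "Suc (r + r)"]
    using A by (subst mat_prod_const[where A = A]) auto
  also have "cmod (trace_mat \<dots>) ^ p \<le> (\<Prod>i<p. schatten k (if i < Suc (r + r) then A else B))"
    using trace_hoelder[of "\<lambda>i. if i < Suc (r + r) then A else B" k] A B by (simp add: p)
  also have "\<dots> = a ^ Suc (r + r) * b"
    unfolding pr prod.lessThan_Suc[of _ "Suc (r + r)"] by (simp add: a b)
  finally have "a ^ Suc (r + r) * a \<le> a ^ Suc (r + r) * b"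
    unfolding pr by (simp add: mult.commute)
  then have "a \<le> b"
    using ab by (cases "a = 0") (auto simp: mult_le_cancel_left)
  then show ?thesis
    by (simp add: a_def b_def A_def)
qed

end

section \<open>Diagonalization and the exponential\<close>

text \<open>A one above the diagonal lies inside a single block, so its column of the transformation
  is a generalised eigenvector for the eigenvalue of the preceding column. In this form the absence
  of such ones can be tested entry by entry.\<close>

lemma jordan_matrix_entries:
  assumes "i < sum_list (map fst n_as)" "j < sum_list (map fst n_as)"
  shows "jordan_matrix n_as $$ (i, j) = (0 :: complex) \<or> i = j \<or>
    (j = Suc i \<and> jordan_matrix n_as $$ (i, j) = 1 \<and> jordan_matrix n_as $$ (i, i) = jordan_matrix n_as $$ (j, j))"
  using assms
proof (induction n_as arbitrary: i j)
  case Nil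
  then show ?case by simp
next
  case (Cons na n_as)
  obtain n a where na: "na = (n, a)" by (cases na)
  have J: "jordan_matrix (na # n_as) = four_block_mat (jordan_block n a)
      (0\<^sub>m n (sum_list (map fst n_as))) (0\<^sub>m (sum_list (map fst n_as)) n) (jordan_matrix n_as)"
    by (simp add: na jordan_matrix_def Let_def) (simp flip: jordan_matrix_def)
  show ?case
  proof (cases "i < n \<or> j < n")
    case True
    then show ?thesis using Cons.prems unfolding J by (auto simp: na)
  next
    case False
    then obtain i' j' where "i = n + i'" "j = n + j'"
      by (metis le_Suc_ex linorder_not_less)
    then show ?thesis
      using Cons.prems Cons.IH[of i' j'] unfolding J by (auto simp: na)
  qed
qed

context
  fixes N :: nat
begin

lemma hermitian_inner:
  assumes "A \<in> carrier_mat N N" "mat_adjoint A = A" "u \<in> carrier_vec N" "v \<in> carrier_vec N"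
  shows "vinner u (A *\<^sub>v v) = vinner (A *\<^sub>v u) v"
  using inner_adjoint[of A N u v] assms by simp

text \<open>The spectral theorem from the Jordan normal form: a one above the diagonal would give
  \<open>A v = u + l v\<close> with an eigenvector \<open>u\<close>, which Hermiticity excludes.
  \<open>P\<close> is merely invertible; this suffices for traces of powers and for intertwining
  relations.\<close>

lemma hermitian_diagonalizable:
  assumes A: "A \<in> carrier_mat N N" "mat_adjoint A = A"
  obtains P Q h where "P \<in> carrier_mat N N" "Q \<in> carrier_mat N N" "P * Q = 1\<^sub>m N" "Q * P = 1\<^sub>m N"
    "A = P * mat_diag N (\<lambda>i. complex_of_real (h i)) * Q"
proof -
  obtain as where "char_poly A = (\<Prod>a\<leftarrow>as. [:- a, 1:])"
    using char_poly_factorized[OF A(1)] by auto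
  then obtain n_as where "jordan_nf A n_as"
    using jordan_nf_exists[OF A(1)] by auto
  then obtain P Q where "similar_mat_wit A (jordan_matrix n_as) P Q"
    by (auto simp: jordan_nf_def similar_mat_def)
  define J where "J = jordan_matrix n_as"
  note wit = similar_mat_witD2[OF A(1) \<open>similar_mat_wit A (jordan_matrix n_as) P Q\<close>, folded J_def]
  have PQ: "P \<in> carrier_mat N N" "Q \<in> carrier_mat N N" "J \<in> carrier_mat N N" "P * Q = 1\<^sub>m N" "Q * P = 1\<^sub>m N"
    "A = P * J * Q"
    using wit by auto
  have "sum_list (map fst n_as) = N"
    using PQ(3) unfolding J_def by (metis carrier_matD(1) jordan_matrix_dim(1))
  then have J: "J $$ (i, j) = 0 \<or> i = j \<or> (j = Suc i \<and> J $$ (i, j) = 1 \<and> J $$ (i, i) = J $$ (j, j))"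
    if "i < N" "j < N" for i j
    using jordan_matrix_entries[of i n_as j] that by (simp add: J_def)
  have "A * P = P * J * (Q * P)"
    using PQ by (simp add: mat_assoc[of _ N])
  then have AP: "A * P = P * J"
    using PQ by simp
  have col_AP: "A *\<^sub>v col P j = vec N (\<lambda>k. \<Sum>l<N. P $$ (k, l) * J $$ (l, j))" if "j < N" for j
  proof -
    have "A *\<^sub>v col P j = col (P * J) j"
      using A PQ that by (metis AP col_mult2)
    also have "\<dots> = vec N (\<lambda>k. \<Sum>l<N. P $$ (k, l) * J $$ (l, j))"
      using PQ(1,3) that by (auto intro!: eq_vecI simp: mult_mat_vec_index col_mult2[of P N N J N] simp del: col_mult)
    finally show ?thesis .
  qed
  have col_P: "col P j \<in> carrier_vec N" for j using PQ by auto
  have P0: "vnorm (col P j) > 0" if "j < N" for j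
  proof (rule ccontr)
    assume "\<not> vnorm (col P j) > 0"
    then have "vnorm (col P j) = 0"
      using vnorm_nonneg[of "col P j"] by linarith
    then have "P $$ (k, j) = 0" if "k < N" for k
      using PQ \<open>j < N\<close> that by (auto simp: vnorm_def L2_set_eq_0_iff)
    then have "(Q * P) $$ (j, j) = 0"
      using PQ(1,2) that by (auto simp: mat_mult_index)
    then show False
      using PQ that by simp
  qed
  have real: "cnj l = l"
    if "A *\<^sub>v col P i = l \<cdot>\<^sub>v col P i" "i < N" for l i
  proof -
    define u where "u = col P i"
    have u: "u \<in> carrier_vec N" "A *\<^sub>v u = l \<cdot>\<^sub>v u" using that col_P by (auto simp: u_def)
    have "l * vinner u u = vinner u (A *\<^sub>v u)"
      using u by (simp add: vinner_smult_right[of _ N])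
    also have "\<dots> = cnj (vinner u (A *\<^sub>v u))"
      using u A by (metis hermitian_inner vinner_commute mult_mat_vec_carrier)
    also have "\<dots> = cnj l * vinner u u"
      using u by (simp add: vinner_smult_right[of _ N] vinner_self)
    finally show ?thesis
      using P0[OF that(2)] by (simp add: vinner_self u_def)
  qed
  \<comment> \<open>Strong induction, because \<open>col P i\<close> is a genuine eigenvector only
    once the entry of \<open>J\<close> above the diagonal in column \<open>i\<close> is known to
    vanish.\<close>
  have no_super: "J $$ (i, Suc i) = 0" if "Suc i < N" for i
    using that
  proof (induction i rule: less_induct)
    case (less i)
    define l where "l = J $$ (i, i)"
    show ?case
    proof (rule ccontr)
      assume "J $$ (i, Suc i) \<noteq> 0"
      with J[of i "Suc i"] less.prems have s: "J $$ (i, Suc i) = 1" "J $$ (Suc i, Suc i) = l"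
        by (auto simp: l_def)
      have i: "i < N" "Suc i < N" using less.prems by auto
      have Ji: "J $$ (k, i) = (if k = i then l else 0)" if "k < N" for k
        using J[of k i] less.IH[of k] that i by (auto simp: l_def)
      have Jsi: "J $$ (k, Suc i) = (if k = i then 1 else 0) + (if k = Suc i then l else 0)" if "k < N" for k
        using J[of k "Suc i"] that i s by auto
      define u v where "u = col P i" and "v = col P (Suc i)"
      have uv: "u \<in> carrier_vec N" "v \<in> carrier_vec N" using col_P by (auto simp: u_def v_def)
      have Au: "A *\<^sub>v u = l \<cdot>\<^sub>v u"
        using i PQ(1) by (auto simp: u_def col_AP Ji if_distrib cong: if_cong intro!: eq_vecI)
      have Av: "A *\<^sub>v v = u + l \<cdot>\<^sub>v v"
        using i PQ(1) by (auto simp: u_def v_def col_AP Jsi sum.distrib distrib_left if_distrib[of "(*) _"] cong: if_cong intro!: eq_vecI)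
      \<comment> \<open>The inner product of \<open>u\<close> and \<open>A v\<close>, evaluated
        directly and with \<open>A\<close> moved to \<open>u\<close>. Since \<open>l\<close> is
        real, the terms with \<open>l\<close> cancel and \<open>vinner u u = 0\<close>
        remains.\<close>
      have "vinner u u + l * vinner u v = vinner u (A *\<^sub>v v)"
        using uv by (simp add: Av vinner_add_right[of _ N] vinner_smult_right[of _ N])
      also have "\<dots> = vinner (l \<cdot>\<^sub>v u) v"
        using uv A by (simp add: hermitian_inner Au)
      also have "\<dots> = cnj l * vinner u v"
        using uv by (simp add: vinner_commute[of v N] vinner_smult_right[of _ N])
      also have "cnj l = l"
        using real[of i l] Au i by (simp add: u_def)
      finally show False
        using P0[of i] i by (simp add: vinner_self u_def)
    qed
  qed
  have Jd: "J $$ (k, i) = 0" if "k < N" "i < N" "k \<noteq> i" for k i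
    using J[of k i] no_super[of k] that by auto
  have "A *\<^sub>v col P i = J $$ (i, i) \<cdot>\<^sub>v col P i" if i: "i < N" for i
  proof
    fix k assume "k < dim_vec (J $$ (i, i) \<cdot>\<^sub>v col P i)"
    then have k: "k < N" using PQ(1) by auto
    have "(\<Sum>l<N. P $$ (k, l) * J $$ (l, i)) = (\<Sum>l<N. if l = i then P $$ (k, i) * J $$ (i, i) else 0)"
      using i by (intro sum.cong) (auto simp: Jd)
    then show "(A *\<^sub>v col P i) $ k = (J $$ (i, i) \<cdot>\<^sub>v col P i) $ k"
      using i k PQ(1) by (simp add: col_AP)
  qed (use A PQ(1) in auto)
  then have "cnj (J $$ (i, i)) = J $$ (i, i)" if "i < N" for i
    using real that by blast
  then have "complex_of_real (Re (J $$ (i, i))) = J $$ (i, i)" if "i < N" for i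
    using that by (metis Reals_cnj_iff of_real_Re)
  then have J_eq: "J = mat_diag N (\<lambda>i. complex_of_real (Re (J $$ (i, i))))"
    using PQ(3) by (intro eq_matI) (auto simp: mat_diag_def Jd)
  have "A = P * mat_diag N (\<lambda>i. complex_of_real (Re (J $$ (i, i)))) * Q"
    unfolding J_eq[symmetric] by (rule PQ(6))
  then show ?thesis
    by (rule that[OF PQ(1,2,4,5)])
qed

lemma pow_mat_similar:
  fixes P Q D :: "complex mat"
  assumes "P \<in> carrier_mat N N" "Q \<in> carrier_mat N N" "D \<in> carrier_mat N N" "P * Q = 1\<^sub>m N" "Q * P = 1\<^sub>m N"
  shows "(P * D * Q) ^\<^sub>m k = P * D ^\<^sub>m k * Q"
  by (rule similar_mat_wit_pow_id[of "P * D * Q" D P Q])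
    (use assms in \<open>auto simp: similar_mat_wit_def Let_def\<close>)

lemma mat_diag_pow: "mat_diag N f ^\<^sub>m k = mat_diag N (\<lambda>i. f i ^ k :: complex)"
proof (induction k)
  case 0
  show ?case by (auto simp: mat_diag_def)
qed (simp add: mult.commute)

lemma trace_affine_pow:
  assumes P: "P \<in> carrier_mat N N" "Q \<in> carrier_mat N N" "P * Q = 1\<^sub>m N" "Q * P = 1\<^sub>m N"
    and A: "A = P * mat_diag N h * Q"
  shows "trace_mat ((c1 \<cdot>\<^sub>m 1\<^sub>m N + c2 \<cdot>\<^sub>m A) ^\<^sub>m k) = (\<Sum>i<N. (c1 + c2 * h i) ^ k)"
proof -
  have "c1 \<cdot>\<^sub>m 1\<^sub>m N + c2 \<cdot>\<^sub>m A = c1 \<cdot>\<^sub>m (P * Q) + c2 \<cdot>\<^sub>m (P * mat_diag N h * Q)"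
    by (simp add: P A)
  also have "\<dots> = P * (c1 \<cdot>\<^sub>m 1\<^sub>m N) * Q + P * (c2 \<cdot>\<^sub>m mat_diag N h) * Q"
    using P by (simp add: mat_smult_right[of _ N] mat_smult_left[of _ N] del: P(3,4))
  also have "\<dots> = P * (c1 \<cdot>\<^sub>m 1\<^sub>m N + c2 \<cdot>\<^sub>m mat_diag N h) * Q"
    using P by (simp add: mat_add_left[of _ N] mat_add_right[of _ N])
  also have "c1 \<cdot>\<^sub>m 1\<^sub>m N + c2 \<cdot>\<^sub>m mat_diag N h = mat_diag N (\<lambda>i. c1 + c2 * h i)"
    by (auto intro!: eq_matI simp: mat_diag_def)
  finally have "(c1 \<cdot>\<^sub>m 1\<^sub>m N + c2 \<cdot>\<^sub>m A) ^\<^sub>m k = P * mat_diag N (\<lambda>i. (c1 + c2 * h i) ^ k) * Q"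
    using P by (simp add: pow_mat_similar mat_diag_pow)
  then have "trace_mat ((c1 \<cdot>\<^sub>m 1\<^sub>m N + c2 \<cdot>\<^sub>m A) ^\<^sub>m k) = trace_mat (Q * (P * mat_diag N (\<lambda>i. (c1 + c2 * h i) ^ k)))"
    using P by (simp only:) (intro trace_mat_mult_commute[of _ N]; simp)
  also have "Q * (P * mat_diag N (\<lambda>i. (c1 + c2 * h i) ^ k)) = mat_diag N (\<lambda>i. (c1 + c2 * h i) ^ k)"
    using P by (simp flip: mat_assoc[of Q N P] add: left_mult_one_mat[of _ N N])
  also have "trace_mat \<dots> = (\<Sum>i<N. (c1 + c2 * h i) ^ k)"
    using P by (simp add: trace_mat_def mat_diag_def)
  finally show ?thesis .
qed

lemma pow_mat_entry_bound:
  assumes "X \<in> carrier_mat N N" "\<And>i j. i < N \<Longrightarrow> j < N \<Longrightarrow> cmod (X $$ (i, j)) \<le> b" "i < N" "j < N"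
  shows "cmod ((X ^\<^sub>m k) $$ (i, j)) \<le> (real N * b) ^ k"
  using assms(3,4)
proof (induction k arbitrary: i j)
  case 0
  then show ?case using assms(1) by simp
next
  case (Suc k)
  have b: "b \<ge> 0" using assms(2)[OF Suc.prems] norm_ge_zero order_trans by blast
  have "cmod ((X ^\<^sub>m Suc k) $$ (i, j)) \<le> (\<Sum>l<N. cmod ((X ^\<^sub>m k) $$ (i, l)) * cmod (X $$ (l, j)))"
    using assms(1) Suc.prems by (auto simp: mat_mult_index norm_mult[symmetric] intro!: sum_norm_le)
  also have "\<dots> \<le> (\<Sum>l<N. (real N * b) ^ k * b)"
    using Suc b assms(2) by (intro sum_mono mult_mono) auto
  finally show ?case by (simp add: algebra_simps)
qed

text \<open>The upper limit \<open>K\<close> is free above \<open>m\<close>, where the binomial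
  coefficients vanish; the induction step needs the hypothesis with two different limits.\<close>

lemma one_plus_pow_entry:
  fixes X :: "complex mat"
  assumes X: "X \<in> carrier_mat N N" and "i < N" "j < N" "m \<le> K"
  shows "((1\<^sub>m N + c \<cdot>\<^sub>m X) ^\<^sub>m m) $$ (i, j) = (\<Sum>k\<le>K. of_nat (m choose k) * c ^ k * (X ^\<^sub>m k) $$ (i, j))"
  using assms(2-)
proof (induction m arbitrary: i j K)
  case 0
  then show ?case using X by (simp add: if_distrib binomial_eq_0_iff sum.atMost_shift)
next
  case (Suc m)
  then obtain L where L: "K = Suc L" "m \<le> L" by (cases K) auto
  define Y where "Y = (1\<^sub>m N + c \<cdot>\<^sub>m X) ^\<^sub>m m"
  have Y: "Y \<in> carrier_mat N N" using X by (simp add: Y_def)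
  have IH: "Y $$ (i, j) = (\<Sum>k\<le>K. of_nat (m choose k) * c ^ k * (X ^\<^sub>m k) $$ (i, j))"
    if "i < N" "j < N" "m \<le> K" for i j K
    using Suc.IH[OF that] by (simp add: Y_def)
  have "Y * (1\<^sub>m N + c \<cdot>\<^sub>m X) = Y + c \<cdot>\<^sub>m (Y * X)"
    using X Y by (simp add: mat_add_right[of _ N] mat_smult_right[of _ N] right_mult_one_mat[of _ N N])
  then have "((1\<^sub>m N + c \<cdot>\<^sub>m X) ^\<^sub>m Suc m) $$ (i, j) = Y $$ (i, j) + c * (\<Sum>l<N. Y $$ (i, l) * X $$ (l, j))"
    using X Y Suc.prems by (simp add: mat_mult_index Y_def[symmetric])
  also have "(\<Sum>l<N. Y $$ (i, l) * X $$ (l, j)) =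
      (\<Sum>l<N. \<Sum>k\<le>L. of_nat (m choose k) * c ^ k * ((X ^\<^sub>m k) $$ (i, l) * X $$ (l, j)))"
    using Suc.prems L by (auto simp: IH[of _ _ L] sum_distrib_right mult.assoc intro!: sum.cong)
  also have "\<dots> = (\<Sum>k\<le>L. \<Sum>l<N. of_nat (m choose k) * c ^ k * ((X ^\<^sub>m k) $$ (i, l) * X $$ (l, j)))"
    by (rule sum.swap)
  also have "\<dots> = (\<Sum>k\<le>L. of_nat (m choose k) * c ^ k * (X ^\<^sub>m Suc k) $$ (i, j))"
    using X Suc.prems by (auto simp: mat_mult_index sum_distrib_left intro!: sum.cong)
  also have "Y $$ (i, j) + c * \<dots> = (\<Sum>k\<le>Suc L. of_nat (m choose k) * c ^ k * (X ^\<^sub>m k) $$ (i, j)) +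
      (\<Sum>k\<le>L. of_nat (m choose k) * c ^ Suc k * (X ^\<^sub>m Suc k) $$ (i, j))"
    using Suc.prems L by (simp only: IH[of i j "Suc L"]) (simp add: sum_distrib_left mult_ac)
  also have "\<dots> = (\<Sum>k\<le>Suc L. of_nat (Suc m choose k) * c ^ k * (X ^\<^sub>m k) $$ (i, j))"
    unfolding sum.atMost_Suc_shift[of _ L] by (simp add: sum.distrib algebra_simps)
  finally show ?case by (simp add: L)
qed

lemma choose_div_pow_le: "real (m choose k) / real m ^ k \<le> 1 / fact k"
proof (cases "m = 0")
  case True
  then show ?thesis by (cases k) auto
next
  case False
  have "real (m choose k) * fact k \<le> real m ^ k"
    using binomial_fact_pow[of m k] by (metis of_nat_fact of_nat_le_iff of_nat_mult of_nat_power)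
  then show ?thesis using False by (simp add: field_simps)
qed

text \<open>The quotient is \<open>1 / fact k\<close> times the product of 1 - i / m over i <
  k.\<close>

lemma choose_div_pow_tendsto: "(\<lambda>m. real (m choose k) / real m ^ k) \<longlonglongrightarrow> 1 / fact k"
proof -
  have "(\<lambda>m. (\<Prod>i<k. 1 - real i * inverse (real m)) / fact k) \<longlonglongrightarrow> (\<Prod>i<k. 1 - real i * 0) / fact k"
    by (intro tendsto_intros tendsto_inverse_0_at_top filterlim_real_sequentially) auto
  moreover have "eventually (\<lambda>m. (\<Prod>i<k. 1 - real i * inverse (real m)) / fact k = real (m choose k) / real m ^ k) at_top"
    using eventually_gt_at_top[of 0]
  proof eventually_elim
    case (elim m)
    have "real (m choose k) = (\<Prod>i<k. real m - real i) / fact k"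
      by (simp add: binomial_gbinomial gbinomial_prod_rev atLeast0LessThan)
    also have "(\<Prod>i<k. real m - real i) = (\<Prod>i<k. real m * (1 - real i * inverse (real m)))"
      using elim by (intro prod.cong) (auto simp: field_simps)
    finally show ?case using elim by (simp add: prod.distrib)
  qed
  ultimately show ?thesis
    by (simp add: tendsto_cong)
qed

text \<open>Tannery's theorem for the binomial expansion: its coefficients (m choose k) / m^k
  converge to 1 / k! and never exceed it, so an exponential series built from a bound on the entries
  dominates.\<close>

lemma exp_mat_limit:
  assumes X: "X \<in> carrier_mat N N" and ij: "i < N" "j < N"
  shows "(\<lambda>m. ((1\<^sub>m N + complex_of_real (1 / real m) \<cdot>\<^sub>m X) ^\<^sub>m m) $$ (i, j)) \<longlonglongrightarrow> exp_mat X $$ (i, j)"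
proof -
  obtain b where b: "\<And>i j. i < N \<Longrightarrow> j < N \<Longrightarrow> cmod (X $$ (i, j)) \<le> b"
  proof
    fix i j assume "i < N" "j < N"
    then have "cmod (X $$ (i, j)) \<le> (\<Sum>i<N. \<Sum>j<N. cmod (X $$ (i, j)))"
      by (intro order_trans[OF member_le_sum[of j "{..<N}" "\<lambda>j. cmod (X $$ (i, j))"]]
        member_le_sum[of i "{..<N}" "\<lambda>i. \<Sum>j<N. cmod (X $$ (i, j))"] sum_nonneg) auto
    then show "cmod (X $$ (i, j)) \<le> (\<Sum>i<N. \<Sum>j<N. cmod (X $$ (i, j)))" .
  qed
  define r where "r = real N * b"
  define a where "a = (\<lambda>k m. complex_of_real (real (m choose k) / real m ^ k) * (X ^\<^sub>m k) $$ (i, j))"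
  have bd: "norm (a k m) \<le> inverse (fact k) * r ^ k" for k m
  proof -
    have "norm (a k m) = real (m choose k) / real m ^ k * cmod ((X ^\<^sub>m k) $$ (i, j))"
      by (simp add: a_def norm_mult norm_divide norm_power)
    also have "\<dots> \<le> 1 / fact k * r ^ k"
      unfolding r_def using X b ij
      by (intro mult_mono choose_div_pow_le pow_mat_entry_bound) auto
    finally show ?thesis by (simp add: field_simps)
  qed
  have "(\<lambda>m. suminf (\<lambda>k. a k m)) \<longlonglongrightarrow> suminf (\<lambda>k. complex_of_real (1 / fact k) * (X ^\<^sub>m k) $$ (i, j))"
  proof (intro conjunct2[OF conjunct2[OF tannerys_theorem[where M = "\<lambda>k. inverse (fact k) * r ^ k"]]])
    show "summable (\<lambda>k. inverse (fact k) * r ^ k)"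
      using summable_exp[of r] by simp
    show "(\<lambda>m. a k m) \<longlonglongrightarrow> complex_of_real (1 / fact k) * (X ^\<^sub>m k) $$ (i, j)" for k
      unfolding a_def by (intro tendsto_mult tendsto_of_real choose_div_pow_tendsto tendsto_const)
    show "\<forall>\<^sub>F (k, m) in sequentially \<times>\<^sub>F sequentially. norm (a k m) \<le> inverse (fact k) * r ^ k"
      by (rule always_eventually) (use bd in auto)
  qed simp
  moreover have "suminf (\<lambda>k. a k m) = ((1\<^sub>m N + complex_of_real (1 / real m) \<cdot>\<^sub>m X) ^\<^sub>m m) $$ (i, j)" for m
  proof -
    have "suminf (\<lambda>k. a k m) = (\<Sum>k\<le>m. a k m)"
      by (intro suminf_finite) (auto simp: a_def binomial_eq_0)
    then show ?thesis
      using one_plus_pow_entry[OF X ij, of m m "complex_of_real (1 / real m)"]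
      by (simp add: a_def power_divide divide_simps)
  qed
  ultimately show ?thesis
    using X ij by (simp add: exp_mat_def field_simps)
qed

lemma exp_mat_carrier [simp]: "X \<in> carrier_mat N N \<Longrightarrow> exp_mat X \<in> carrier_mat N N"
  by (auto simp: exp_mat_def)

lemma trace_exp_limit:
  assumes X: "X \<in> carrier_mat N N" and D: "D \<in> carrier_mat N N"
  shows "(\<lambda>m. trace_mat (D * (1\<^sub>m N + complex_of_real (1 / real m) \<cdot>\<^sub>m X) ^\<^sub>m m)) \<longlonglongrightarrow> trace_mat (D * exp_mat X)"
proof -
  have "(1\<^sub>m N + complex_of_real (1 / real m) \<cdot>\<^sub>m X) ^\<^sub>m m \<in> carrier_mat N N" for m :: nat
    using X by simp
  note tr = trace_mat_mult[OF D this] trace_mat_mult[OF D exp_mat_carrier[OF X]]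
  show ?thesis
    unfolding tr by (intro tendsto_intros exp_mat_limit[OF X]) auto
qed

end

section \<open>Gibbs states under similarity transformations\<close>

context
  fixes N :: nat
begin

lemmas [simp] = mult_mat_vec_carrier[of _ N N, where 'a = complex]

lemma smult_mat_vec:
  "A \<in> carrier_mat N N \<Longrightarrow> v \<in> carrier_vec N \<Longrightarrow> (c \<cdot>\<^sub>m A) *\<^sub>v v = c \<cdot>\<^sub>v (A *\<^sub>v v)" for A :: "complex mat"
  by (auto intro!: eq_vecI simp: mult_mat_vec_index sum_distrib_left mult.assoc)

lemma vnorm_add_sq:
  assumes "u \<in> carrier_vec N" "v \<in> carrier_vec N"
  shows "(vnorm (u + v))\<^sup>2 = (vnorm u)\<^sup>2 + 2 * Re (vinner u v) + (vnorm v)\<^sup>2"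
proof -
  have "complex_of_real ((vnorm (u + v))\<^sup>2) = vinner (u + v) u + vinner (u + v) v"
    unfolding vinner_self[symmetric] using assms by (simp add: vinner_add_right[of _ N])
  also have "\<dots> = cnj (vinner u (u + v)) + cnj (vinner v (u + v))"
    using assms by (simp add: vinner_commute[of u N "u + v"] vinner_commute[of v N "u + v"])
  also have "\<dots> = vinner u u + (vinner u v + cnj (vinner u v)) + vinner v v"
    using assms by (simp add: vinner_add_right[of _ N] vinner_commute[of u N v] vinner_self)
  also have "vinner u v + cnj (vinner u v) = complex_of_real (2 * Re (vinner u v))"
    by (simp add: complex_add_cnj)
  finally show ?thesis
    unfolding vinner_self by (metis of_real_add of_real_eq_iff)
qed

text \<open>With \<open>E = 1 + X / (2 q)\<close>, the Cauchy-Schwarz and Hoelder inequalities bound the trace of \<open>D E\<close> to the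
  power \<open>2 q\<close> by that of \<open>(E E\<^sup>*)\<^sup>q\<close>, and \<open>E E\<^sup>*\<close> is dominated by an affine function of \<open>H\<close>, whose
  powers are evaluated on the spectrum.\<close>

lemma trace_poly_bound:
  assumes X: "X \<in> carrier_mat N N" and H: "H \<in> carrier_mat N N" "mat_adjoint H = H" and D: "D \<in> carrier_mat N N"
    and P: "P \<in> carrier_mat N N" "Q \<in> carrier_mat N N" "P * Q = 1\<^sub>m N" "Q * P = 1\<^sub>m N"
    and diag: "H = P * mat_diag N (\<lambda>i. complex_of_real (h i)) * Q"
    and le: "\<And>v. v \<in> carrier_vec N \<Longrightarrow> Re (vinner v (X *\<^sub>v v)) \<le> b * (vnorm v)\<^sup>2 - Re (vinner v (H *\<^sub>v v))"
    and w: "op_bounded D w" "w \<ge> 0"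
    and q: "q = 2 ^ (k + 1)"
  shows "cmod (trace_mat (D * (1\<^sub>m N + complex_of_real (1 / real (2 * q)) \<cdot>\<^sub>m X) ^\<^sub>m (2 * q)))
    \<le> w * (\<Sum>i<N. (1 + (b - h i) / q + (frobenius (mat_adjoint X))\<^sup>2 / (2 * real q)\<^sup>2) ^ q)"
proof -
  define f where "f = frobenius (mat_adjoint X)"
  define c where "c = 1 / real (2 * q)"
  define E where "E = 1\<^sub>m N + complex_of_real c \<cdot>\<^sub>m X"
  \<comment> \<open>From expanding \<open>E * mat_adjoint E\<close> with step
    \<open>c = 1 / (2 q)\<close>: the linear terms give \<open>b / q\<close> and
    \<open>- 1 / q\<close> times \<open>H\<close>, and the last summand bounds the quadratic
    term.\<close>
  define c1 where "c1 = 1 + b / q + f\<^sup>2 / (2 * real q)\<^sup>2"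
  define B where "B = complex_of_real c1 \<cdot>\<^sub>m 1\<^sub>m N + complex_of_real (- 1 / q) \<cdot>\<^sub>m H"
  have E: "E \<in> carrier_mat N N" using X by (simp add: E_def)
  have B: "B \<in> carrier_mat N N" "mat_adjoint B = B"
    using H by (auto simp: B_def mat_adjoint_add[of _ N] mat_adjoint_smult[of _ N])
  have EB: "(vnorm (mat_adjoint E *\<^sub>v v))\<^sup>2 \<le> Re (vinner v (B *\<^sub>v v))" if v: "v \<in> carrier_vec N" for v
  proof -
    define y where "y = mat_adjoint X *\<^sub>v v"
    have y: "y \<in> carrier_vec N" using X v by (simp add: y_def)
    have "mat_adjoint E = 1\<^sub>m N + complex_of_real c \<cdot>\<^sub>m mat_adjoint X"
      using X by (simp add: E_def mat_adjoint_add[of _ N] mat_adjoint_smult[of _ N])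
    then have "mat_adjoint E *\<^sub>v v = v + complex_of_real c \<cdot>\<^sub>v y"
      using X v by (simp add: y_def mat_vec_add[of _ N] smult_mat_vec)
    then have "(vnorm (mat_adjoint E *\<^sub>v v))\<^sup>2 = (vnorm v)\<^sup>2 + 2 * Re (vinner v (complex_of_real c \<cdot>\<^sub>v y)) + c\<^sup>2 * (vnorm y)\<^sup>2"
      using v y by (simp add: vnorm_add_sq vnorm_smult power_mult_distrib)
    \<comment> \<open>The real part of the quadratic form is the same for \<open>X\<close> and its
      adjoint; this is why control of the Hermitian part is enough.\<close>
    also have "Re (vinner v (complex_of_real c \<cdot>\<^sub>v y)) = c * Re (vinner v (X *\<^sub>v v))"
      using X v y vinner_commute[of y N v] by (simp add: vinner_smult_right[of _ N] inner_adjoint[of X N] y_def)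
    also have "(vnorm y)\<^sup>2 \<le> (f * vnorm v)\<^sup>2"
      using X v op_bounded_frobenius[of "mat_adjoint X" N]
      by (intro power_mono) (auto simp: op_bounded_def y_def f_def)
    finally have "(vnorm (mat_adjoint E *\<^sub>v v))\<^sup>2 \<le> (vnorm v)\<^sup>2 + 2 * (c * Re (vinner v (X *\<^sub>v v))) + c\<^sup>2 * (f * vnorm v)\<^sup>2"
      by (simp add: mult_left_mono)
    also have "\<dots> \<le> (vnorm v)\<^sup>2 + 2 * (c * (b * (vnorm v)\<^sup>2 - Re (vinner v (H *\<^sub>v v)))) + c\<^sup>2 * (f * vnorm v)\<^sup>2"
      using le[OF v] by (intro add_mono order_refl mult_left_mono) (auto simp: c_def)
    also have "\<dots> = c1 * (vnorm v)\<^sup>2 - Re (vinner v (H *\<^sub>v v)) / q"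
      by (simp add: c_def c1_def q power_divide power_mult_distrib field_simps)
    also have "\<dots> = Re (vinner v (B *\<^sub>v v))"
      using H v by (simp add: B_def mat_vec_add[of _ N] smult_mat_vec
          vinner_add_right[of _ N] vinner_smult_right[of _ N] vinner_self)
    finally show ?thesis .
  qed
  define Z where "Z = E ^\<^sub>m q"
  have Z: "Z \<in> carrier_mat N N" using E by (simp add: Z_def)
  \<comment> \<open>Half of the factors go with \<open>D\<close>, so that \<open>D\<close> costs
    only its operator norm and both halves leave the same Frobenius norm.\<close>
  have "cmod (trace_mat (D * E ^\<^sub>m (2 * q))) = cmod (trace_mat ((D * Z) * Z))"
    using E Z D by (simp add: mult_2 pow_mat_add[of _ N] mat_assoc[of _ N] flip: Z_def)
  also have "\<dots> \<le> frobenius (D * Z) * frobenius Z"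
    using D Z by (intro trace_cauchy_schwarz[of _ N]) auto
  also have "\<dots> \<le> (w * frobenius Z) * frobenius Z"
    using D Z w by (intro mult_right_mono frobenius_mult_le[of _ N]) auto
  also have "\<dots> = w * (frobenius Z)\<^sup>2" by (simp add: power2_eq_square)
  also have "\<dots> \<le> w * Re (trace_mat ((E * mat_adjoint E) ^\<^sub>m q))"
    unfolding Z_def using w E by (intro mult_left_mono frobenius_pow_le[OF _ q]) auto
  also have "\<dots> \<le> w * Re (trace_mat (B ^\<^sub>m q))"
    using w by (intro mult_left_mono trace_pow_mono[OF E B EB q]) auto
  also have "trace_mat (B ^\<^sub>m q) = complex_of_real (\<Sum>i<N. (1 + (b - h i) / q + f\<^sup>2 / (2 * real q)\<^sup>2) ^ q)"
    unfolding B_def trace_affine_pow[OF P diag]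
    by (simp add: c1_def diff_divide_distrib algebra_simps)
  finally show ?thesis
    by (simp add: E_def f_def c_def)
qed

lemma pow_mat_intertwine:
  fixes A A' R :: "complex mat"
  assumes "A \<in> carrier_mat N N" "A' \<in> carrier_mat N N" "R \<in> carrier_mat N N" "A * R = R * A'"
  shows "A ^\<^sub>m k * R = R * A' ^\<^sub>m k"
proof (induction k)
  case (Suc k)
  have "A ^\<^sub>m Suc k * R = A ^\<^sub>m k * (A * R)"
    using assms by (simp add: mat_assoc[of _ N])
  also have "\<dots> = A ^\<^sub>m k * R * A'"
    using assms by (simp add: mat_assoc[of _ N])
  finally show ?case
    using assms Suc by (simp add: mat_assoc[of _ N])
qed (use assms in simp)

text \<open>From \<open>1 + z \<le> exp z\<close>; the quadratic remainder adds only
  \<open>c / (4 q)\<close> to the exponent. The assumption is available along powers of two, which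
  is enough because the limit is known to exist.\<close>

lemma limit_exp_bound:
  fixes a :: "nat \<Rightarrow> real"
  assumes le: "\<And>k q. q = 2 ^ (k + 1) \<Longrightarrow> x (2 * q) \<le> w * (\<Sum>i<N. (1 + a i / q + c / (2 * real q)\<^sup>2) ^ q)"
    and lim: "x \<longlonglongrightarrow> l" and w: "w \<ge> 0"
  shows "l \<le> w * (\<Sum>i<N. exp (a i))"
proof -
  define q :: "nat \<Rightarrow> nat" where "q = (\<lambda>k. 2 ^ (k + 1))"
  have "strict_mono q" by (simp add: strict_mono_def q_def)
  then have q_lim: "filterlim q at_top at_top" by (rule filterlim_subseq)
  have rq_lim: "filterlim (\<lambda>k. real (q k)) at_top at_top"
    by (rule filterlim_compose[OF filterlim_real_sequentially q_lim])
  have inv: "(\<lambda>k. inverse (real (q k))) \<longlonglongrightarrow> 0"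
    by (rule tendsto_inverse_0_at_top[OF rq_lim])
  have qpos: "real (q k) > 0" for k by (simp add: q_def)
  have "filterlim (\<lambda>k. 2 * q k) at_top at_top"
    using q_lim by (rule filterlim_at_top_mono) auto
  then have lim': "(\<lambda>k. x (2 * q k)) \<longlonglongrightarrow> l"
    by (rule filterlim_compose[OF lim])
  \<comment> \<open>The bases must be non-negative before an inequality between them may be raised
    to the power \<open>q k\<close>; this holds for all large \<open>k\<close>.\<close>
  have ev: "eventually (\<lambda>k. 1 + a i / q k + c / (2 * real (q k))\<^sup>2 \<ge> 0) at_top" for i
  proof -
    have "(\<lambda>k. 1 + a i * inverse (real (q k)) + c / 4 * (inverse (real (q k)) * inverse (real (q k)))) \<longlonglongrightarrow> 1 + a i * 0 + c / 4 * (0 * 0)"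
      by (intro tendsto_intros inv)
    then have "eventually (\<lambda>k. 1 + a i * inverse (real (q k)) + c / 4 * (inverse (real (q k)) * inverse (real (q k))) > 0) at_top"
      by (rule order_tendstoD) auto
    then show ?thesis
      by eventually_elim (simp add: field_simps power2_eq_square)
  qed
  have "eventually (\<lambda>k. \<forall>i\<in>{..<N}. 1 + a i / q k + c / (2 * real (q k))\<^sup>2 \<ge> 0) at_top"
    by (intro eventually_ball_finite ballI ev) auto
  then have ev_le: "eventually (\<lambda>k. x (2 * q k) \<le> w * (\<Sum>i<N. exp (a i + c / 4 * inverse (real (q k))))) at_top"
  proof eventually_elim
    case (elim k)
    have "(1 + a i / q k + c / (2 * real (q k))\<^sup>2) ^ q k \<le> exp (a i + c / 4 * inverse (real (q k)))" if "i < N" for i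
    proof -
      have "(1 + a i / q k + c / (2 * real (q k))\<^sup>2) ^ q k \<le> exp (a i / q k + c / (2 * real (q k))\<^sup>2) ^ q k"
        using elim that exp_ge_add_one_self[of "a i / q k + c / (2 * real (q k))\<^sup>2"] by (intro power_mono) (auto simp: add.assoc)
      also have "\<dots> = exp (real (q k) * (a i / q k + c / (2 * real (q k))\<^sup>2))"
        by (simp add: exp_of_nat_mult)
      also have "real (q k) * (a i / q k + c / (2 * real (q k))\<^sup>2) = a i + c / 4 * inverse (real (q k))"
        using qpos[of k] by (simp add: field_simps power2_eq_square)
      finally show ?thesis .
    qed
    then have "w * (\<Sum>i<N. (1 + a i / q k + c / (2 * real (q k))\<^sup>2) ^ q k) \<le> w * (\<Sum>i<N. exp (a i + c / 4 * inverse (real (q k))))"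
      using w by (intro mult_left_mono sum_mono) auto
    then show ?case
      using le[of "q k" k] by (simp add: q_def)
  qed
  have "(\<lambda>k. w * (\<Sum>i<N. exp (a i + c / 4 * inverse (real (q k))))) \<longlonglongrightarrow> w * (\<Sum>i<N. exp (a i + c / 4 * 0))"
    by (intro tendsto_intros inv)
  then show ?thesis
    using tendsto_le[OF _ _ lim' ev_le] by simp
qed

text \<open>Carrying \<open>R\<close> around the trace replaces \<open>H\<close> by the similar
  \<open>H'\<close> at the price of the factor \<open>\<mu>\<close>. Numerator and partition
  function are both expressed through the eigenvalues of \<open>\<beta>\<close> times
  \<open>H\<close>, so the sum of exponentials cancels in the quotient.\<close>

lemma gibbs_state_bound:
  assumes H: "H \<in> carrier_mat N N" "mat_adjoint H = H" and H': "H' \<in> carrier_mat N N"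
    and D: "D \<in> carrier_mat N N"
    and R: "R \<in> carrier_mat N N" "R' \<in> carrier_mat N N" "R * R' = 1\<^sub>m N" "R' * R = 1\<^sub>m N"
    and HR: "H * R = R * H'" and DR: "D * R = \<mu> \<cdot>\<^sub>m (R * D)"
    and le: "\<And>v. v \<in> carrier_vec N \<Longrightarrow>
      Re (vinner v (H *\<^sub>v v)) - \<epsilon> * (vnorm v)\<^sup>2 \<le> Re (vinner v (H' *\<^sub>v v))"
    and w: "op_bounded D w" "w \<ge> 0" and \<beta>: "\<beta> > 0" and N: "N > 0"
  shows "cmod (gibbs_state \<beta> H D) \<le> cmod \<mu> * w * exp (\<beta> * \<epsilon>)"
proof -
  obtain P Q h where P: "P \<in> carrier_mat N N" "Q \<in> carrier_mat N N" "P * Q = 1\<^sub>m N" "Q * P = 1\<^sub>m N"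
    and diag: "complex_of_real \<beta> \<cdot>\<^sub>m H = P * mat_diag N (\<lambda>i. complex_of_real (h i)) * Q"
    using hermitian_diagonalizable[of "complex_of_real \<beta> \<cdot>\<^sub>m H" N] H
    by (auto simp: mat_adjoint_smult[of _ N])
  define X where "X = complex_of_real (- \<beta>) \<cdot>\<^sub>m H"
  define X' where "X' = complex_of_real (- \<beta>) \<cdot>\<^sub>m H'"
  have X: "X \<in> carrier_mat N N" "X' \<in> carrier_mat N N" using H H' by (auto simp: X_def X'_def)
  define G where "G = (\<lambda>X m. (1\<^sub>m N + complex_of_real (1 / real m) \<cdot>\<^sub>m X) ^\<^sub>m m)"
  have G: "Y \<in> carrier_mat N N \<Longrightarrow> G Y m \<in> carrier_mat N N" for Y m by (simp add: G_def)
  have tr_G: "trace_mat (D * G X m) = \<mu> * trace_mat (D * G X' m)" for m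
  proof -
    have "X * R = R * X'"
      using H H' R HR by (simp add: X_def X'_def mat_smult_left[of _ N] mat_smult_right[of _ N])
    then have GR: "G X m * R = R * G X' m"
      unfolding G_def using X R
      by (intro pow_mat_intertwine) (auto simp: mat_add_left[of _ N] mat_add_right[of _ N]
          mat_smult_left[of _ N] mat_smult_right[of _ N] left_mult_one_mat[of _ N N] right_mult_one_mat[of _ N N])
    have "trace_mat (D * G X m) = trace_mat (D * G X m * (R * R'))"
      using R D G[OF X(1)] by (simp add: right_mult_one_mat[of _ N N])
    also have "D * G X m * (R * R') = D * (G X m * R) * R'"
      using D R(1,2) G[OF X(1)] by (simp add: mat_assoc[of _ N])
    also have "\<dots> = (D * R) * (G X' m * R')"
      using D R(1,2) G[OF X(2)] by (simp add: GR mat_assoc[of _ N])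
    also have "\<dots> = \<mu> \<cdot>\<^sub>m (R * (D * G X' m * R'))"
      using D R(1,2) G[OF X(2)] by (simp add: DR mat_smult_left[of _ N] mat_assoc[of _ N])
    also have "trace_mat \<dots> = \<mu> * trace_mat (R * (D * G X' m * R'))"
      using D R(1,2) G[OF X(2)] by (intro trace_mat_smult[of _ N]) auto
    also have "trace_mat (R * (D * G X' m * R')) = trace_mat (D * G X' m * R' * R)"
      using D R(1,2) G[OF X(2)] by (intro trace_mat_mult_commute[of _ N]) auto
    also have "D * G X' m * R' * R = D * G X' m"
      using D R G[OF X(2)] by (simp add: mat_assoc[of _ N] right_mult_one_mat[of _ N N])
    finally show ?thesis .
  qed
  have X'_le: "Re (vinner v (X' *\<^sub>v v)) \<le> \<beta> * \<epsilon> * (vnorm v)\<^sup>2 - Re (vinner v ((complex_of_real \<beta> \<cdot>\<^sub>m H) *\<^sub>v v))"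
    if v: "v \<in> carrier_vec N" for v
    using H H' v mult_left_mono[OF le[OF v], of \<beta>] \<beta>
    by (simp add: X'_def smult_mat_vec vinner_smult_right[of _ N] algebra_simps)
  have lim: "(\<lambda>m. cmod (trace_mat (D * G X m))) \<longlonglongrightarrow> cmod (trace_mat (D * exp_mat X))"
    unfolding G_def by (intro tendsto_norm trace_exp_limit X D)
  have "cmod (trace_mat (D * exp_mat X)) \<le> (cmod \<mu> * w) * (\<Sum>i<N. exp (\<beta> * \<epsilon> - h i))"
  proof (rule limit_exp_bound[where c = "(frobenius (mat_adjoint X'))\<^sup>2", OF _ lim])
    fix k q :: nat assume q: "q = 2 ^ (k + 1)"
    have "cmod (trace_mat (D * G X' (2 * q))) \<le>
        w * (\<Sum>i<N. (1 + (\<beta> * \<epsilon> - h i) / q + (frobenius (mat_adjoint X'))\<^sup>2 / (2 * real q)\<^sup>2) ^ q)"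
      unfolding G_def
      by (rule trace_poly_bound[OF X(2) _ _ D P diag X'_le w q]) (use H in \<open>auto simp: mat_adjoint_smult[of _ N]\<close>)
    then show "cmod (trace_mat (D * G X (2 * q))) \<le>
        (cmod \<mu> * w) * (\<Sum>i<N. (1 + (\<beta> * \<epsilon> - h i) / q + (frobenius (mat_adjoint X'))\<^sup>2 / (2 * real q)\<^sup>2) ^ q)"
      by (simp add: tr_G norm_mult mult_left_mono mult.assoc)
  qed (use w in auto)
  \<comment> \<open>The partition function is obtained as the same limit, from powers of an affine
    function of the diagonalised matrix.\<close>
  moreover have "trace_mat (exp_mat X) = complex_of_real (\<Sum>i<N. exp (- h i))"
  proof (rule LIMSEQ_unique)
    show "(\<lambda>m. trace_mat (1\<^sub>m N * G X m)) \<longlonglongrightarrow> trace_mat (exp_mat X)"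
      using trace_exp_limit[OF X(1) one_carrier_mat] exp_mat_carrier[OF X(1)]
      by (simp add: G_def left_mult_one_mat[of _ N N])
    have "trace_mat (1\<^sub>m N * G X m) = complex_of_real (\<Sum>i<N. (1 + (- h i) / real m) ^ m)" for m
    proof -
      have "G X m = (1 \<cdot>\<^sub>m 1\<^sub>m N + complex_of_real (- 1 / real m) \<cdot>\<^sub>m (complex_of_real \<beta> \<cdot>\<^sub>m H)) ^\<^sub>m m"
        unfolding G_def X_def using H by (intro arg_cong[where f = "\<lambda>A. A ^\<^sub>m m"] eq_matI) auto
      then show ?thesis
        using G[OF X(1), of m] trace_affine_pow[OF P diag, of 1 "complex_of_real (- 1 / real m)" m]
        by (simp add: left_mult_one_mat[of _ N N])
    qed
    moreover have "(\<lambda>m. complex_of_real (\<Sum>i<N. (1 + (- h i) / real m) ^ m)) \<longlonglongrightarrow> complex_of_real (\<Sum>i<N. exp (- h i))"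
      by (intro tendsto_of_real tendsto_sum tendsto_exp_limit_sequentially)
    ultimately show "(\<lambda>m. trace_mat (1\<^sub>m N * G X m)) \<longlonglongrightarrow> complex_of_real (\<Sum>i<N. exp (- h i))"
      by simp
  qed
  moreover have pos: "(\<Sum>i<N. exp (- h i)) > 0"
    using N by (intro sum_pos) auto
  moreover have "(\<Sum>i<N. exp (\<beta> * \<epsilon> - h i)) = exp (\<beta> * \<epsilon>) * (\<Sum>i<N. exp (- h i))"
    by (simp add: sum_distrib_left exp_diff exp_minus field_simps)
  ultimately show ?thesis
    unfolding gibbs_state_def X_def[symmetric] by (simp add: norm_divide norm_of_real divide_simps mult_ac abs_of_pos del: of_real_sum)
qed

end

section \<open>Operators at a site\<close>

lemma digit_less: "d > 0 \<Longrightarrow> digit d x i < d"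
  by (simp add: digit_def)

lemma digit_Suc: "digit d (Suc x) i = digit d x (i div d)"
  by (simp add: digit_def div_mult2_eq)

text \<open>With \<open>digits_exist\<close> this identifies the indices below \<open>d ^ n\<close>
  with the configurations of local indices on \<open>n\<close> sites.\<close>

lemma digits_inject:
  assumes "i < d ^ n" "j < d ^ n" "\<And>x. x < n \<Longrightarrow> digit d x i = digit d x j"
  shows "i = j"
  using assms
proof (induction n arbitrary: i j)
  case (Suc n)
  have "i div d = j div d"
  proof (rule Suc.IH)
    show "i div d < d ^ n" "j div d < d ^ n"
      using Suc.prems(1,2) by (auto intro!: less_mult_imp_div_less simp: mult.commute)
    show "digit d x (i div d) = digit d x (j div d)" if "x < n" for x
      using Suc.prems(3)[of "Suc x"] that by (simp add: digit_Suc)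
  qed
  moreover have "i mod d = j mod d"
    using Suc.prems(3)[of 0] by (simp add: digit_def)
  ultimately show ?case
    by (metis div_mult_mod_eq)
qed simp

lemma digits_exist:
  assumes "\<And>x. x < n \<Longrightarrow> f x < d"
  shows "\<exists>i<d ^ n. \<forall>x<n. digit d x i = f x"
  using assms
proof (induction n arbitrary: f)
  case (Suc n)
  obtain i where i: "i < d ^ n" "\<And>x. x < n \<Longrightarrow> digit d x i = f (Suc x)"
    using Suc.IH[of "\<lambda>x. f (Suc x)"] Suc.prems by auto
  have f0: "f 0 < d" using Suc.prems by simp
  have "i * d + f 0 < (i + 1) * d" using f0 by simp
  also have "\<dots> \<le> d ^ n * d" using i by (intro mult_right_mono) auto
  finally have "i * d + f 0 < d ^ Suc n" by (simp add: mult.commute)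
  moreover have "digit d x (i * d + f 0) = f x" if "x < Suc n" for x
  proof (cases x)
    case 0
    then show ?thesis using f0 by (simp add: digit_def)
  next
    case (Suc y)
    then show ?thesis using f0 i that by (simp add: digit_Suc)
  qed
  ultimately show ?case by blast
qed simp

text \<open>A set of exempt sites, because a product of operators at two sites may change
  both.\<close>

definition agree_off :: "nat \<Rightarrow> nat \<Rightarrow> nat set \<Rightarrow> nat \<Rightarrow> nat \<Rightarrow> bool" where
  "agree_off d n X i j \<longleftrightarrow> (\<forall>y<n. y \<notin> X \<longrightarrow> digit d y i = digit d y j)"

lemma agree_off_sym: "agree_off d n X i j = agree_off d n X j i"
  by (auto simp: agree_off_def)

text \<open>The configurations that agree with \<open>i\<close> off \<open>x\<close> are determined
  by their digit at \<open>x\<close>, and each digit occurs once.\<close>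

lemma sum_agree_off:
  fixes g :: "nat \<Rightarrow> 'a :: comm_monoid_add"
  assumes d: "d > 0" and x: "x < n"
  shows "(\<Sum>k<d ^ n. if agree_off d n {x} i k then g (digit d x k) else 0) = (\<Sum>b<d. g b)"
proof -
  let ?K = "{k \<in> {..<d ^ n}. agree_off d n {x} i k}"
  have bij: "bij_betw (digit d x) ?K {..<d}"
  proof (intro bij_betwI')
    fix k l assume "k \<in> ?K" "l \<in> ?K"
    then show "(digit d x k = digit d x l) = (k = l)"
      by (auto simp: agree_off_def intro!: digits_inject[of k d n l])
  next
    fix k assume "k \<in> ?K"
    then show "digit d x k \<in> {..<d}" using d by (simp add: digit_less)
  next
    fix b assume "b \<in> {..<d}"
    then have "\<exists>k<d ^ n. \<forall>y<n. digit d y k = (if y = x then b else digit d y i)"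
      by (intro digits_exist) (use d in \<open>auto simp: digit_less\<close>)
    then obtain k where "k < d ^ n" "\<And>y. y < n \<Longrightarrow> digit d y k = (if y = x then b else digit d y i)"
      by blast
    then show "\<exists>k\<in>?K. b = digit d x k"
      using x by (intro bexI[of _ k]) (auto simp: agree_off_def)
  qed
  have "(\<Sum>k<d ^ n. if agree_off d n {x} i k then g (digit d x k) else 0) = (\<Sum>k\<in>?K. g (digit d x k))"
    by (rule sum.inter_filter[symmetric]) simp
  also have "\<dots> = (\<Sum>b<d. g b)"
    by (rule sum.reindex_bij_betw[OF bij])
  finally show ?thesis .
qed

context
  fixes d n :: nat
  assumes d: "d > 0"
begin

lemma site_op_carrier [simp]: "site_op d n x A \<in> carrier_mat (d ^ n) (d ^ n)"
  by (simp add: site_op_def)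

lemma site_op_index:
  "i < d ^ n \<Longrightarrow> j < d ^ n \<Longrightarrow> site_op d n x A $$ (i, j) =
    (if agree_off d n {x} i j then A $$ (digit d x i, digit d x j) else 0)"
  by (simp add: site_op_def agree_off_def)

lemma site_op_dim [simp]: "dim_row (site_op d n x A) = d ^ n" "dim_col (site_op d n x A) = d ^ n"
  by (auto simp: site_op_def)

lemma site_op_mult:
  assumes A: "A \<in> carrier_mat d d" and B: "B \<in> carrier_mat d d" and x: "x < n"
  shows "site_op d n x (A * B) = site_op d n x A * site_op d n x B"
proof (rule eq_matI)
  fix i j assume "i < dim_row (site_op d n x A * site_op d n x B)" "j < dim_col (site_op d n x A * site_op d n x B)"
  then have ij: "i < d ^ n" "j < d ^ n" by auto
  have agree: "agree_off d n {x} k j = agree_off d n {x} i j" if "agree_off d n {x} i k" for k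
    using that by (auto simp: agree_off_def)
  have "(site_op d n x A * site_op d n x B) $$ (i, j) =
      (\<Sum>k<d ^ n. if agree_off d n {x} i k then
        (if agree_off d n {x} i j then A $$ (digit d x i, digit d x k) * B $$ (digit d x k, digit d x j) else 0) else 0)"
    using ij by (auto simp: mat_mult_index site_op_index agree intro!: sum.cong)
  also have "\<dots> = (if agree_off d n {x} i j then \<Sum>b<d. A $$ (digit d x i, b) * B $$ (b, digit d x j) else 0)"
    by (subst sum_agree_off[OF d x, where g = "\<lambda>b. if agree_off d n {x} i j then A $$ (digit d x i, b) * B $$ (b, digit d x j) else 0"]) auto
  also have "\<dots> = site_op d n x (A * B) $$ (i, j)"
    using A B d ij by (auto simp: site_op_index mat_mult_index digit_less)
  finally show "site_op d n x (A * B) $$ (i, j) = (site_op d n x A * site_op d n x B) $$ (i, j)" ..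
qed auto

text \<open>At most one intermediate configuration contributes: the digit of \<open>j\<close> at
  \<open>x\<close> and the digits of \<open>i\<close> elsewhere. The result is symmetric in the two
  sites, which yields \<open>site_op_commute\<close>.\<close>

lemma site_op_mult_index:
  assumes "x \<noteq> y" "x < n" "y < n" "i < d ^ n" "j < d ^ n"
  shows "(site_op d n x A * site_op d n y B) $$ (i, j) =
    (if agree_off d n {x, y} i j then A $$ (digit d x i, digit d x j) * B $$ (digit d y i, digit d y j) else 0)"
proof -
  have "\<exists>k<d ^ n. \<forall>z<n. digit d z k = (if z = x then digit d x j else digit d z i)"
    by (rule digits_exist) (use d in \<open>auto simp: digit_less\<close>)
  then obtain k where k: "k < d ^ n" "\<And>z. z < n \<Longrightarrow> digit d z k = (if z = x then digit d x j else digit d z i)"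
    by blast
  have uniq: "l = k \<and> agree_off d n {x, y} i j" if "l < d ^ n" "agree_off d n {x} i l" "agree_off d n {y} l j" for l
  proof
    show "l = k"
      using that k assms by (intro digits_inject[of l d n k]) (auto simp: agree_off_def)
    show "agree_off d n {x, y} i j"
      using that by (auto simp: agree_off_def)
  qed
  define W where "W = (if agree_off d n {x, y} i j then A $$ (digit d x i, digit d x j) * B $$ (digit d y i, digit d y j) else 0)"
  have k_agree: "agree_off d n {x} i k \<and> agree_off d n {y} k j" if "agree_off d n {x, y} i j"
    using that k(2) by (auto simp: agree_off_def)
  have "(site_op d n x A * site_op d n y B) $$ (i, j) =
      (\<Sum>l<d ^ n. site_op d n x A $$ (i, l) * site_op d n y B $$ (l, j))"
    using assms by (simp add: mat_mult_index)
  also have "\<dots> = (\<Sum>l<d ^ n. if l = k then W else 0)"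
  proof (intro sum.cong refl)
    fix l assume "l \<in> {..<d ^ n}"
    then have l: "l < d ^ n" by simp
    show "site_op d n x A $$ (i, l) * site_op d n y B $$ (l, j) = (if l = k then W else 0)"
    proof (cases "agree_off d n {x} i l \<and> agree_off d n {y} l j")
      case True
      then have "l = k" "agree_off d n {x, y} i j" using uniq[OF l] by auto
      then show ?thesis
        using True assms l k(2)[of x] k(2)[of y] by (simp add: site_op_index W_def)
    next
      case False
      then have "l = k \<Longrightarrow> W = 0" using k_agree by (auto simp: W_def)
      then show ?thesis
        using False assms l by (auto simp: site_op_index)
    qed
  qed
  finally show ?thesis using k by (simp add: W_def)
qed

lemma site_op_commute:
  assumes "x \<noteq> y" "x < n" "y < n"
  shows "site_op d n x A * site_op d n y B = site_op d n y B * site_op d n x A"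
  using assms by (auto intro!: eq_matI simp: site_op_mult_index insert_commute mult.commute)

lemma site_op_one: "site_op d n x (1\<^sub>m d) = 1\<^sub>m (d ^ n)"
proof (intro eq_matI)
  fix i j assume "i < dim_row (1\<^sub>m (d ^ n))" "j < dim_col (1\<^sub>m (d ^ n))"
  then show "site_op d n x (1\<^sub>m d) $$ (i, j) = 1\<^sub>m (d ^ n) $$ (i, j)"
    using digits_inject[of i d n j] d by (auto simp: site_op_index digit_less agree_off_def)
qed auto

lemma site_op_add:
  "A \<in> carrier_mat d d \<Longrightarrow> B \<in> carrier_mat d d \<Longrightarrow> site_op d n x (A + B) = site_op d n x A + site_op d n x B"
  using d by (auto intro!: eq_matI simp: site_op_index digit_less)

lemma site_op_smult: "A \<in> carrier_mat d d \<Longrightarrow> site_op d n x (c \<cdot>\<^sub>m A) = c \<cdot>\<^sub>m site_op d n x A"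
  using d by (auto intro!: eq_matI simp: site_op_index digit_less)

lemma site_op_adjoint: "A \<in> carrier_mat d d \<Longrightarrow> site_op d n x (mat_adjoint A) = mat_adjoint (site_op d n x A)"
  using d by (auto intro!: eq_matI simp: site_op_index digit_less agree_off_sym)

text \<open>A Schur test: every row and column has at most \<open>d\<close> non-zero entries, so the
  bound does not grow with \<open>n\<close>. This keeps the constants independent of the
  graph.\<close>

lemma op_bounded_site_op:
  assumes x: "x < n" and a: "\<And>i j. i < d \<Longrightarrow> j < d \<Longrightarrow> cmod (A $$ (i, j)) \<le> a"
  shows "op_bounded (site_op d n x A) (a * d)"
  unfolding op_bounded_def
proof
  fix v :: "complex vec" assume "v \<in> carrier_vec (dim_col (site_op d n x A))"
  then have v: "v \<in> carrier_vec (d ^ n)" by simp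
  have a0: "a \<ge> 0" using a[of 0 0] d norm_ge_zero order_trans by blast
  define e where "e = (\<lambda>i j. if agree_off d n {x} i j then 1 else 0 :: real)"
  have e_sum: "(\<Sum>j<d ^ n. e i j) = d" for i
    unfolding e_def using sum_agree_off[OF d x, of i "\<lambda>_. 1 :: real"] by simp
  have e_sym: "e i j = e j i" for i j
    unfolding e_def using agree_off_sym by simp
  have e_sum': "(\<Sum>i<d ^ n. e i j) = d" for j
    unfolding e_sum[of j, symmetric] by (intro sum.cong refl e_sym)
  have e_sq: "(e i j)\<^sup>2 = e i j" for i j by (simp add: e_def)
  have e_nonneg: "e i j \<ge> 0" for i j by (simp add: e_def)
  have row: "(cmod ((site_op d n x A *\<^sub>v v) $ i))\<^sup>2 \<le> a\<^sup>2 * (d * (\<Sum>j<d ^ n. e i j * (cmod (v $ j))\<^sup>2))"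
    if i: "i < d ^ n" for i
  proof -
    \<comment> \<open>The indicator \<open>e\<close> is written as its own square to have a copy in
      each factor of Cauchy-Schwarz; the first copy then sums to \<open>d\<close>.\<close>
    have "cmod ((site_op d n x A *\<^sub>v v) $ i) \<le> (\<Sum>j<d ^ n. a * (\<bar>e i j\<bar> * \<bar>e i j * cmod (v $ j)\<bar>))"
      using i v a d
      by (subst mult_mat_vec_index)
        (auto simp: e_def site_op_index norm_mult digit_less intro!: sum_norm_le mult_right_mono)
    also have "\<dots> \<le> a * (L2_set (e i) {..<d ^ n} * L2_set (\<lambda>j. e i j * cmod (v $ j)) {..<d ^ n})"
      unfolding sum_distrib_left[symmetric] using a0 by (intro mult_left_mono L2_set_mult_ineq)
    finally have "(cmod ((site_op d n x A *\<^sub>v v) $ i))\<^sup>2 \<le>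
        (a * (L2_set (e i) {..<d ^ n} * L2_set (\<lambda>j. e i j * cmod (v $ j)) {..<d ^ n}))\<^sup>2"
      by (intro power_mono) auto
    then show ?thesis
      by (simp add: power_mult_distrib L2_set_def sum_nonneg e_sq e_sum e_nonneg)
  qed
  show "vnorm (site_op d n x A *\<^sub>v v) \<le> a * d * vnorm v"
  proof (rule power2_le_imp_le)
    have "(vnorm (site_op d n x A *\<^sub>v v))\<^sup>2 = (\<Sum>i<d ^ n. (cmod ((site_op d n x A *\<^sub>v v) $ i))\<^sup>2)"
      by (simp add: vnorm_def L2_set_def sum_nonneg)
    also have "\<dots> \<le> (\<Sum>i<d ^ n. a\<^sup>2 * (d * (\<Sum>j<d ^ n. e i j * (cmod (v $ j))\<^sup>2)))"
      using row by (intro sum_mono) auto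
    also have "\<dots> = a\<^sup>2 * (d * (\<Sum>j<d ^ n. \<Sum>i<d ^ n. e i j * (cmod (v $ j))\<^sup>2))"
      by (subst sum.swap) (simp add: sum_distrib_left)
    also have "\<dots> = a\<^sup>2 * (d * (\<Sum>j<d ^ n. d * (cmod (v $ j))\<^sup>2))"
      by (simp add: sum_distrib_right[symmetric] e_sum')
    also have "\<dots> = (a * d * vnorm v)\<^sup>2"
      using v by (simp add: vnorm_def L2_set_def sum_nonneg power_mult_distrib sum_distrib_left power2_eq_square mult_ac)
    finally show "(vnorm (site_op d n x A *\<^sub>v v))\<^sup>2 \<le> (a * d * vnorm v)\<^sup>2" .
  qed (use a0 in auto)
qed

end

section \<open>Hermitian parts of rotated interactions\<close>

context
  fixes N :: nat
begin

lemma vinner_hermitian_sq: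
  assumes "A \<in> carrier_mat N N" "mat_adjoint A = A" "v \<in> carrier_vec N"
  shows "(vnorm (A *\<^sub>v v))\<^sup>2 = Re (vinner v ((A * A) *\<^sub>v v))"
proof -
  have "vinner v ((A * A) *\<^sub>v v) = vinner (A *\<^sub>v v) (A *\<^sub>v v)"
    using assms hermitian_inner[of A N v "A *\<^sub>v v"] by (simp add: mat_vec_assoc[of _ N])
  then show ?thesis by (simp add: vinner_self)
qed

text \<open>The map from \<open>(y1, y2, y3)\<close> to the combination is adjoint to the map from
  \<open>w\<close> to \<open>(A1 w, A2 w, A3 w)\<close>, whose norm is at most the root of
  \<open>M\<close>. The other root of \<open>M\<close> comes from the size of the
  \<open>y\<close>.\<close>

lemma vnorm_three_term:
  assumes A: "A1 \<in> carrier_mat N N" "A2 \<in> carrier_mat N N" "A3 \<in> carrier_mat N N"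
      "mat_adjoint A1 = A1" "mat_adjoint A2 = A2" "mat_adjoint A3 = A3"
    and A_le: "\<And>w. w \<in> carrier_vec N \<Longrightarrow>
      (vnorm (A1 *\<^sub>v w))\<^sup>2 + (vnorm (A2 *\<^sub>v w))\<^sup>2 + (vnorm (A3 *\<^sub>v w))\<^sup>2 \<le> M * (vnorm w)\<^sup>2"
    and y: "y1 \<in> carrier_vec N" "y2 \<in> carrier_vec N" "y3 \<in> carrier_vec N"
    and y_le: "(vnorm y1)\<^sup>2 + (vnorm y2)\<^sup>2 + (vnorm y3)\<^sup>2 \<le> M * V\<^sup>2"
    and M: "M \<ge> 0" "V \<ge> 0"
  shows "vnorm (A1 *\<^sub>v y1 + A2 *\<^sub>v y2 + A3 *\<^sub>v y3) \<le> M * V"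
proof -
  define w where "w = A1 *\<^sub>v y1 + A2 *\<^sub>v y2 + A3 *\<^sub>v y3"
  have w: "w \<in> carrier_vec N" using A y by (simp add: w_def)
  have "complex_of_real ((vnorm w)\<^sup>2) = vinner w (A1 *\<^sub>v y1 + A2 *\<^sub>v y2 + A3 *\<^sub>v y3)"
    by (simp only: vinner_self[symmetric] w_def)
  also have "\<dots> = vinner (A1 *\<^sub>v w) y1 + vinner (A2 *\<^sub>v w) y2 + vinner (A3 *\<^sub>v w) y3"
    using A y w by (simp add: vinner_add_right[of _ N] hermitian_inner)
  finally have "(vnorm w)\<^sup>2 = cmod (vinner (A1 *\<^sub>v w) y1 + vinner (A2 *\<^sub>v w) y2 + vinner (A3 *\<^sub>v w) y3)"
    by (metis abs_of_nonneg norm_of_real zero_le_power2)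
  also have "\<dots> \<le> vnorm (A1 *\<^sub>v w) * vnorm y1 + vnorm (A2 *\<^sub>v w) * vnorm y2 + vnorm (A3 *\<^sub>v w) * vnorm y3"
    using A y w by (intro order_trans[OF norm_triangle_ineq] add_mono cauchy_schwarz_vec[of _ N]) auto
  finally have 1: "(vnorm w)\<^sup>2 \<le> vnorm (A1 *\<^sub>v w) * vnorm y1 + vnorm (A2 *\<^sub>v w) * vnorm y2 + vnorm (A3 *\<^sub>v w) * vnorm y3" .
  define a where "a = (\<lambda>i :: nat. if i = 0 then vnorm (A1 *\<^sub>v w) else if i = 1 then vnorm (A2 *\<^sub>v w) else vnorm (A3 *\<^sub>v w))"
  define b where "b = (\<lambda>i :: nat. if i = 0 then vnorm y1 else if i = 1 then vnorm y2 else vnorm y3)"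
  have "(vnorm w)\<^sup>2 \<le> (\<Sum>i<3. \<bar>a i\<bar> * \<bar>b i\<bar>)"
    using 1 by (simp add: a_def b_def numeral_3_eq_3)
  also have "\<dots> \<le> L2_set a {..<3} * L2_set b {..<3}"
    by (rule L2_set_mult_ineq)
  also have "\<dots> \<le> sqrt (M * (vnorm w)\<^sup>2) * sqrt (M * V\<^sup>2)"
    using A_le[OF w] y_le
    by (intro mult_mono) (auto simp: L2_set_def a_def b_def numeral_3_eq_3 M sum_nonneg)
  also have "\<dots> = M * V * vnorm w"
    using M by (simp add: real_sqrt_mult)
  finally have "vnorm w * vnorm w \<le> (M * V) * vnorm w"
    by (simp add: power2_eq_square)
  then have "vnorm w \<le> M * V"
    using M by (cases "vnorm w = 0") (auto simp: mult_le_cancel_right order.strict_iff_order)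
  then show ?thesis by (simp add: w_def)
qed

text \<open>The Hermitian part of \<open>A\<close> to the power \<open>k\<close> consists of the terms of even degree in \<open>Q\<close>, so it differs
  from \<open>T\<close> to the power \<open>k\<close> only at second order in \<open>\<delta>\<close>. In the proof \<open>u\<close> and \<open>w\<close> collect the
  even and the odd terms.\<close>

lemma hermitian_part_pow_bound:
  assumes T: "T \<in> carrier_mat N N" "P \<in> carrier_mat N N" "Q \<in> carrier_mat N N"
    and adj: "mat_adjoint T = T" "mat_adjoint P = P" "mat_adjoint Q = (- 1) \<cdot>\<^sub>m Q"
    and bd: "op_bounded T M" "op_bounded P M" "op_bounded Q M" and M: "M \<ge> 0"
    and A: "A = T + complex_of_real (cosh \<delta> - 1) \<cdot>\<^sub>m P + complex_of_real (sinh \<delta>) \<cdot>\<^sub>m Q"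
    and v: "v \<in> carrier_vec N"
  shows "\<bar>Re (vinner v (A ^\<^sub>m k *\<^sub>v v)) - Re (vinner v (T ^\<^sub>m k *\<^sub>v v))\<bar> \<le> M ^ k * (cosh (k * \<delta>) - 1) * (vnorm v)\<^sup>2"
proof -
  define c where "c = cosh \<delta> - 1"
  define s where "s = sinh \<delta>"
  \<comment> \<open>With the absolute value both cosh and sinh are non-negative and can bound the
    norms of the even and the odd terms; in the final estimate only the even function cosh
    remains.\<close>
  define D where "D = \<bar>\<delta>\<bar>"
  have cD: "c = cosh D - 1" and sD: "\<bar>s\<bar> = sinh D" and c0: "c \<ge> 0"
    using cosh_real_ge_1[of \<delta>] by (auto simp: c_def s_def D_def abs_if sinh_real_nonneg_iff)
  define B where "B = mat_adjoint A"
  have AB: "A \<in> carrier_mat N N" "B \<in> carrier_mat N N" using T by (auto simp: A B_def)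
  have A_vec: "A *\<^sub>v y = T *\<^sub>v y + complex_of_real c \<cdot>\<^sub>v (P *\<^sub>v y) + complex_of_real s \<cdot>\<^sub>v (Q *\<^sub>v y)"
    if "y \<in> carrier_vec N" for y
    using T that by (simp add: A c_def s_def mat_vec_add[of _ N] smult_mat_vec[of _ N] assoc_add_vec[of _ N])
  have "B = T + complex_of_real c \<cdot>\<^sub>m P + complex_of_real (- s) \<cdot>\<^sub>m Q"
    using T by (simp add: B_def A c_def s_def mat_adjoint_add[of _ N] mat_adjoint_smult[of _ N] adj)
      (auto intro!: eq_matI)
  then have B_vec: "B *\<^sub>v y = T *\<^sub>v y + complex_of_real c \<cdot>\<^sub>v (P *\<^sub>v y) + complex_of_real (- s) \<cdot>\<^sub>v (Q *\<^sub>v y)"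
    if "y \<in> carrier_vec N" for y
    using T that by (simp add: mat_vec_add[of _ N] smult_mat_vec[of _ N] assoc_add_vec[of _ N])
  have bdv: "vnorm (T *\<^sub>v y) \<le> M * vnorm y" "vnorm (P *\<^sub>v y) \<le> M * vnorm y" "vnorm (Q *\<^sub>v y) \<le> M * vnorm y"
    if "y \<in> carrier_vec N" for y
    using bd T that by (auto simp: op_bounded_def)
  \<comment> \<open>Passing to the adjoint \<open>B\<close> reverses the sign of \<open>Q\<close>,
    hence of the odd terms. \<open>e\<close> is the deviation of the even terms from the power of
    \<open>T\<close>. One more factor mixes the bounds exactly as the addition formulas for cosh and
    sinh do.\<close>
  have "\<exists>u w e. u \<in> carrier_vec N \<and> w \<in> carrier_vec N \<and> e \<in> carrier_vec N \<and>
      A ^\<^sub>m k *\<^sub>v v = u + w \<and> B ^\<^sub>m k *\<^sub>v v = u + (- 1) \<cdot>\<^sub>v w \<and> u = T ^\<^sub>m k *\<^sub>v v + e \<and>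
      vnorm u \<le> M ^ k * cosh (k * D) * vnorm v \<and> vnorm w \<le> M ^ k * sinh (k * D) * vnorm v \<and>
      vnorm e \<le> M ^ k * (cosh (k * D) - 1) * vnorm v"
  proof (induction k)
    case 0
    show ?case
      by (rule exI[of _ v], rule exI[of _ "0\<^sub>v N"], rule exI[of _ "0\<^sub>v N"])
        (use v T AB in \<open>auto intro!: eq_vecI\<close>)
  next
    case (Suc k)
    then obtain u w e where uwe: "u \<in> carrier_vec N" "w \<in> carrier_vec N" "e \<in> carrier_vec N"
      and eqs: "A ^\<^sub>m k *\<^sub>v v = u + w" "B ^\<^sub>m k *\<^sub>v v = u + (- 1) \<cdot>\<^sub>v w" "u = T ^\<^sub>m k *\<^sub>v v + e"
      and u: "vnorm u \<le> M ^ k * cosh (k * D) * vnorm v"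
      and w: "vnorm w \<le> M ^ k * sinh (k * D) * vnorm v"
      and e: "vnorm e \<le> M ^ k * (cosh (k * D) - 1) * vnorm v" by blast
    define g where "g = (\<lambda>y. T *\<^sub>v y + complex_of_real c \<cdot>\<^sub>v (P *\<^sub>v y))"
    define h where "h = (\<lambda>y. complex_of_real s \<cdot>\<^sub>v (Q *\<^sub>v y))"
    have gh: "g y \<in> carrier_vec N" "h y \<in> carrier_vec N" if "y \<in> carrier_vec N" for y
      using T that by (auto simp: g_def h_def)
    have pow_Suc: "Y ^\<^sub>m Suc k *\<^sub>v v = Y *\<^sub>v (Y ^\<^sub>m k *\<^sub>v v)" if "Y \<in> carrier_mat N N" for Y
      using that v by (simp add: pow_mat_commute[of _ N] mat_vec_assoc[of _ N])
    let ?u = "g u + h w" and ?w = "g w + h u"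
    let ?e = "T *\<^sub>v e + complex_of_real c \<cdot>\<^sub>v (P *\<^sub>v u) + h w"
    have g_le: "vnorm (g y) \<le> M * cosh D * vnorm y" and h_le: "vnorm (h y) \<le> M * sinh D * vnorm y"
      if "y \<in> carrier_vec N" for y
    proof -
      have "vnorm (g y) \<le> vnorm (T *\<^sub>v y) + vnorm (complex_of_real c \<cdot>\<^sub>v (P *\<^sub>v y))"
        unfolding g_def using T that by (intro vnorm_triangle[of _ N]) auto
      also have "\<dots> \<le> M * vnorm y + c * (M * vnorm y)"
        using bdv[OF that] c0 by (simp add: vnorm_smult add_mono mult_left_mono)
      finally show "vnorm (g y) \<le> M * cosh D * vnorm y"
        by (simp add: cD algebra_simps)
      have "vnorm (h y) \<le> sinh D * (M * vnorm y)"
        using bdv[OF that] by (auto simp: h_def vnorm_smult sD[symmetric] intro!: mult_left_mono)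
      then show "vnorm (h y) \<le> M * sinh D * vnorm y"
        by (simp add: algebra_simps)
    qed
    have sinh0: "sinh D \<ge> 0" by (simp add: D_def)
    have "A ^\<^sub>m Suc k *\<^sub>v v = ?u + ?w"
      using uwe T unfolding pow_Suc[OF AB(1)] eqs(1)
      by (auto simp: A_vec vec_add_right[of _ N] g_def h_def algebra_simps intro!: eq_vecI)
    moreover have "B ^\<^sub>m Suc k *\<^sub>v v = ?u + (- 1) \<cdot>\<^sub>v ?w"
      using uwe T unfolding pow_Suc[OF AB(2)] eqs(2)
      by (auto simp: B_vec vec_add_right[of _ N] mult_mat_vec[of _ N N] g_def h_def algebra_simps intro!: eq_vecI)
    moreover have "?u = T ^\<^sub>m Suc k *\<^sub>v v + ?e"
    proof -
      have "T *\<^sub>v u = T *\<^sub>v (T ^\<^sub>m k *\<^sub>v v) + T *\<^sub>v e"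
        unfolding eqs(3) using T v uwe by (intro vec_add_right[of _ N]) auto
      then show ?thesis
        unfolding pow_Suc[OF T(1)] using T v uwe by (auto simp: g_def h_def algebra_simps intro!: eq_vecI)
    qed
    moreover have "vnorm ?u \<le> M ^ Suc k * cosh (Suc k * D) * vnorm v"
    proof -
      have "vnorm ?u \<le> M * cosh D * vnorm u + M * sinh D * vnorm w"
        using uwe gh by (intro order_trans[OF vnorm_triangle[of _ N]] add_mono g_le h_le) auto
      also have "\<dots> \<le> M * cosh D * (M ^ k * cosh (k * D) * vnorm v) + M * sinh D * (M ^ k * sinh (k * D) * vnorm v)"
        using M sinh0 by (intro add_mono mult_left_mono u w) auto
      also have "\<dots> = M ^ Suc k * cosh (Suc k * D) * vnorm v"
        by (simp add: distrib_right cosh_add algebra_simps)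
      finally show ?thesis .
    qed
    moreover have "vnorm ?w \<le> M ^ Suc k * sinh (Suc k * D) * vnorm v"
    proof -
      have "vnorm ?w \<le> M * cosh D * vnorm w + M * sinh D * vnorm u"
        using uwe gh by (intro order_trans[OF vnorm_triangle[of _ N]] add_mono g_le h_le) auto
      also have "\<dots> \<le> M * cosh D * (M ^ k * sinh (k * D) * vnorm v) + M * sinh D * (M ^ k * cosh (k * D) * vnorm v)"
        using M sinh0 by (intro add_mono mult_left_mono u w) auto
      also have "\<dots> = M ^ Suc k * sinh (Suc k * D) * vnorm v"
        by (simp add: distrib_right sinh_add algebra_simps)
      finally show ?thesis .
    qed
    moreover have "vnorm ?e \<le> M ^ Suc k * (cosh (Suc k * D) - 1) * vnorm v"
    proof -
      have "vnorm ?e \<le> vnorm (T *\<^sub>v e) + vnorm (complex_of_real c \<cdot>\<^sub>v (P *\<^sub>v u)) + vnorm (h w)"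
        using uwe gh T by (intro order_trans[OF vnorm_triangle[of _ N]] add_mono order_refl vnorm_triangle[of _ N]) auto
      also have "\<dots> \<le> M * vnorm e + c * (M * vnorm u) + M * sinh D * vnorm w"
        using uwe c0 by (intro add_mono h_le bdv) (auto simp: vnorm_smult intro!: mult_left_mono bdv)
      also have "\<dots> \<le> M * (M ^ k * (cosh (k * D) - 1) * vnorm v) + c * (M * (M ^ k * cosh (k * D) * vnorm v)) +
          M * sinh D * (M ^ k * sinh (k * D) * vnorm v)"
        using M sinh0 c0 by (intro add_mono mult_left_mono u w e) auto
      also have "\<dots> = M ^ Suc k * (cosh (Suc k * D) - 1) * vnorm v"
        by (simp add: cD distrib_right cosh_add algebra_simps)
      finally show ?thesis .
    qed
    moreover have "?u \<in> carrier_vec N" "?w \<in> carrier_vec N" "?e \<in> carrier_vec N"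
      using uwe gh T by auto
    ultimately show ?case
      by (intro exI[of _ ?u] exI[of _ ?w] exI[of _ ?e] conjI)
  qed
  then obtain u w e where uwe: "u \<in> carrier_vec N" "w \<in> carrier_vec N" "e \<in> carrier_vec N"
    and eqs: "A ^\<^sub>m k *\<^sub>v v = u + w" "B ^\<^sub>m k *\<^sub>v v = u + (- 1) \<cdot>\<^sub>v w" "u = T ^\<^sub>m k *\<^sub>v v + e"
    and e: "vnorm e \<le> M ^ k * (cosh (k * D) - 1) * vnorm v" by blast
  have "vinner v (B ^\<^sub>m k *\<^sub>v v) = cnj (vinner v (A ^\<^sub>m k *\<^sub>v v))"
  proof -
    have "vinner v (A ^\<^sub>m k *\<^sub>v v) = vinner (mat_adjoint (A ^\<^sub>m k) *\<^sub>v v) v"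
      using AB v by (intro inner_adjoint[of _ N]) auto
    also have "mat_adjoint (A ^\<^sub>m k) = B ^\<^sub>m k"
      using AB by (simp add: B_def mat_adjoint_pow[of _ N])
    finally show ?thesis
      using AB v vinner_commute[of "B ^\<^sub>m k *\<^sub>v v" N v] by simp
  qed
  \<comment> \<open>A matrix and its adjoint have quadratic forms with equal real parts; the odd
    part \<open>w\<close> enters with opposite signs and so contributes nothing.\<close>
  then have "Re (vinner v (u + w)) = Re (vinner v (u + (- 1) \<cdot>\<^sub>v w))"
    by (simp add: eqs(1,2))
  then have "Re (vinner v (A ^\<^sub>m k *\<^sub>v v)) = Re (vinner v u)"
    unfolding eqs(1) using uwe v by (simp add: vinner_add_right[of _ N] vinner_smult_right[of _ N])
  also have "\<dots> = Re (vinner v (T ^\<^sub>m k *\<^sub>v v)) + Re (vinner v e)"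
    unfolding eqs(3) using uwe v T by (simp add: vinner_add_right[of _ N])
  finally have "\<bar>Re (vinner v (A ^\<^sub>m k *\<^sub>v v)) - Re (vinner v (T ^\<^sub>m k *\<^sub>v v))\<bar> = \<bar>Re (vinner v e)\<bar>"
    by simp
  also have "\<dots> \<le> vnorm v * vnorm e"
    using abs_Re_le_cmod cauchy_schwarz_vec[OF v uwe(3)] order_trans by blast
  also have "\<dots> \<le> vnorm v * (M ^ k * (cosh (k * D) - 1) * vnorm v)"
    by (intro mult_left_mono e) auto
  also have "cosh (k * D) = cosh (k * \<delta>)"
    by (simp add: D_def abs_if)
  finally show ?thesis
    by (simp add: power2_eq_square algebra_simps)
qed

text \<open>In the eigenbasis of \<open>S\<close> the commutation relation says that non-zero
  entries of \<open>A\<close> connect eigenvalues differing by \<open>c\<close>. Conjugation by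
  \<open>r \<theta>\<close>, the exponential of \<open>\<theta>\<close> times \<open>S\<close>,
  scales all of them by the same factor.\<close>

lemma intertwine_diag:
  assumes P: "P \<in> carrier_mat N N" "Q \<in> carrier_mat N N" "P * Q = 1\<^sub>m N" "Q * P = 1\<^sub>m N"
    and S: "S = P * mat_diag N (\<lambda>i. complex_of_real (h i)) * Q" and A: "A \<in> carrier_mat N N"
    and comm: "S * A - A * S = complex_of_real c \<cdot>\<^sub>m A"
  defines "r \<equiv> \<lambda>\<theta>. P * mat_diag N (\<lambda>i. complex_of_real (exp (\<theta> * h i))) * Q"
  shows "A * r \<theta> = complex_of_real (exp (- c * \<theta>)) \<cdot>\<^sub>m (r \<theta> * A)"
proof -
  define A' where "A' = Q * A * P"
  define Dh where "Dh = mat_diag N (\<lambda>i. complex_of_real (h i))"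
  define De where "De = mat_diag N (\<lambda>i. complex_of_real (exp (\<theta> * h i)))"
  have D: "Dh \<in> carrier_mat N N" "De \<in> carrier_mat N N" by (auto simp: Dh_def De_def)
  have A': "A' \<in> carrier_mat N N" using A P by (simp add: A'_def)
  have A_eq: "A = P * A' * Q"
  proof -
    have "P * A' * Q = (P * Q) * A * (P * Q)"
      using P(1,2) A by (simp add: A'_def mat_assoc[of _ N])
    then show ?thesis using P A by (simp add: left_mult_one_mat[of _ N N] right_mult_one_mat[of _ N N])
  qed
  have cancel: "Q * (P * X) = X" if "X \<in> carrier_mat N N" for X
    using P that by (simp add: mat_assoc[of Q N P, symmetric] left_mult_one_mat[of _ N N])
  have "Q * (S * A) * P = Dh * A'"
    using P(1,2) A D by (simp add: S Dh_def[symmetric] A'_def mat_assoc[of _ N] cancel)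
  moreover have "Q * (A * S) * P = A' * Dh"
    using P(1,2) A D by (simp add: S Dh_def[symmetric] A'_def mat_assoc[of _ N] P(4) right_mult_one_mat[of _ N N])
  moreover have "Q * (S * A - A * S) * P = Q * (S * A) * P - Q * (A * S) * P"
    using P(1,2) A D by (simp add: S Dh_def[symmetric] mult_minus_distrib_mat[of _ N N _ N] minus_mult_distrib_mat[of _ N N _ _ N])
  moreover have "Q * (complex_of_real c \<cdot>\<^sub>m A) * P = complex_of_real c \<cdot>\<^sub>m A'"
    using P(1,2) A by (simp add: A'_def mat_smult_left[of _ N] mat_smult_right[of _ N])
  ultimately have comm': "Dh * A' - A' * Dh = complex_of_real c \<cdot>\<^sub>m A'"
    using comm by simp
  have entry: "A' $$ (i, j) = 0 \<or> h i = h j + c" if "i < N" "j < N" for i j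
  proof -
    have "(Dh * A' - A' * Dh) $$ (i, j) = (complex_of_real c \<cdot>\<^sub>m A') $$ (i, j)"
      by (simp only: comm')
    then have "complex_of_real (h i) * A' $$ (i, j) - A' $$ (i, j) * complex_of_real (h j) = complex_of_real c * A' $$ (i, j)"
      using that A' by (simp add: Dh_def mat_diag_mult_left[of _ N N] mat_diag_mult_right[of _ N N])
    then have "complex_of_real (h i - h j - c) * A' $$ (i, j) = 0"
      by (simp add: algebra_simps)
    then show ?thesis by (auto simp flip: of_real_add simp del: of_real_diff)
  qed
  have key: "A' * De = complex_of_real (exp (- c * \<theta>)) \<cdot>\<^sub>m (De * A')"
  proof (rule eq_matI)
    fix i j assume "i < dim_row (complex_of_real (exp (- c * \<theta>)) \<cdot>\<^sub>m (De * A'))" "j < dim_col (complex_of_real (exp (- c * \<theta>)) \<cdot>\<^sub>m (De * A'))"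
    then have ij: "i < N" "j < N" using D A' by auto
    have "h i = h j + c \<Longrightarrow> exp (\<theta> * h j) = exp (- c * \<theta>) * exp (\<theta> * h i)"
      by (simp add: exp_add[symmetric] algebra_simps)
    then show "(A' * De) $$ (i, j) = (complex_of_real (exp (- c * \<theta>)) \<cdot>\<^sub>m (De * A')) $$ (i, j)"
      using ij A' entry[OF ij] D
      by (auto simp: De_def mat_diag_mult_left[of _ N N] mat_diag_mult_right[of _ N N] simp flip: of_real_mult)
  qed (use A' D in auto)
  have "A * r \<theta> = P * A' * Q * (P * De * Q)"
    by (simp add: r_def De_def A_eq[symmetric])
  also have "\<dots> = P * (A' * De) * Q"
    using P(1,2) A' D by (simp add: mat_assoc[of _ N] cancel)
  also have "\<dots> = complex_of_real (exp (- c * \<theta>)) \<cdot>\<^sub>m (P * De * A' * Q)"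
    using P(1,2) A' D by (simp add: key mat_smult_left[of _ N] mat_smult_right[of _ N] mat_assoc[of _ N])
  also have "P * De * A' * Q = P * De * Q * (P * A' * Q)"
    using P(1,2) A' D by (simp add: mat_assoc[of _ N] cancel)
  finally show ?thesis
    by (simp add: r_def De_def A_eq[symmetric])
qed

end

text \<open>Otherwise \<open>S 1\<close> would be rewritten to \<open>S (Suc 0)\<close>.\<close>

declare One_nat_def [simp del]

text \<open>Covers the Hamiltonian and its rotated version, which share index set and coefficients
  and differ in \<open>F\<close>. Claims about them thus reduce to single interaction terms.\<close>

definition lin_mat :: "nat \<Rightarrow> 'i set \<Rightarrow> ('i \<Rightarrow> complex) \<Rightarrow> ('i \<Rightarrow> complex mat) \<Rightarrow> complex mat" where
  "lin_mat N I c F = mat N N (\<lambda>(i, j). \<Sum>e\<in>I. c e * F e $$ (i, j))"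

context
  fixes N :: nat
begin

lemma lin_mat_carrier [simp]: "lin_mat N I c F \<in> carrier_mat N N"
  by (simp add: lin_mat_def)

lemma lin_mat_mult_right:
  assumes "\<And>e. e \<in> I \<Longrightarrow> F e \<in> carrier_mat N N" "R \<in> carrier_mat N N"
  shows "lin_mat N I c F * R = lin_mat N I c (\<lambda>e. F e * R)"
proof (rule eq_matI)
  fix i j assume "i < dim_row (lin_mat N I c (\<lambda>e. F e * R))" "j < dim_col (lin_mat N I c (\<lambda>e. F e * R))"
  then have ij: "i < N" "j < N" by (auto simp: lin_mat_def)
  have "(lin_mat N I c F * R) $$ (i, j) = (\<Sum>k<N. \<Sum>e\<in>I. c e * F e $$ (i, k) * R $$ (k, j))"
    using assms ij by (auto simp: mat_mult_index lin_mat_def sum_distrib_right)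
  also have "\<dots> = (\<Sum>e\<in>I. \<Sum>k<N. c e * F e $$ (i, k) * R $$ (k, j))"
    by (rule sum.swap)
  also have "\<dots> = lin_mat N I c (\<lambda>e. F e * R) $$ (i, j)"
    using assms ij by (auto simp: mat_mult_index lin_mat_def sum_distrib_left mult.assoc carrier_matD[OF assms(1)] intro!: sum.cong)
  finally show "(lin_mat N I c F * R) $$ (i, j) = lin_mat N I c (\<lambda>e. F e * R) $$ (i, j)" .
qed (use assms in \<open>auto simp: lin_mat_def\<close>)

lemma lin_mat_mult_left:
  assumes "\<And>e. e \<in> I \<Longrightarrow> F e \<in> carrier_mat N N" "R \<in> carrier_mat N N"
  shows "R * lin_mat N I c F = lin_mat N I c (\<lambda>e. R * F e)"
proof (rule eq_matI)
  fix i j assume "i < dim_row (lin_mat N I c (\<lambda>e. R * F e))" "j < dim_col (lin_mat N I c (\<lambda>e. R * F e))"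
  then have ij: "i < N" "j < N" by (auto simp: lin_mat_def)
  have "(R * lin_mat N I c F) $$ (i, j) = (\<Sum>k<N. \<Sum>e\<in>I. c e * (R $$ (i, k) * F e $$ (k, j)))"
    using assms ij by (auto simp: mat_mult_index lin_mat_def sum_distrib_left mult_ac intro!: sum.cong)
  also have "\<dots> = (\<Sum>e\<in>I. \<Sum>k<N. c e * (R $$ (i, k) * F e $$ (k, j)))"
    by (rule sum.swap)
  also have "\<dots> = lin_mat N I c (\<lambda>e. R * F e) $$ (i, j)"
    using assms ij by (auto simp: mat_mult_index lin_mat_def sum_distrib_left carrier_matD[OF assms(1)] intro!: sum.cong)
  finally show "(R * lin_mat N I c F) $$ (i, j) = lin_mat N I c (\<lambda>e. R * F e) $$ (i, j)" .
qed (use assms in \<open>auto simp: lin_mat_def\<close>)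

lemma lin_mat_intertwine:
  assumes "\<And>e. e \<in> I \<Longrightarrow> F e \<in> carrier_mat N N" "\<And>e. e \<in> I \<Longrightarrow> F' e \<in> carrier_mat N N" "R \<in> carrier_mat N N"
    and "\<And>e. e \<in> I \<Longrightarrow> F e * R = R * F' e"
  shows "lin_mat N I c F * R = R * lin_mat N I c F'"
proof -
  have "lin_mat N I c (\<lambda>e. F e * R) = lin_mat N I c (\<lambda>e. R * F' e)"
    unfolding lin_mat_def using assms(4) by (auto intro!: cong_mat sum.cong)
  then show ?thesis
    using assms by (simp add: lin_mat_mult_left lin_mat_mult_right)
qed

lemma lin_mat_hermitian:
  assumes "\<And>e. e \<in> I \<Longrightarrow> F e \<in> carrier_mat N N" "\<And>e. e \<in> I \<Longrightarrow> mat_adjoint (F e) = F e"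
    and "\<And>e. e \<in> I \<Longrightarrow> cnj (c e) = c e"
  shows "mat_adjoint (lin_mat N I c F) = lin_mat N I c F"
proof (rule eq_matI)
  fix i j assume "i < dim_row (lin_mat N I c F)" "j < dim_col (lin_mat N I c F)"
  then have ij: "i < N" "j < N" by (auto simp: lin_mat_def)
  have "cnj (F e $$ (j, i)) = F e $$ (i, j)" if "e \<in> I" for e
    using mat_adjoint_index[of i "F e" j] assms(1)[OF that] assms(2)[OF that] ij by simp
  then show "mat_adjoint (lin_mat N I c F) $$ (i, j) = lin_mat N I c F $$ (i, j)"
    using ij assms(3) by (simp add: lin_mat_def)
qed (auto simp: lin_mat_def)

lemma vinner_lin_mat:
  assumes "\<And>e. e \<in> I \<Longrightarrow> F e \<in> carrier_mat N N" "v \<in> carrier_vec N"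
  shows "vinner v (lin_mat N I c F *\<^sub>v v) = (\<Sum>e\<in>I. c e * vinner v (F e *\<^sub>v v))"
proof -
  have "vinner v (lin_mat N I c F *\<^sub>v v) = (\<Sum>i<N. \<Sum>j<N. \<Sum>e\<in>I. c e * (cnj (v $ i) * (F e $$ (i, j) * v $ j)))"
    using assms by (auto simp: vinner_def mult_mat_vec_index lin_mat_def sum_distrib_left sum_distrib_right mult_ac
        intro!: sum.cong)
  also have "\<dots> = (\<Sum>i<N. \<Sum>e\<in>I. \<Sum>j<N. c e * (cnj (v $ i) * (F e $$ (i, j) * v $ j)))"
    by (intro sum.cong refl sum.swap)
  also have "\<dots> = (\<Sum>e\<in>I. \<Sum>i<N. \<Sum>j<N. c e * (cnj (v $ i) * (F e $$ (i, j) * v $ j)))"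
    by (rule sum.swap)
  also have "\<dots> = (\<Sum>e\<in>I. c e * vinner v (F e *\<^sub>v v))"
    using assms by (intro sum.cong refl)
      (auto simp: vinner_def mult_mat_vec_index sum_distrib_left carrier_matD[OF assms(1)])
  finally show ?thesis .
qed

lemma op_bounded_mult:
  assumes "A \<in> carrier_mat N N" "B \<in> carrier_mat N N" "op_bounded A a" "op_bounded B b" "a \<ge> 0"
  shows "op_bounded (A * B) (a * b)"
  unfolding op_bounded_def
proof
  fix v :: "complex vec" assume "v \<in> carrier_vec (dim_col (A * B))"
  then have v: "v \<in> carrier_vec N" using assms by auto
  have "vnorm ((A * B) *\<^sub>v v) \<le> a * vnorm (B *\<^sub>v v)"
    using assms v by (auto simp: op_bounded_def mat_vec_assoc[of _ N])
  also have "\<dots> \<le> a * (b * vnorm v)"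
    using assms v by (intro mult_left_mono) (auto simp: op_bounded_def)
  finally show "vnorm ((A * B) *\<^sub>v v) \<le> a * b * vnorm v" by (simp add: mult.assoc)
qed

end

definition edge_pairs :: "nat set set \<Rightarrow> (nat \<times> nat) set" where
  "edge_pairs E = {(x, y). x < y \<and> {x, y} \<in> E}"

lemma edge_pairsD:
  assumes "finite_graph n E" "(x, y) \<in> edge_pairs E"
  shows "x < y" "x < n" "y < n" "{x, y} \<in> E"
  using assms by (auto simp: edge_pairs_def finite_graph_def doubleton_eq_iff) 

lemma finite_edge_pairs: "finite_graph n E \<Longrightarrow> finite (edge_pairs E)"
  by (rule finite_subset[of _ "{..<n} \<times> {..<n}"]) (auto dest: edge_pairsD)

text \<open>Depends only on the matrix at one site. The factor \<open>dim_row A\<close> is the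
  number of entries per row counted in \<open>op_bounded_site_op\<close>.\<close>

definition matrix_bound :: "complex mat \<Rightarrow> real" where
  "matrix_bound A = (\<Sum>i<dim_row A. \<Sum>j<dim_col A. cmod (A $$ (i, j))) * dim_row A"

lemma matrix_bound_nonneg [simp]: "matrix_bound A \<ge> 0"
  by (simp add: matrix_bound_def sum_nonneg)

lemma op_bounded_matrix_bound:
  assumes "A \<in> carrier_mat d d" "x < n" "d > 0"
  shows "op_bounded (site_op d n x A) (matrix_bound A)"
proof -
  have "cmod (A $$ (i, j)) \<le> (\<Sum>i<d. \<Sum>j<d. cmod (A $$ (i, j)))" if "i < d" "j < d" for i j
    using that
    by (intro order_trans[OF member_le_sum[of j "{..<d}" "\<lambda>j. cmod (A $$ (i, j))"]]
        member_le_sum[of i "{..<d}" "\<lambda>i. \<Sum>j<d. cmod (A $$ (i, j))"] sum_nonneg) auto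
  then show ?thesis
    using op_bounded_site_op[OF assms(3,2), of A "\<Sum>i<d. \<Sum>j<d. cmod (A $$ (i, j))"] carrier_matD[OF assms(1)]
    by (simp add: matrix_bound_def)
qed

section \<open>Imaginary rotations of a single spin\<close>

context
  fixes t :: nat and S :: "nat \<Rightarrow> complex mat"
  assumes spin: "spin_matrices t S"
begin

lemma S_carrier [simp]:
  "S 1 \<in> carrier_mat (t + 1) (t + 1)" "S 2 \<in> carrier_mat (t + 1) (t + 1)" "S 3 \<in> carrier_mat (t + 1) (t + 1)"
  using spin by (auto simp: spin_matrices_def)

lemma S_hermitian: "mat_adjoint (S 1) = S 1" "mat_adjoint (S 2) = S 2" "mat_adjoint (S 3) = S 3"
  using spin by (auto simp: spin_matrices_def)

lemma spin_raising_carrier [simp]: "spin_raising S \<in> carrier_mat (t + 1) (t + 1)"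
  by (simp add: spin_raising_def)

text \<open>\<open>r \<theta>\<close> is the exponential of \<open>\<theta>\<close> times
  \<open>S 3\<close>. The raising and lowering matrices satisfy the commutation relation of
  \<open>intertwine_diag\<close> with the values 1 and -1, so they pick up
  \<open>exp (- \<theta>)\<close> and \<open>exp \<theta>\<close>; the relations for
  \<open>S 1\<close> and \<open>S 2\<close> are linear combinations of these.\<close>

lemma spin_rotation:
  assumes d: "d = t + 1"
  obtains r where "\<And>\<theta>. r \<theta> \<in> carrier_mat d d" "r 0 = 1\<^sub>m d" "\<And>\<theta>. r \<theta> * r (- \<theta>) = 1\<^sub>m d"
    "\<And>\<theta>. S 1 * r \<theta> = r \<theta> * (complex_of_real (cosh \<theta>) \<cdot>\<^sub>m S 1 + (- \<i> * complex_of_real (sinh \<theta>)) \<cdot>\<^sub>m S 2)"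
    "\<And>\<theta>. S 2 * r \<theta> = r \<theta> * (complex_of_real (cosh \<theta>) \<cdot>\<^sub>m S 2 + (\<i> * complex_of_real (sinh \<theta>)) \<cdot>\<^sub>m S 1)"
    "\<And>\<theta>. S 3 * r \<theta> = r \<theta> * S 3"
    "\<And>\<theta>. spin_raising S * r \<theta> = r \<theta> * (complex_of_real (exp (- \<theta>)) \<cdot>\<^sub>m spin_raising S)"
proof -
  note C = S_carrier[folded d] spin_raising_carrier[folded d]
  note [simp] = C
  obtain P Q h where P: "P \<in> carrier_mat d d" "Q \<in> carrier_mat d d" "P * Q = 1\<^sub>m d" "Q * P = 1\<^sub>m d"
    and S3: "S 3 = P * mat_diag d (\<lambda>i. complex_of_real (h i)) * Q"
    using hermitian_diagonalizable[of "S 3" d] S_hermitian C by metis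
  define r where "r = (\<lambda>\<theta>. P * mat_diag d (\<lambda>i. complex_of_real (exp (\<theta> * h i))) * Q)"
  have r: "r \<theta> \<in> carrier_mat d d" for \<theta> using P by (auto simp: r_def)
  have r0: "r 0 = 1\<^sub>m d" using P by (simp add: r_def right_mult_one_mat[of _ d d])
  have rr: "r \<theta> * r (- \<theta>) = 1\<^sub>m d" for \<theta>
  proof -
    have "r \<theta> * r (- \<theta>) = P * (mat_diag d (\<lambda>i. complex_of_real (exp (\<theta> * h i))) * ((Q * P) * (mat_diag d (\<lambda>i. complex_of_real (exp (- \<theta> * h i))) * Q)))"
      unfolding r_def using P(1,2) by (simp add: mat_assoc[of _ d])
    also have "\<dots> = P * (mat_diag d (\<lambda>i. complex_of_real (exp (\<theta> * h i))) * mat_diag d (\<lambda>i. complex_of_real (exp (- \<theta> * h i)))) * Q"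
      using P by (simp add: mat_assoc[of _ d] left_mult_one_mat[of _ d d] del: mat_diag_diag)
    also have "mat_diag d (\<lambda>i. complex_of_real (exp (\<theta> * h i))) * mat_diag d (\<lambda>i. complex_of_real (exp (- \<theta> * h i))) = 1\<^sub>m d"
      by (simp flip: of_real_mult exp_add)
    finally show ?thesis using P by (simp add: right_mult_one_mat[of _ d d])
  qed
  have inter: "A * r \<theta> = complex_of_real (exp (- c * \<theta>)) \<cdot>\<^sub>m (r \<theta> * A)"
    if "A \<in> carrier_mat d d" "S 3 * A - A * S 3 = complex_of_real c \<cdot>\<^sub>m A" for A c \<theta>
    unfolding r_def by (rule intertwine_diag[OF P S3 that])
  have S12: "S 3 * S 1 - S 1 * S 3 = \<i> \<cdot>\<^sub>m S 2" "S 2 * S 3 - S 3 * S 2 = \<i> \<cdot>\<^sub>m S 1"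
    using spin by (auto simp: spin_matrices_def)
  have S12': "(S 3 * S 1) $$ (i, j) = (S 1 * S 3) $$ (i, j) + \<i> * S 2 $$ (i, j)"
    "(S 3 * S 2) $$ (i, j) = (S 2 * S 3) $$ (i, j) - \<i> * S 1 $$ (i, j)" if "i < d" "j < d" for i j
    using arg_cong[OF S12(1), of "\<lambda>A. A $$ (i, j)"] arg_cong[OF S12(2), of "\<lambda>A. A $$ (i, j)"] that
      carrier_matD[OF C(1)] carrier_matD[OF C(2)] carrier_matD[OF C(3)]
    by (auto simp: algebra_simps)
  define lower where "lower = S 1 + (- \<i>) \<cdot>\<^sub>m S 2"
  have lower: "lower \<in> carrier_mat d d" by (simp add: lower_def)
  have raise: "S 3 * spin_raising S - spin_raising S * S 3 = complex_of_real 1 \<cdot>\<^sub>m spin_raising S"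
  proof (rule eq_matI)
    fix i j assume "i < dim_row (complex_of_real 1 \<cdot>\<^sub>m spin_raising S)" "j < dim_col (complex_of_real 1 \<cdot>\<^sub>m spin_raising S)"
    then have "i < d" "j < d" using carrier_matD[OF C(4)] by auto
    then show "(S 3 * spin_raising S - spin_raising S * S 3) $$ (i, j) = (complex_of_real 1 \<cdot>\<^sub>m spin_raising S) $$ (i, j)"
      using carrier_matD[OF C(1)] carrier_matD[OF C(2)] carrier_matD[OF C(3)]
      by (simp add: S12' spin_raising_def mat_add_left[of _ d] mat_add_right[of _ d] mat_smult_left[of _ d] mat_smult_right[of _ d] algebra_simps)
  qed (use carrier_matD[OF C(4)] carrier_matD[OF C(3)] in auto)
  have low: "S 3 * lower - lower * S 3 = complex_of_real (- 1) \<cdot>\<^sub>m lower"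
  proof (rule eq_matI)
    fix i j assume "i < dim_row (complex_of_real (- 1) \<cdot>\<^sub>m lower)" "j < dim_col (complex_of_real (- 1) \<cdot>\<^sub>m lower)"
    then have "i < d" "j < d" using carrier_matD[OF lower] by auto
    then show "(S 3 * lower - lower * S 3) $$ (i, j) = (complex_of_real (- 1) \<cdot>\<^sub>m lower) $$ (i, j)"
      using carrier_matD[OF C(1)] carrier_matD[OF C(2)] carrier_matD[OF C(3)]
      by (simp add: S12' lower_def mat_add_left[of _ d] mat_add_right[of _ d] mat_smult_left[of _ d] mat_smult_right[of _ d] algebra_simps)
  qed (use carrier_matD[OF lower] carrier_matD[OF C(3)] in auto)
  have raise_r: "spin_raising S * r \<theta> = complex_of_real (exp (- \<theta>)) \<cdot>\<^sub>m (r \<theta> * spin_raising S)" for \<theta>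
    using inter[OF C(4) raise, of \<theta>] by simp
  have low_r: "lower * r \<theta> = complex_of_real (exp \<theta>) \<cdot>\<^sub>m (r \<theta> * lower)" for \<theta>
    using inter[OF lower low, of \<theta>] by simp
  have S3_r: "S 3 * r \<theta> = r \<theta> * S 3" for \<theta>
  proof -
    have "S 3 * S 3 - S 3 * S 3 = complex_of_real 0 \<cdot>\<^sub>m S 3"
      using carrier_matD[OF C(3)] by (auto intro!: eq_matI)
    moreover have "1 \<cdot>\<^sub>m X = X" for X :: "complex mat"
      by (auto intro!: eq_matI)
    ultimately show ?thesis
      using inter[OF C(3), of 0 \<theta>] by simp
  qed
  have dims: "dim_row (S 1) = d" "dim_col (S 1) = d" "dim_row (S 2) = d" "dim_col (S 2) = d" "dim_row (r \<theta>) = d" "dim_col (r \<theta>) = d" for \<theta>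
    using carrier_matD[OF C(1)] carrier_matD[OF C(2)] carrier_matD[OF r] by auto
  have entries: "(S 1 * r \<theta>) $$ (i, j) + \<i> * (S 2 * r \<theta>) $$ (i, j) =
      complex_of_real (exp (- \<theta>)) * ((r \<theta> * S 1) $$ (i, j) + \<i> * (r \<theta> * S 2) $$ (i, j))"
    "(S 1 * r \<theta>) $$ (i, j) - \<i> * (S 2 * r \<theta>) $$ (i, j) =
      complex_of_real (exp \<theta>) * ((r \<theta> * S 1) $$ (i, j) - \<i> * (r \<theta> * S 2) $$ (i, j))" if "i < d" "j < d" for i j \<theta>
    using arg_cong[OF raise_r[of \<theta>], of "\<lambda>A. A $$ (i, j)"] arg_cong[OF low_r[of \<theta>], of "\<lambda>A. A $$ (i, j)"] that r[of \<theta>] dims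
    by (auto simp: spin_raising_def lower_def mat_add_left[of _ d] mat_add_right[of _ d] mat_smult_left[of _ d] mat_smult_right[of _ d])
  have solve: "a = complex_of_real (cosh \<theta>) * a' + (- \<i> * complex_of_real (sinh \<theta>)) * b' \<and>
      b = complex_of_real (cosh \<theta>) * b' + (\<i> * complex_of_real (sinh \<theta>)) * a'"
    if "a + \<i> * b = complex_of_real (exp (- \<theta>)) * (a' + \<i> * b')" "a - \<i> * b = complex_of_real (exp \<theta>) * (a' - \<i> * b')" for a b a' b' \<theta>
  proof -
    define p m where "p = complex_of_real (exp \<theta>)" and "m = complex_of_real (exp (- \<theta>))"
    have ch: "complex_of_real (cosh \<theta>) = (p + m) / 2" "complex_of_real (sinh \<theta>) = (p - m) / 2"
      by (simp_all add: p_def m_def cosh_def sinh_def)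
    have "a = ((a + \<i> * b) + (a - \<i> * b)) / 2" "b = - \<i> * ((a + \<i> * b) - (a - \<i> * b)) / 2"
      by (simp_all add: algebra_simps)
    then have ab: "a = (m * (a' + \<i> * b') + p * (a' - \<i> * b')) / 2" "b = - \<i> * (m * (a' + \<i> * b') - p * (a' - \<i> * b')) / 2"
      unfolding that p_def m_def by blast+
    show ?thesis
      unfolding ch by (subst ab(1), subst ab(2)) (simp add: field_simps)
  qed
  show ?thesis
  proof (rule that[of r, OF r r0 rr _ _ S3_r])
    fix \<theta>
    show "S 1 * r \<theta> = r \<theta> * (complex_of_real (cosh \<theta>) \<cdot>\<^sub>m S 1 + (- \<i> * complex_of_real (sinh \<theta>)) \<cdot>\<^sub>m S 2)"
      using solve[OF entries] r[of \<theta>] dims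
      by (intro eq_matI) (auto simp: mat_add_right[of _ d] mat_smult_right[of _ d])
    show "S 2 * r \<theta> = r \<theta> * (complex_of_real (cosh \<theta>) \<cdot>\<^sub>m S 2 + (\<i> * complex_of_real (sinh \<theta>)) \<cdot>\<^sub>m S 1)"
      using solve[OF entries] r[of \<theta>] dims
      by (intro eq_matI) (auto simp: mat_add_right[of _ d] mat_smult_right[of _ d])
    show "spin_raising S * r \<theta> = r \<theta> * (complex_of_real (exp (- \<theta>)) \<cdot>\<^sub>m spin_raising S)"
      using raise_r[of \<theta>] r[of \<theta>] mat_smult_right[OF r C(4)] by simp
  qed
qed

end

section \<open>Complex rotations of the spins\<close>

text \<open>\<open>R\<close> is the product of the local rotations. A site operator commutes with
  every factor but the one at its own site, so the single-site relation carries over.\<close>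

lemma site_op_product_rotation:
  fixes r :: "real \<Rightarrow> complex mat" and \<theta> :: "nat \<Rightarrow> real"
  assumes d: "d > 0" and r: "\<And>a. r a \<in> carrier_mat d d" "\<And>a. r a * r (- a) = 1\<^sub>m d"
  obtains R R' where "R \<in> carrier_mat (d ^ n) (d ^ n)" "R' \<in> carrier_mat (d ^ n) (d ^ n)"
    "R * R' = 1\<^sub>m (d ^ n)" "R' * R = 1\<^sub>m (d ^ n)"
    "\<And>x A B. x < n \<Longrightarrow> A \<in> carrier_mat d d \<Longrightarrow> B \<in> carrier_mat d d \<Longrightarrow> A * r (\<theta> x) = r (\<theta> x) * B \<Longrightarrow>
      site_op d n x A * R = R * site_op d n x B"
proof -
  define N where "N = d ^ n"
  have site_op_closed [simp]: "site_op d n x A \<in> carrier_mat N N" for x A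
    using d by (simp add: N_def)
  \<comment> \<open>The partial product covers the sites below \<open>k\<close>. The last clause,
    that operators at the other sites still commute with it, allows the factor of site
    \<open>k\<close> to be appended.\<close>
  have "\<exists>R R'. R \<in> carrier_mat N N \<and> R' \<in> carrier_mat N N \<and> R * R' = 1\<^sub>m N \<and> R' * R = 1\<^sub>m N \<and>
    (\<forall>x<k. \<forall>A\<in>carrier_mat d d. \<forall>B\<in>carrier_mat d d. A * r (\<theta> x) = r (\<theta> x) * B \<longrightarrow>
      site_op d n x A * R = R * site_op d n x B) \<and>
    (\<forall>x. k \<le> x \<longrightarrow> x < n \<longrightarrow> (\<forall>A. site_op d n x A * R = R * site_op d n x A))" if "k \<le> n" for k
    using that
  proof (induction k)
    case 0
    show ?case
      by (rule exI[of _ "1\<^sub>m N"], rule exI[of _ "1\<^sub>m N"])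
        (auto simp: left_mult_one_mat[of _ N N] right_mult_one_mat[of _ N N])
  next
    case (Suc k)
    then obtain R R' where R: "R \<in> carrier_mat N N" "R' \<in> carrier_mat N N" "R * R' = 1\<^sub>m N" "R' * R = 1\<^sub>m N"
      and R_lt: "\<And>x A B. x < k \<Longrightarrow> A \<in> carrier_mat d d \<Longrightarrow> B \<in> carrier_mat d d \<Longrightarrow> A * r (\<theta> x) = r (\<theta> x) * B \<Longrightarrow>
        site_op d n x A * R = R * site_op d n x B"
      and R_ge: "\<And>x A. k \<le> x \<Longrightarrow> x < n \<Longrightarrow> site_op d n x A * R = R * site_op d n x A"
      by auto
    have k: "k < n" using Suc.prems by simp
    define a b where "a = site_op d n k (r (\<theta> k))" and "b = site_op d n k (r (- \<theta> k))"
    have ab [simp]: "a \<in> carrier_mat N N" "b \<in> carrier_mat N N" by (simp_all add: a_def b_def)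
    have inv: "a * b = 1\<^sub>m N" "b * a = 1\<^sub>m N"
      using r(2)[of "\<theta> k"] r(2)[of "- \<theta> k"]
      by (simp_all add: a_def b_def N_def site_op_mult[OF d r(1) r(1) k, symmetric] site_op_one[OF d])
    have "(R * a) * (b * R') = R * ((a * b) * R')" "(b * R') * (R * a) = b * ((R' * R) * a)"
      using R(1,2) by (simp_all add: mat_assoc[of _ N])
    then have "(R * a) * (b * R') = 1\<^sub>m N" "(b * R') * (R * a) = 1\<^sub>m N"
      using R inv by (simp_all add: left_mult_one_mat[of _ N N])
    moreover have "site_op d n x A * (R * a) = (R * a) * site_op d n x B"
      if x: "x < Suc k" and A: "A \<in> carrier_mat d d" and B: "B \<in> carrier_mat d d"
        and AB: "A * r (\<theta> x) = r (\<theta> x) * B" for x A B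
    proof (cases "x = k")
      case True
      have "site_op d n x A * a = a * site_op d n x B"
        unfolding a_def True using AB A B k d r by (simp add: True flip: site_op_mult)
      then show ?thesis
        using R(1) R_ge[of x A] k True
        by (simp add: mat_assoc[of _ N, symmetric]) (simp add: mat_assoc[of _ N])
    next
      case False
      then have "x < k" using x by simp
      have "site_op d n x B * a = a * site_op d n x B"
        unfolding a_def using \<open>x < k\<close> k d by (intro site_op_commute) auto
      then show ?thesis
        using R(1) R_lt[OF \<open>x < k\<close> A B AB]
        by (simp add: mat_assoc[of _ N, symmetric]) (simp add: mat_assoc[of _ N])
    qed
    moreover have "site_op d n x A * (R * a) = (R * a) * site_op d n x A" if x: "Suc k \<le> x" "x < n" for x A
    proof -
      have "site_op d n x A * a = a * site_op d n x A"
        unfolding a_def using x k d by (intro site_op_commute) auto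
      then show ?thesis
        using R(1) R_ge[of x A] x
        by (simp add: mat_assoc[of _ N, symmetric]) (simp add: mat_assoc[of _ N])
    qed
    ultimately show ?case
      using R by (intro exI[of _ "R * a"] exI[of _ "b * R'"]) auto
  qed
  from this[of n] obtain R R' where "R \<in> carrier_mat N N" "R' \<in> carrier_mat N N" "R * R' = 1\<^sub>m N" "R' * R = 1\<^sub>m N"
    "\<And>x A B. x < n \<Longrightarrow> A \<in> carrier_mat d d \<Longrightarrow> B \<in> carrier_mat d d \<Longrightarrow> A * r (\<theta> x) = r (\<theta> x) * B \<Longrightarrow>
      site_op d n x A * R = R * site_op d n x B"
    by blast
  then show ?thesis
    unfolding N_def by (rule that)
qed

text \<open>The left factors are spin operators rotated by the imaginary angle \<open>\<i> \<alpha>\<close>, the right factors those of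
  another site, rotated by \<open>\<i> \<eta>\<close>.\<close>

lemma rotated_dot:
  fixes s1 s2 s3 s1' s2' s3' :: "complex mat" and \<alpha> \<eta> :: real
  assumes [simp]: "s1 \<in> carrier_mat N N" "s2 \<in> carrier_mat N N" "s3 \<in> carrier_mat N N"
    "s1' \<in> carrier_mat N N" "s2' \<in> carrier_mat N N" "s3' \<in> carrier_mat N N"
  shows "(complex_of_real (cosh \<alpha>) \<cdot>\<^sub>m s1 + (- \<i> * complex_of_real (sinh \<alpha>)) \<cdot>\<^sub>m s2) *
        (complex_of_real (cosh \<eta>) \<cdot>\<^sub>m s1' + (- \<i> * complex_of_real (sinh \<eta>)) \<cdot>\<^sub>m s2') +
      (complex_of_real (cosh \<alpha>) \<cdot>\<^sub>m s2 + (\<i> * complex_of_real (sinh \<alpha>)) \<cdot>\<^sub>m s1) *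
        (complex_of_real (cosh \<eta>) \<cdot>\<^sub>m s2' + (\<i> * complex_of_real (sinh \<eta>)) \<cdot>\<^sub>m s1') + s3 * s3' =
    (s1 * s1' + s2 * s2' + s3 * s3') + complex_of_real (cosh (\<alpha> - \<eta>) - 1) \<cdot>\<^sub>m (s1 * s1' + s2 * s2') +
      complex_of_real (sinh (\<alpha> - \<eta>)) \<cdot>\<^sub>m (\<i> \<cdot>\<^sub>m (s1 * s2') + (- \<i>) \<cdot>\<^sub>m (s2 * s1'))"
    (is "?l = ?r")
proof (rule eq_matI)
  have dims [simp]: "dim_row s1 = N" "dim_row s2 = N" "dim_row s3 = N" "dim_col s1' = N" "dim_col s2' = N" "dim_col s3' = N"
    "dim_row s1' = N" "dim_row s2' = N" "dim_row s3' = N" "dim_col s1 = N" "dim_col s2 = N" "dim_col s3 = N"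
    using assms[THEN carrier_matD(1)] assms[THEN carrier_matD(2)] by auto
  show "dim_row ?l = dim_row ?r" "dim_col ?l = dim_col ?r" by auto
  fix i j assume "i < dim_row ?r" "j < dim_col ?r"
  then have ij: "i < N" "j < N" by auto
  show "?l $$ (i, j) = ?r $$ (i, j)"
    using ij
    by (simp add: mat_add_left[of _ N] mat_add_right[of _ N] mat_smult_left[of _ N] mat_smult_right[of _ N]
        cosh_diff sinh_diff algebra_simps)
qed

context
  fixes t n :: nat and S :: "nat \<Rightarrow> complex mat" and d N :: nat and M :: real
  assumes spin: "spin_matrices t S" and d_def: "d = t + 1" and N_def: "N = d ^ n"
    and M_def: "M = real t / 2 * (real t / 2 + 1)"
begin

lemma d_pos: "d > 0" by (simp add: d_def)

lemmas spin_carriers [simp] = S_carrier[OF spin, folded d_def] spin_raising_carrier[OF spin, folded d_def]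

lemma site_op_closed [simp]: "site_op d n x A \<in> carrier_mat N N"
  using d_pos by (simp add: N_def)

lemma site_op_spin_hermitian: "j \<in> {1, 2, 3} \<Longrightarrow> mat_adjoint (site_op d n x (S j)) = site_op d n x (S j)"
  using S_hermitian[OF spin] by (auto simp: site_op_adjoint[OF d_pos, symmetric])

lemma casimir_nonneg: "M \<ge> 0" by (simp add: M_def)

text \<open>For a Hermitian operator the squared norm is the quadratic form of its square, and the
  three squares add up to a multiple of the identity. All norm bounds on interactions rest on
  this.\<close>

lemma casimir:
  assumes x: "x < n" and v: "v \<in> carrier_vec N"
  shows "(vnorm (site_op d n x (S 1) *\<^sub>v v))\<^sup>2 + (vnorm (site_op d n x (S 2) *\<^sub>v v))\<^sup>2 +
    (vnorm (site_op d n x (S 3) *\<^sub>v v))\<^sup>2 = M * (vnorm v)\<^sup>2"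
proof -
  have sq: "(vnorm (site_op d n x (S j) *\<^sub>v v))\<^sup>2 = Re (vinner v (site_op d n x (S j * S j) *\<^sub>v v))"
    if j: "j \<in> {1, 2, 3}" for j
  proof -
    have "S j \<in> carrier_mat d d" using j by auto
    then show ?thesis
      unfolding site_op_mult[OF d_pos \<open>S j \<in> carrier_mat d d\<close> \<open>S j \<in> carrier_mat d d\<close> x]
      by (intro vinner_hermitian_sq[OF site_op_closed site_op_spin_hermitian[OF j] v])
  qed
  have c: "S 1 * S 1 \<in> carrier_mat d d" "S 2 * S 2 \<in> carrier_mat d d" "S 3 * S 3 \<in> carrier_mat d d"
    by (intro mult_carrier_mat[of _ d d]; simp)+
  have "site_op d n x (S 1 * S 1) + site_op d n x (S 2 * S 2) + site_op d n x (S 3 * S 3) =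
      site_op d n x (S 1 * S 1 + S 2 * S 2 + S 3 * S 3)"
    by (simp only: site_op_add[OF d_pos add_carrier_mat[OF c(2)] c(3)] site_op_add[OF d_pos c(1,2)])
  also have "S 1 * S 1 + S 2 * S 2 + S 3 * S 3 = complex_of_real M \<cdot>\<^sub>m 1\<^sub>m d"
    using spin unfolding spin_matrices_def M_def d_def by blast
  also have "site_op d n x (complex_of_real M \<cdot>\<^sub>m 1\<^sub>m d) = complex_of_real M \<cdot>\<^sub>m 1\<^sub>m N"
    using d_pos by (simp add: site_op_smult site_op_one N_def)
  finally have e1: "vinner v ((site_op d n x (S 1 * S 1) + site_op d n x (S 2 * S 2) + site_op d n x (S 3 * S 3)) *\<^sub>v v) =
      complex_of_real (M * (vnorm v)\<^sup>2)"
    using v by (simp add: smult_mat_vec[of _ N] vinner_smult_right[of _ N] vinner_self)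
  have e2: "vinner v ((site_op d n x (S 1 * S 1) + site_op d n x (S 2 * S 2) + site_op d n x (S 3 * S 3)) *\<^sub>v v) =
      vinner v (site_op d n x (S 1 * S 1) *\<^sub>v v) + vinner v (site_op d n x (S 2 * S 2) *\<^sub>v v) +
      vinner v (site_op d n x (S 3 * S 3) *\<^sub>v v)"
    using v by (simp add: mat_vec_add[of _ N] vinner_add_right[of _ N])
  show ?thesis
    unfolding sq[of 1, simplified] sq[of 2, simplified] sq[of 3, simplified]
    using arg_cong[OF trans[OF e2[symmetric] e1], of Re] by simp
qed

text \<open>\<open>twisted_dot\<close> is the dot product after imaginary rotations whose angles
  differ by \<open>\<delta>\<close>. Only the difference enters, as a common rotation leaves the dot
  product invariant; \<open>spin_xy\<close> is the first-order term.\<close>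

abbreviation "spin_xx x y \<equiv> site_op d n x (S 1) * site_op d n y (S 1) + site_op d n x (S 2) * site_op d n y (S 2)"
abbreviation "spin_xy x y \<equiv> \<i> \<cdot>\<^sub>m (site_op d n x (S 1) * site_op d n y (S 2)) + (- \<i>) \<cdot>\<^sub>m (site_op d n x (S 2) * site_op d n y (S 1))"
abbreviation "twisted_dot \<delta> x y \<equiv> spin_dot t n S x y + complex_of_real (cosh \<delta> - 1) \<cdot>\<^sub>m spin_xx x y +
  complex_of_real (sinh \<delta>) \<cdot>\<^sub>m spin_xy x y"

lemma spin_dot_eq: "spin_dot t n S x y = site_op d n x (S 1) * site_op d n y (S 1) +
    site_op d n x (S 2) * site_op d n y (S 2) + site_op d n x (S 3) * site_op d n y (S 3)"
  by (simp add: spin_dot_def d_def)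

lemma spin_dot_carrier [simp]: "spin_dot t n S x y \<in> carrier_mat N N"
  by (simp add: spin_dot_eq)

text \<open>The Casimir identity at \<open>y\<close> bounds the vectors and that at \<open>x\<close>
  the operators applied to them; each contributes a root of \<open>M\<close>. A missing third
  component is filled by the zero vector.\<close>

lemma spin_dot_bounds:
  assumes x: "x < n" and y: "y < n"
  shows "op_bounded (spin_dot t n S x y) M" "op_bounded (spin_xx x y) M" "op_bounded (spin_xy x y) M"
proof -
  let ?s = "\<lambda>x j. site_op d n x (S j)"
  have three: "vnorm (?s x 1 *\<^sub>v y1 + ?s x 2 *\<^sub>v y2 + ?s x 3 *\<^sub>v y3) \<le> M * vnorm v"
    if "y1 \<in> carrier_vec N" "y2 \<in> carrier_vec N" "y3 \<in> carrier_vec N" "v \<in> carrier_vec N"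
      "(vnorm y1)\<^sup>2 + (vnorm y2)\<^sup>2 + (vnorm y3)\<^sup>2 \<le> M * (vnorm v)\<^sup>2" for y1 y2 y3 v
    using that x casimir_nonneg casimir[OF x]
    by (intro vnorm_three_term[of _ N]) (auto simp: site_op_spin_hermitian)
  note cas = casimir[OF y]
  have cas2: "(vnorm (?s y 1 *\<^sub>v v))\<^sup>2 + (vnorm (?s y 2 *\<^sub>v v))\<^sup>2 \<le> M * (vnorm v)\<^sup>2" if "v \<in> carrier_vec N" for v
    using cas[OF that] zero_le_power2[of "vnorm (?s y 3 *\<^sub>v v)"] by linarith
  have dims [simp]: "dim_col (spin_dot t n S x y) = N" "dim_col (?s z j) = N" "dim_row (?s z j) = N" for z j
    using carrier_matD[OF spin_dot_carrier] carrier_matD[OF site_op_closed] by auto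
  show "op_bounded (spin_dot t n S x y) M"
    unfolding op_bounded_def
  proof
    fix v :: "complex vec" assume "v \<in> carrier_vec (dim_col (spin_dot t n S x y))"
    then have v: "v \<in> carrier_vec N" by simp
    have "spin_dot t n S x y *\<^sub>v v = ?s x 1 *\<^sub>v (?s y 1 *\<^sub>v v) + ?s x 2 *\<^sub>v (?s y 2 *\<^sub>v v) + ?s x 3 *\<^sub>v (?s y 3 *\<^sub>v v)"
      using v by (simp add: spin_dot_eq mat_vec_add[of _ N] mat_vec_assoc[of _ N])
    also have "vnorm \<dots> \<le> M * vnorm v"
      using v cas[OF v] by (intro three) auto
    finally show "vnorm (spin_dot t n S x y *\<^sub>v v) \<le> M * vnorm v" .
  qed
  show "op_bounded (spin_xx x y) M"
    unfolding op_bounded_def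
  proof
    fix v :: "complex vec" assume "v \<in> carrier_vec (dim_col (spin_xx x y))"
    then have v: "v \<in> carrier_vec N" by simp
    have "spin_xx x y *\<^sub>v v = ?s x 1 *\<^sub>v (?s y 1 *\<^sub>v v) + ?s x 2 *\<^sub>v (?s y 2 *\<^sub>v v) + ?s x 3 *\<^sub>v 0\<^sub>v N"
      using v by (auto simp: mat_vec_add[of _ N] mat_vec_assoc[of _ N] mult_mat_vec_index intro!: eq_vecI)
    also have "vnorm \<dots> \<le> M * vnorm v"
      using v cas2[OF v] by (intro three) auto
    finally show "vnorm (spin_xx x y *\<^sub>v v) \<le> M * vnorm v" .
  qed
  show "op_bounded (spin_xy x y) M"
    unfolding op_bounded_def
  proof
    fix v :: "complex vec" assume "v \<in> carrier_vec (dim_col (spin_xy x y))"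
    then have v: "v \<in> carrier_vec N" by simp
    have "spin_xy x y *\<^sub>v v = ?s x 1 *\<^sub>v (\<i> \<cdot>\<^sub>v (?s y 2 *\<^sub>v v)) + ?s x 2 *\<^sub>v ((- \<i>) \<cdot>\<^sub>v (?s y 1 *\<^sub>v v)) + ?s x 3 *\<^sub>v 0\<^sub>v N"
      using v by (auto simp: mat_vec_add[of _ N] mat_vec_assoc[of _ N] smult_mat_vec[of _ N] mult_mat_vec[of _ N N]
          mult_mat_vec_index intro!: eq_vecI)
    also have "vnorm \<dots> \<le> M * vnorm v"
      using v cas2[OF v] by (intro three) (auto simp: vnorm_smult add.commute)
    finally show "vnorm (spin_xy x y *\<^sub>v v) \<le> M * vnorm v" .
  qed
qed

text \<open>Hermitian operators at distinct sites commute, so their products are Hermitian; the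
  factor \<i> then makes \<open>spin_xy\<close> anti-Hermitian.\<close>

lemma spin_dot_adjoints:
  assumes "x < n" "y < n" "x \<noteq> y"
  shows "mat_adjoint (spin_dot t n S x y) = spin_dot t n S x y" "mat_adjoint (spin_xx x y) = spin_xx x y"
    "mat_adjoint (spin_xy x y) = (- 1) \<cdot>\<^sub>m spin_xy x y"
proof -
  note [simp] = carrier_matD[OF site_op_closed]
  have "mat_adjoint (site_op d n x (S i) * site_op d n y (S j)) = site_op d n x (S i) * site_op d n y (S j)"
    if "i \<in> {1, 2, 3}" "j \<in> {1, 2, 3}" for i j
    using that assms site_op_commute[OF d_pos assms(3,1,2)]
    by (simp add: mat_adjoint_mult[of _ N] site_op_spin_hermitian)
  then show "mat_adjoint (spin_dot t n S x y) = spin_dot t n S x y" "mat_adjoint (spin_xx x y) = spin_xx x y"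
    "mat_adjoint (spin_xy x y) = (- 1) \<cdot>\<^sub>m spin_xy x y"
    by (auto simp: spin_dot_eq mat_adjoint_add[of _ N] mat_adjoint_smult[of _ N] intro!: eq_matI)
qed

lemma hamiltonian_eq:
  "hamiltonian t n E S c = lin_mat N (edge_pairs E \<times> {1..t}) (\<lambda>((x, y), k). - complex_of_real (c k x y))
    (\<lambda>((x, y), k). spin_dot t n S x y ^\<^sub>m k)"
proof -
  have "(\<Sum>p\<in>edge_pairs E \<times> {1..t}. (\<lambda>((x, y), k). - complex_of_real (c k x y)) p * (\<lambda>((x, y), k). spin_dot t n S x y ^\<^sub>m k) p $$ (i, j)) =
    - (\<Sum>(x, y)\<in>edge_pairs E. \<Sum>k=1..t. complex_of_real (c k x y) * (spin_dot t n S x y ^\<^sub>m k) $$ (i, j))" for i j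
    by (simp add: sum_negf[symmetric] sum.cartesian_product case_prod_unfold)
  then show ?thesis
    unfolding hamiltonian_def lin_mat_def N_def d_def edge_pairs_def[symmetric]
    by (intro cong_mat refl) (simp only: prod.case)
qed

text \<open>As \<open>\<theta> y0 = 0\<close>, the rotation leaves an arbitrary \<open>A\<close> at
  \<open>y0\<close> untouched. The sum in the exponent collects the second-order losses of all
  interaction terms; the loss estimate is two-sided, so couplings of either sign are
  covered.\<close>

lemma gibbs_rotation_bound:
  fixes \<theta> :: "nat \<Rightarrow> real"
  assumes graph: "finite_graph n E" and \<beta>: "\<beta> > 0" and x0: "x0 < n" and y0: "y0 < n" and \<theta>: "\<theta> y0 = 0"
    and A: "A \<in> carrier_mat d d"
  shows "cmod (gibbs_state \<beta> (hamiltonian t n E S c) (site_op d n x0 (spin_raising S) * site_op d n y0 A))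
    \<le> exp (- \<theta> x0) * (matrix_bound (spin_raising S) * matrix_bound A) *
      exp (\<beta> * (\<Sum>((x, y), k)\<in>edge_pairs E \<times> {1..t}. \<bar>c k x y\<bar> * (M ^ k * (cosh (k * (\<theta> x - \<theta> y)) - 1))))"
proof -
  obtain r where r: "\<And>a. r a \<in> carrier_mat d d" "r 0 = 1\<^sub>m d" "\<And>a. r a * r (- a) = 1\<^sub>m d"
    "\<And>a. S 1 * r a = r a * (complex_of_real (cosh a) \<cdot>\<^sub>m S 1 + (- \<i> * complex_of_real (sinh a)) \<cdot>\<^sub>m S 2)"
    "\<And>a. S 2 * r a = r a * (complex_of_real (cosh a) \<cdot>\<^sub>m S 2 + (\<i> * complex_of_real (sinh a)) \<cdot>\<^sub>m S 1)"
    "\<And>a. S 3 * r a = r a * S 3"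
    "\<And>a. spin_raising S * r a = r a * (complex_of_real (exp (- a)) \<cdot>\<^sub>m spin_raising S)"
    using spin_rotation[OF spin d_def] by metis
  obtain R R' where R: "R \<in> carrier_mat N N" "R' \<in> carrier_mat N N" "R * R' = 1\<^sub>m N" "R' * R = 1\<^sub>m N"
    and R_site_op: "\<And>x A B. x < n \<Longrightarrow> A \<in> carrier_mat d d \<Longrightarrow> B \<in> carrier_mat d d \<Longrightarrow> A * r (\<theta> x) = r (\<theta> x) * B \<Longrightarrow>
      site_op d n x A * R = R * site_op d n x B"
    using site_op_product_rotation[of d r, OF d_pos r(1,3), of n \<theta>] unfolding N_def by metis
  define I where "I = edge_pairs E \<times> {1..t}"
  define F where "F = (\<lambda>((x, y), k). spin_dot t n S x y ^\<^sub>m k)"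
  define F' where "F' = (\<lambda>((x, y), k). twisted_dot (\<theta> x - \<theta> y) x y ^\<^sub>m k)"
  define f where "f = (\<lambda>((x, y), k). - complex_of_real (c k x y))"
  define g where "g = (\<lambda>((x, y), k). \<bar>c k x y\<bar> * (M ^ k * (cosh (k * (\<theta> x - \<theta> y)) - 1)))"
  have F: "F e \<in> carrier_mat N N" "F' e \<in> carrier_mat N N" for e
    by (auto simp: F_def F'_def split: prod.splits)
  have "cmod (gibbs_state \<beta> (lin_mat N I f F) (site_op d n x0 (spin_raising S) * site_op d n y0 A))
    \<le> cmod (complex_of_real (exp (- \<theta> x0))) * (matrix_bound (spin_raising S) * matrix_bound A) * exp (\<beta> * (\<Sum>e\<in>I. g e))"
  proof (rule gibbs_state_bound[where H' = "lin_mat N I f F'", OF _ _ _ _ R])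
    have adj: "mat_adjoint (F e) = F e" if "e \<in> I" for e
      using that edge_pairsD[OF graph]
      by (auto simp: I_def F_def mat_adjoint_pow[of _ N] spin_dot_adjoints less_imp_neq)
    show "mat_adjoint (lin_mat N I f F) = lin_mat N I f F"
      by (intro lin_mat_hermitian F adj) (auto simp: f_def)
    have "F e * R = R * F' e" if e: "e \<in> I" for e
    proof -
      obtain x y k where xyk: "e = ((x, y), k)" by (metis prod.exhaust)
      then have xy: "x < n" "y < n" using e edge_pairsD[OF graph] by (auto simp: I_def)
      define U1 U2 where "U1 = (\<lambda>x. complex_of_real (cosh (\<theta> x)) \<cdot>\<^sub>m site_op d n x (S 1) + (- \<i> * complex_of_real (sinh (\<theta> x))) \<cdot>\<^sub>m site_op d n x (S 2))"
        and "U2 = (\<lambda>x. complex_of_real (cosh (\<theta> x)) \<cdot>\<^sub>m site_op d n x (S 2) + (\<i> * complex_of_real (sinh (\<theta> x))) \<cdot>\<^sub>m site_op d n x (S 1))"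
      have U: "U1 x \<in> carrier_mat N N" "U2 x \<in> carrier_mat N N" for x by (auto simp: U1_def U2_def)
      have site_op_R: "site_op d n x (S 1) * R = R * U1 x" "site_op d n x (S 2) * R = R * U2 x"
        "site_op d n x (S 3) * R = R * site_op d n x (S 3)" if "x < n" for x
        using R_site_op[OF that _ _ r(4)] R_site_op[OF that _ _ r(5)] R_site_op[OF that _ _ r(6)] d_pos
        by (simp_all add: U1_def U2_def site_op_add site_op_smult)
      have mv: "a * b * R = R * (a' * b')"
        if "a * R = R * a'" "b * R = R * b'" "a \<in> carrier_mat N N" "b \<in> carrier_mat N N" "a' \<in> carrier_mat N N" "b' \<in> carrier_mat N N"
        for a b a' b'
      proof -
        have "a * b * R = a * R * b'" using that(2-) R(1) by (simp add: mat_assoc[of _ N])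
        also have "\<dots> = R * a' * b'" by (simp only: that(1))
        finally show ?thesis using that R(1) by (simp add: mat_assoc[of _ N])
      qed
      have "spin_dot t n S x y * R = R * (U1 x * U1 y + U2 x * U2 y + site_op d n x (S 3) * site_op d n y (S 3))"
        using U R(1) mv[OF site_op_R(1)[OF xy(1)] site_op_R(1)[OF xy(2)]] mv[OF site_op_R(2)[OF xy(1)] site_op_R(2)[OF xy(2)]]
          mv[OF site_op_R(3)[OF xy(1)] site_op_R(3)[OF xy(2)]]
        by (simp add: spin_dot_eq mat_add_left[of _ N] mat_add_right[of _ N])
      also have "U1 x * U1 y + U2 x * U2 y + site_op d n x (S 3) * site_op d n y (S 3) = twisted_dot (\<theta> x - \<theta> y) x y"
        unfolding U1_def U2_def spin_dot_eq by (rule rotated_dot[of _ N]) auto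
      finally have "spin_dot t n S x y * R = R * twisted_dot (\<theta> x - \<theta> y) x y" .
      then show ?thesis
        unfolding xyk F_def F'_def prod.case using R(1) by (intro pow_mat_intertwine[of _ N]) auto
    qed
    then show "lin_mat N I f F * R = R * lin_mat N I f F'"
      using F R(1) by (intro lin_mat_intertwine) auto
    show "site_op d n x0 (spin_raising S) * site_op d n y0 A * R =
        complex_of_real (exp (- \<theta> x0)) \<cdot>\<^sub>m (R * (site_op d n x0 (spin_raising S) * site_op d n y0 A))"
    proof -
      have "site_op d n y0 A * R = R * site_op d n y0 A"
        by (rule R_site_op[OF y0 A A]) (use A \<theta> r(2) in \<open>simp add: left_mult_one_mat[of _ d d] right_mult_one_mat[of _ d d]\<close>)
      moreover have "site_op d n x0 (spin_raising S) * R = R * (complex_of_real (exp (- \<theta> x0)) \<cdot>\<^sub>m site_op d n x0 (spin_raising S))"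
        using R_site_op[OF x0 _ _ r(7)] d_pos by (simp add: site_op_smult)
      ultimately have "site_op d n x0 (spin_raising S) * site_op d n y0 A * R =
          R * (complex_of_real (exp (- \<theta> x0)) \<cdot>\<^sub>m site_op d n x0 (spin_raising S)) * site_op d n y0 A"
        using R(1) by (simp add: mat_assoc[of _ N] flip: mat_assoc[of _ N R])
      then show ?thesis
        using R(1) by (simp add: mat_assoc[of _ N] mat_smult_left[of _ N] mat_smult_right[of _ N])
    qed
    show "Re (vinner v (lin_mat N I f F *\<^sub>v v)) - (\<Sum>e\<in>I. g e) * (vnorm v)\<^sup>2 \<le> Re (vinner v (lin_mat N I f F' *\<^sub>v v))"
      if v: "v \<in> carrier_vec N" for v
    proof -
      have "Re (f e * vinner v (F e *\<^sub>v v)) - g e * (vnorm v)\<^sup>2 \<le> Re (f e * vinner v (F' e *\<^sub>v v))" if e: "e \<in> I" for e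
      proof -
        obtain x y k where xyk: "e = ((x, y), k)" by (metis prod.exhaust)
        then have xy: "x < n" "y < n" "x \<noteq> y" using e edge_pairsD[OF graph] by (auto simp: I_def)
        define a where "a = Re (vinner v (F e *\<^sub>v v))"
        define b where "b = Re (vinner v (F' e *\<^sub>v v))"
        have "\<bar>b - a\<bar> \<le> M ^ k * (cosh (k * (\<theta> x - \<theta> y)) - 1) * (vnorm v)\<^sup>2"
          unfolding a_def b_def xyk F_def F'_def prod.case
          by (rule hermitian_part_pow_bound[OF _ _ _ spin_dot_adjoints[OF xy] spin_dot_bounds[OF xy(1,2)] casimir_nonneg refl v]) auto
        then have "\<bar>c k x y\<bar> * \<bar>b - a\<bar> \<le> \<bar>c k x y\<bar> * (M ^ k * (cosh (k * (\<theta> x - \<theta> y)) - 1) * (vnorm v)\<^sup>2)"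
          by (intro mult_left_mono) auto
        moreover have "c k x y * (b - a) \<le> \<bar>c k x y\<bar> * \<bar>b - a\<bar>"
          by (metis abs_ge_self abs_mult)
        ultimately have "c k x y * (b - a) \<le> g e * (vnorm v)\<^sup>2"
          by (simp add: g_def xyk mult.assoc)
        then show ?thesis
          by (simp add: f_def xyk a_def[symmetric, unfolded xyk] b_def[symmetric, unfolded xyk] algebra_simps)
      qed
      then have "(\<Sum>e\<in>I. Re (f e * vinner v (F e *\<^sub>v v)) - g e * (vnorm v)\<^sup>2) \<le> (\<Sum>e\<in>I. Re (f e * vinner v (F' e *\<^sub>v v)))"
        by (rule sum_mono)
      then show ?thesis
        using F v by (simp add: vinner_lin_mat sum_subtractf sum_distrib_right)
    qed
    show "op_bounded (site_op d n x0 (spin_raising S) * site_op d n y0 A) (matrix_bound (spin_raising S) * matrix_bound A)"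
      using x0 y0 d_pos A by (intro op_bounded_mult[of _ N] op_bounded_matrix_bound) auto
  qed (use \<beta> d_pos in \<open>auto simp: N_def\<close>)
  then show ?thesis
    by (simp add: hamiltonian_eq I_def f_def F_def g_def)
qed

end

section \<open>Distances in the graph\<close>

lemma graph_dist_reachable:
  assumes "(x, y) \<in> {(u, v). {u, v} \<in> E} ^^ l"
  shows "(x, y) \<in> {(u, v). {u, v} \<in> E} ^^ graph_dist E x y" "graph_dist E x y \<le> l"
proof -
  define L where "L = {l. (x, y) \<in> {(u, v). {u, v} \<in> E} ^^ l}"
  have l: "l \<in> L" using assms by (simp add: L_def)
  then have "graph_dist E x y = (LEAST l. l \<in> L)"
    by (auto simp: graph_dist_def L_def[symmetric] Let_def)
  then show "(x, y) \<in> {(u, v). {u, v} \<in> E} ^^ graph_dist E x y" "graph_dist E x y \<le> l"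
    using LeastI[of "\<lambda>l. l \<in> L", OF l] Least_le[of "\<lambda>l. l \<in> L", OF l] by (auto simp: L_def)
qed

lemma graph_dist_unreachable:
  "(\<And>l. (x, y) \<notin> {(u, v). {u, v} \<in> E} ^^ l) \<Longrightarrow> graph_dist E x y = 0"
  by (simp add: graph_dist_def)

lemma graph_dist_self [simp]: "graph_dist E x x = 0"
  using graph_dist_reachable(2)[of x x 0 E] by simp

text \<open>Edges can be walked both ways, so the end points are both reachable from
  \<open>x\<close> or both unreachable; in the second case both distances are 0.\<close>

lemma graph_dist_edge:
  assumes uv: "{u, v} \<in> E"
  shows "graph_dist E x v \<le> graph_dist E x u + 1"
proof (cases "\<exists>l. (x, v) \<in> {(u, v). {u, v} \<in> E} ^^ l")
  case True
  then obtain l where "(x, v) \<in> {(u, v). {u, v} \<in> E} ^^ l" by blast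
  then have "(x, u) \<in> {(u, v). {u, v} \<in> E} ^^ Suc l"
    using uv by (intro relpow_Suc_I) (auto simp: insert_commute)
  from graph_dist_reachable(1)[OF this]
  have "(x, v) \<in> {(u, v). {u, v} \<in> E} ^^ Suc (graph_dist E x u)"
    using uv by (intro relpow_Suc_I) auto
  then show ?thesis
    using graph_dist_reachable(2) by fastforce
qed (simp add: graph_dist_unreachable)

text \<open>Unreachable vertices have distance 0 as well, but no neighbour at distance 1.\<close>

lemma graph_dist_edge_root:
  assumes uv: "{u, v} \<in> E" and "graph_dist E x u = 0" "graph_dist E x v = 1"
  shows "u = x"
proof -
  obtain l where "(x, v) \<in> {(u, v). {u, v} \<in> E} ^^ l"
    using graph_dist_unreachable[of x v E] assms(3) by auto
  then have "(x, u) \<in> {(u, v). {u, v} \<in> E} ^^ Suc l"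
    using uv by (intro relpow_Suc_I) (auto simp: insert_commute)
  from graph_dist_reachable(1)[OF this] show ?thesis
    using assms(2) by simp
qed

lemma graph_dist_neighbour:
  assumes "finite_graph n E" "{u, v} \<in> E"
  shows "v < n" "graph_dist E u v = 1"
proof -
  have uv: "u \<noteq> v" "v < n"
    using assms by (auto simp: finite_graph_def doubleton_eq_iff) 
  then show "v < n" by simp
  have "(u, v) \<in> {(u, v). {u, v} \<in> E} ^^ 1" using assms by simp
  note r = graph_dist_reachable[OF this]
  have "graph_dist E u v \<noteq> 0"
    using r(1) uv by (metis pair_in_Id_conv relpow.simps(1))
  then show "graph_dist E u v = 1" using r(2) by simp
qed

text \<open>A real supremum is an upper bound only if the set is bounded above; here all quotients
  are at most \<open>n\<close>.\<close>

lemma sphere_card_le: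
  assumes x: "x < n" and l: "l \<ge> 1"
  shows "real (card {y. y < n \<and> graph_dist E x y = l}) \<le> perimeter_constant n E * l"
proof -
  let ?f = "\<lambda>x l. real (card {y. y < n \<and> graph_dist E x y = l}) / real l"
  have bd: "?f x l \<le> n" if "l \<in> {1..}" for x l
  proof -
    have "card {y. y < n \<and> graph_dist E x y = l} \<le> card {..<n}"
      by (rule card_mono) auto
    then have "?f x l \<le> real n / real l" by (intro divide_right_mono) auto
    also have "\<dots> \<le> real n / 1" using that by (intro divide_left_mono) auto
    finally show ?thesis by simp
  qed
  have "?f x l \<le> (SUP l\<in>{1..}. ?f x l)"
    using l bd by (intro cSUP_upper bdd_aboveI2[where M = "real n"]) auto
  also have "\<dots> \<le> perimeter_constant n E"
    unfolding perimeter_constant_def using x by (intro cSUP_upper bdd_above_finite) auto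
  finally show ?thesis using l by (simp add: field_simps)
qed

text \<open>Neighbours lie on the sphere of radius 1, so the perimeter constant also bounds the
  degree.\<close>

lemma neighbours_card_le:
  assumes "finite_graph n E" "u < n"
  shows "real (card {v. {u, v} \<in> E}) \<le> perimeter_constant n E"
proof -
  have "card {v. {u, v} \<in> E} \<le> card {y. y < n \<and> graph_dist E u y = 1}"
    using graph_dist_neighbour[OF assms(1)] by (intro card_mono) auto
  then show ?thesis using sphere_card_le[OF assms(2), of 1 E] by simp
qed

text \<open>The sphere of radius l has at most \<gamma> l vertices, each of degree at most \<gamma>.
  For l = 0 such an edge can start only at \<open>x\<close>, which explains the maximum with
  1.\<close>

lemma shell_edges_card_le:
  assumes graph: "finite_graph n E" and x: "x < n"
  defines "\<gamma> \<equiv> perimeter_constant n E"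
  shows "real (card {(u, v). {u, v} \<in> E \<and> graph_dist E x u = l \<and> graph_dist E x v = Suc l}) \<le> \<gamma>\<^sup>2 * max 1 (real l)"
proof -
  define B where "B = {(u, v). {u, v} \<in> E \<and> graph_dist E x u = l \<and> graph_dist E x v = Suc l}"
  define U where "U = (if l = 0 then {x} else {y. y < n \<and> graph_dist E x y = l})"
  have nb: "v < n \<and> u < n" if "{u, v} \<in> E" for u v
    using graph_dist_neighbour(1)[OF graph that] graph_dist_neighbour(1)[OF graph, of v u] that
    by (simp add: insert_commute)
  have fin: "finite {v. {u, v} \<in> E}" for u
    by (rule finite_subset[of _ "{..<n}"]) (auto dest: nb)
  have U: "finite U" "u \<in> U \<Longrightarrow> u < n" for u using x by (auto simp: U_def split: if_splits)
  have "B \<subseteq> (SIGMA u:U. {v. {u, v} \<in> E})"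
    using graph_dist_edge_root[of _ _ E x] by (auto simp: B_def U_def dest: nb)
  then have "card B \<le> card (SIGMA u:U. {v. {u, v} \<in> E})"
    using U fin by (intro card_mono) auto
  also have "\<dots> = (\<Sum>u\<in>U. card {v. {u, v} \<in> E})"
    using U fin by (intro card_SigmaI) auto
  finally have "real (card B) \<le> (\<Sum>u\<in>U. real (card {v. {u, v} \<in> E}))"
    by (metis of_nat_le_iff of_nat_sum)
  also have "\<dots> \<le> (\<Sum>u\<in>U. \<gamma>)"
    unfolding \<gamma>_def using U by (intro sum_mono neighbours_card_le[OF graph]) auto
  finally have B_le: "real (card B) \<le> card U * \<gamma>" by simp
  show ?thesis
  proof (cases "B = {}")
    case True
    then show ?thesis unfolding B_def[symmetric] by simp
  next
    case False
    then obtain u v where "{u, v} \<in> E" by (auto simp: B_def)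
    then have "card {v. {u, v} \<in> E} \<ge> 1"
      using fin[of u] card_0_eq[of "{v. {u, v} \<in> E}"] by (metis (mono_tags, lifting) One_nat_def Suc_leI card_gt_0_iff empty_iff mem_Collect_eq)
    \<comment> \<open>Needed for l = 0, where the single vertex \<open>x\<close> must be bounded by
      \<open>\<gamma>\<close>.\<close>
    then have \<gamma>: "\<gamma> \<ge> 1"
      using neighbours_card_le[OF graph, of u] nb[OF \<open>{u, v} \<in> E\<close>] by (simp add: \<gamma>_def)
    have "real (card U) \<le> \<gamma> * max 1 (real l)"
    proof (cases "l = 0")
      case True
      then show ?thesis using \<gamma> by (simp add: U_def)
    next
      case False
      then show ?thesis
        using sphere_card_le[OF x, of l E] by (simp add: U_def \<gamma>_def)
    qed
    then have "real (card U) * \<gamma> \<le> \<gamma> * max 1 (real l) * \<gamma>"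
      using \<gamma> by (intro mult_right_mono) auto
    then show ?thesis
      unfolding B_def[symmetric] using B_le by (simp add: power2_eq_square mult_ac)
  qed
qed

text \<open>The angle at distance \<open>l\<close> from \<open>x\<close>, where \<open>D\<close> is
  the distance of \<open>y\<close>; the cut-off makes it vanish from \<open>D\<close> on. Vertices
  unreachable from \<open>x\<close> have distance 0 and share the angle of \<open>x\<close>, so
  edges among them cost nothing.\<close>

definition log_profile :: "real \<Rightarrow> nat \<Rightarrow> nat \<Rightarrow> real" where
  "log_profile K D l = K * max 0 (ln ((real D + 1) / (real l + 1)))"

lemma log_profile_ge: "l \<ge> D \<Longrightarrow> log_profile K D l = 0"
  by (simp add: log_profile_def max_def field_simps)

lemma log_profile_0: "log_profile K D 0 = K * ln (real D + 1)"
  by (simp add: log_profile_def)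

lemma log_profile_step:
  assumes "l < D"
  shows "log_profile K D l - log_profile K D (Suc l) = K * ln ((real l + 2) / (real l + 1))"
proof -
  have "ln ((real D + 1) / (real l + 1)) \<ge> 0" "ln ((real D + 1) / (real l + 2)) \<ge> 0"
    using assms by (simp_all add: field_simps)
  then have "log_profile K D l - log_profile K D (Suc l) =
      K * (ln ((real D + 1) / (real l + 1)) - ln ((real D + 1) / (real l + 2)))"
    by (simp add: log_profile_def algebra_simps)
  also have "ln ((real D + 1) / (real l + 1)) - ln ((real D + 1) / (real l + 2)) = ln ((real l + 2) / (real l + 1))"
    by (simp add: ln_div)
  finally show ?thesis .
qed

lemma ln_step_bounds: "0 \<le> ln ((real l + 2) / (real l + 1))" "ln ((real l + 2) / (real l + 1)) \<le> 1 / (real l + 1)"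
proof -
  have "(real l + 2) / (real l + 1) = 1 + 1 / (real l + 1)" by (simp add: field_simps)
  then show "0 \<le> ln ((real l + 2) / (real l + 1))" "ln ((real l + 2) / (real l + 1)) \<le> 1 / (real l + 1)"
    by (simp_all add: ln_add_one_self_le_self)
qed

lemma log_profile_step_le:
  assumes "K \<ge> 0"
  shows "\<bar>log_profile K D l - log_profile K D (Suc l)\<bar> \<le> K"
proof (cases "l < D")
  case True
  have "ln ((real l + 2) / (real l + 1)) \<le> 1"
    using ln_step_bounds(2)[of l] by (rule order_trans) simp
  then show ?thesis
    using assms ln_step_bounds(1)[of l] by (simp add: log_profile_step[OF True] mult_left_le)
qed (use assms in \<open>simp add: log_profile_ge\<close>)

lemma sum_ln_steps: "(\<Sum>l<D. ln ((real l + 2) / (real l + 1))) = ln (real D + 1)"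
  by (induction D) (simp_all add: ln_div algebra_simps)

text \<open>An edge between the spheres of radii l and l + 1, l < D, costs K^2 L^2 with L = ln ((l +
  2) / (l + 1)) \<le> 1 / (l + 1). One factor L compensates the growth max 1 l of the number of
  edges, and the other telescopes to ln (D + 1).\<close>

lemma edge_energy_le:
  assumes graph: "finite_graph n E" and x: "x < n"
  shows "(\<Sum>(u, v)\<in>edge_pairs E. (log_profile K D (graph_dist E x u) - log_profile K D (graph_dist E x v))\<^sup>2)
    \<le> (perimeter_constant n E)\<^sup>2 * K\<^sup>2 * ln (real D + 1)"
proof -
  let ?d = "graph_dist E x"
  define f where "f = log_profile K D"
  define a where "a = (\<lambda>l. (f l - f (Suc l))\<^sup>2)"
  \<comment> \<open>Pairs in \<open>edge_pairs\<close> are ordered by vertex number, not by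
    distance, so shells are crossed in both directions. Swapping the second kind embeds both
    disjointly into \<open>B l\<close>.\<close>
  define P1 where "P1 = (\<lambda>l. {(u, v) \<in> edge_pairs E. ?d u = l \<and> ?d v = Suc l})"
  define P2 where "P2 = (\<lambda>l. {(u, v) \<in> edge_pairs E. ?d v = l \<and> ?d u = Suc l})"
  define B where "B = (\<lambda>l. {(u, v). {u, v} \<in> E \<and> ?d u = l \<and> ?d v = Suc l})"
  note fin = finite_edge_pairs[OF graph]
  have finP: "finite (P1 l)" "finite (P2 l)" for l
    using fin by (auto simp: P1_def P2_def intro: finite_subset[of _ "edge_pairs E"])
  have "finite (B l)" for l
  proof (rule finite_subset)
    show "B l \<subseteq> {..<n} \<times> {..<n}"
      using graph_dist_neighbour(1)[OF graph] by (auto simp: B_def insert_commute)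
  qed simp
  then have card_P: "card (P1 l) + card (P2 l) \<le> card (B l)" for l
  proof -
    have "fst p < snd p" if "p \<in> P1 l" for p using that by (auto simp: P1_def edge_pairs_def)
    moreover have "snd p < fst p" if "p \<in> prod.swap ` P2 l" for p using that by (auto simp: P2_def edge_pairs_def)
    ultimately have disj: "P1 l \<inter> prod.swap ` P2 l = {}" by (meson disjoint_iff less_asym)
    have sub: "P1 l \<subseteq> B l" "prod.swap ` P2 l \<subseteq> B l"
      by (auto simp: P1_def P2_def B_def edge_pairs_def insert_commute)
    have "card (P1 l) + card (P2 l) = card (P1 l) + card (prod.swap ` P2 l)"
      by (simp add: card_image)
    also have "\<dots> = card (P1 l \<union> prod.swap ` P2 l)"
      using finP disj by (intro card_Un_disjoint[symmetric]) auto
    also have "\<dots> \<le> card (B l)"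
      using \<open>\<And>l. finite (B l)\<close> sub by (intro card_mono) auto
    finally show ?thesis .
  qed
  have "(\<Sum>(u, v)\<in>edge_pairs E. (f (?d u) - f (?d v))\<^sup>2) \<le>
      (\<Sum>p\<in>edge_pairs E. \<Sum>l<D. a l * (of_bool (p \<in> P1 l) + of_bool (p \<in> P2 l)))"
  proof (rule sum_mono)
    fix p assume p: "p \<in> edge_pairs E"
    obtain u v where uv: "p = (u, v)" by (cases p)
    then have E: "{u, v} \<in> E" "{v, u} \<in> E" using p by (auto simp: edge_pairs_def insert_commute)
    have nonneg: "0 \<le> a l * (of_bool (p \<in> P1 l) + of_bool (p \<in> P2 l))" for l
      by (simp add: a_def)
    have single: "a l \<le> (\<Sum>l<D. a l * (of_bool (p \<in> P1 l) + of_bool (p \<in> P2 l)))"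
      if "l < D" "p \<in> P1 l \<or> p \<in> P2 l" for l
    proof -
      have "a l \<le> a l * (of_bool (p \<in> P1 l) + of_bool (p \<in> P2 l))"
        using that(2) by (auto simp: a_def)
      also have "\<dots> \<le> (\<Sum>l<D. a l * (of_bool (p \<in> P1 l) + of_bool (p \<in> P2 l)))"
        using that(1) nonneg by (intro member_le_sum) auto
      finally show ?thesis .
    qed
    have zero: "a l = 0" if "\<not> l < D" for l
      using that by (simp add: a_def f_def log_profile_ge)
    have "?d u = ?d v \<or> ?d v = Suc (?d u) \<or> ?d u = Suc (?d v)"
      using graph_dist_edge[OF E(1), of x] graph_dist_edge[OF E(2), of x] by linarith
    then show "(case p of (u, v) \<Rightarrow> (f (?d u) - f (?d v))\<^sup>2) \<le>
        (\<Sum>l<D. a l * (of_bool (p \<in> P1 l) + of_bool (p \<in> P2 l)))"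
    proof (elim disjE)
      assume "?d u = ?d v"
      then show ?thesis using nonneg by (simp add: uv sum_nonneg)
    next
      assume v: "?d v = Suc (?d u)"
      then have "(case p of (u, v) \<Rightarrow> (f (?d u) - f (?d v))\<^sup>2) = a (?d u)" "p \<in> P1 (?d u)"
        using p by (auto simp: uv a_def P1_def)
      then show ?thesis
        using single[of "?d u"] zero[of "?d u"] nonneg sum_nonneg[of "{..<D}"] by (cases "?d u < D") (auto simp: sum_nonneg)
    next
      assume u: "?d u = Suc (?d v)"
      then have "(case p of (u, v) \<Rightarrow> (f (?d u) - f (?d v))\<^sup>2) = a (?d v)" "p \<in> P2 (?d v)"
        using p by (auto simp: uv a_def P2_def power2_commute)
      then show ?thesis
        using single[of "?d v"] zero[of "?d v"] nonneg by (cases "?d v < D") (auto simp: sum_nonneg)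
    qed
  qed
  also have "\<dots> = (\<Sum>l<D. \<Sum>p\<in>edge_pairs E. a l * (of_bool (p \<in> P1 l) + of_bool (p \<in> P2 l)))"
    by (rule sum.swap)
  also have "\<dots> = (\<Sum>l<D. a l * real (card (P1 l) + card (P2 l)))"
  proof (intro sum.cong refl)
    fix l
    have "edge_pairs E \<inter> P1 l = P1 l" "edge_pairs E \<inter> P2 l = P2 l" by (auto simp: P1_def P2_def)
    then show "(\<Sum>p\<in>edge_pairs E. a l * (of_bool (p \<in> P1 l) + of_bool (p \<in> P2 l))) = a l * real (card (P1 l) + card (P2 l))"
      using fin by (simp add: sum_distrib_left[symmetric] sum.distrib sum_of_bool_eq Int_def[symmetric])
  qed
  also have "\<dots> \<le> (\<Sum>l<D. (perimeter_constant n E)\<^sup>2 * K\<^sup>2 * ln ((real l + 2) / (real l + 1)))"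
  proof (intro sum_mono)
    fix l assume "l \<in> {..<D}"
    define L where "L = ln ((real l + 2) / (real l + 1))"
    have L: "0 \<le> L" "L \<le> 1 / (real l + 1)" using ln_step_bounds[of l] by (auto simp: L_def)
    have a: "a l = K\<^sup>2 * L\<^sup>2"
      using \<open>l \<in> {..<D}\<close> by (simp add: a_def f_def log_profile_step L_def power_mult_distrib)
    have "real (card (P1 l) + card (P2 l)) \<le> (perimeter_constant n E)\<^sup>2 * max 1 (real l)"
      using shell_edges_card_le[OF graph x, of l] card_P[of l] unfolding B_def by linarith
    then have "a l * real (card (P1 l) + card (P2 l)) \<le> K\<^sup>2 * L\<^sup>2 * ((perimeter_constant n E)\<^sup>2 * max 1 (real l))"
      unfolding a by (intro mult_left_mono) auto
    also have "\<dots> = (perimeter_constant n E)\<^sup>2 * K\<^sup>2 * (L * (L * max 1 (real l)))"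
      by (simp add: power2_eq_square mult_ac)
    also have "\<dots> \<le> (perimeter_constant n E)\<^sup>2 * K\<^sup>2 * (L * 1)"
    proof -
      have "L * max 1 (real l) \<le> 1 / (real l + 1) * max 1 (real l)"
        using L by (intro mult_right_mono) auto
      also have "\<dots> \<le> 1" by (simp add: field_simps)
      finally show ?thesis using L by (intro mult_left_mono) auto
    qed
    finally show "a l * real (card (P1 l) + card (P2 l)) \<le> (perimeter_constant n E)\<^sup>2 * K\<^sup>2 * ln ((real l + 2) / (real l + 1))"
      by (simp add: L_def)
  qed
  also have "\<dots> = (perimeter_constant n E)\<^sup>2 * K\<^sup>2 * ln (real D + 1)"
    by (simp add: sum_distrib_left[symmetric] sum_ln_steps)
  finally show ?thesis by (simp add: f_def)
qed

section \<open>Numerical estimates for the couplings\<close>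

lemma cosh_minus_one_le:
  fixes u :: real
  assumes "\<bar>u\<bar> \<le> 1"
  shows "cosh u - 1 \<le> u\<^sup>2"
proof -
  have nonneg: "cosh u - 1 \<le> u\<^sup>2" if u: "0 \<le> u" "u \<le> 1" for u :: real
  proof -
    \<comment> \<open>The estimate rests on
      \<open>(1 - u + u\<^sup>2) * (1 + u) = 1 + u ^ 3\<close>. Added to the bound 1 + u + u^2 for
      exp u, it makes the linear terms cancel.\<close>
    have "exp (- u) = 1 / exp u" by (simp add: exp_minus field_simps)
    also have "\<dots> \<le> 1 / (1 + u)"
      using u exp_ge_add_one_self[of u] by (intro divide_left_mono) auto
    also have "\<dots> \<le> 1 - u + u\<^sup>2"
    proof -
      have "1 \<le> (1 - u + u\<^sup>2) * (1 + u)"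
        using u by (simp add: power2_eq_square algebra_simps)
      then show ?thesis using u by (simp add: divide_le_eq)
    qed
    finally show ?thesis
      using exp_bound[OF u] by (simp add: cosh_def field_simps)
  qed
  show ?thesis
    using nonneg[of "\<bar>u\<bar>"] assms by (simp add: abs_if split: if_splits)
qed

lemma sq_two_pow_le: "(real k)\<^sup>2 * 2 ^ k \<le> 4 * 3 ^ k"
\<comment> \<open>5 is the first value from which passing to \<open>k + 1\<close> multiplies the
  left side by at most 3; smaller values are checked directly.\<close>
proof (cases "k \<ge> 5")
  case True
  then show ?thesis
  proof (induction k rule: dec_induct)
    case (step k)
    have "2 * (real (Suc k))\<^sup>2 \<le> 3 * (real k)\<^sup>2"
    proof -
      have "real k \<ge> 5" using step.hyps by simp
      moreover from this have "real k * 5 \<le> real k * real k" by (intro mult_left_mono) auto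
      ultimately show ?thesis
        unfolding power2_eq_square of_nat_Suc ring_distribs mult_1_left mult_1_right by linarith
    qed
    then have "2 * (real (Suc k))\<^sup>2 * 2 ^ k \<le> 3 * (real k)\<^sup>2 * 2 ^ k"
      by (intro mult_right_mono) auto
    then have "(real (Suc k))\<^sup>2 * 2 ^ Suc k \<le> 3 * ((real k)\<^sup>2 * 2 ^ k)"
      by (simp only: power_Suc mult_ac)
    also have "\<dots> \<le> 3 * (4 * 3 ^ k)" by (intro mult_left_mono step.IH) simp
    finally show ?case by simp
  qed simp
next
  case False
  then have "k \<in> {0, 1, 2, 3, 4}" by auto
  then show ?thesis by auto
qed

text \<open>For \<open>s \<ge> 1\<close> the Casimir value \<open>s (s + 1)\<close> is at most two thirds of \<open>3 s\<^sup>2\<close>, which compensates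
  the growth of \<open>k\<^sup>2\<close>.\<close>

lemma casimir_pow_le:
  assumes t: "t \<ge> 1" and k: "1 \<le> k" "k \<le> t"
  shows "(real t / 2 * (real t / 2 + 1)) ^ k * (real k)\<^sup>2 \<le> 4 * real t * (3 * (real t / 2)\<^sup>2) ^ k"
\<comment> \<open>For spin 1/2 the two bases agree,
  \<open>s * (s + 1) = 3 * s\<^sup>2 = 3 / 4\<close>, but only \<open>k = 1\<close> occurs and there
  is no growth to compensate.\<close>
proof (cases "t = 1")
  case True
  then have "k = 1" using k by simp
  then show ?thesis using True by (simp add: power2_eq_square)
next
  case False
  then have t2: "real t \<ge> 2" using t by simp
  define s where "s = real t / 2"
  have s: "s \<ge> 1" using t2 by (simp add: s_def)
  have "(s * (s + 1)) ^ k * (real k)\<^sup>2 \<le> (2 * s\<^sup>2) ^ k * (real k)\<^sup>2"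
    using s by (intro mult_right_mono power_mono) (auto simp: power2_eq_square distrib_left)
  also have "\<dots> = (s\<^sup>2) ^ k * ((real k)\<^sup>2 * 2 ^ k)" by (simp add: power_mult_distrib)
  also have "\<dots> \<le> (s\<^sup>2) ^ k * (4 * 3 ^ k)"
    by (intro mult_left_mono sq_two_pow_le) auto
  also have "\<dots> = 4 * (3 * s\<^sup>2) ^ k" by (simp add: power_mult_distrib)
  also have "\<dots> \<le> 4 * real t * (3 * s\<^sup>2) ^ k"
    using t2 by (intro mult_right_mono) auto
  finally show ?thesis by (simp add: s_def)
qed

text \<open>\<open>casimir_pow_le\<close> produces exactly the weights of the normalisation of the
  couplings, so the sum over \<open>k\<close> is at most 1 and the factor 4 t = 8 s remains. The
  bound on \<open>\<delta>\<close> keeps \<open>k * \<delta>\<close> in the range of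
  \<open>cosh_minus_one_le\<close> up to \<open>k = t\<close>.\<close>

lemma edge_coupling_le:
  fixes c :: "nat \<Rightarrow> real"
  assumes t: "t \<ge> 1" and c: "(\<Sum>k=1..t. \<bar>c k\<bar> * (3 * (real t / 2)\<^sup>2) ^ k) \<le> 1" and \<delta>: "real t * \<bar>\<delta>\<bar> \<le> 1"
  shows "(\<Sum>k=1..t. \<bar>c k\<bar> * ((real t / 2 * (real t / 2 + 1)) ^ k * (cosh (k * \<delta>) - 1))) \<le> 4 * real t * \<delta>\<^sup>2"
proof -
  let ?M = "real t / 2 * (real t / 2 + 1)"
  have "?M ^ k * (cosh (k * \<delta>) - 1) \<le> (3 * (real t / 2)\<^sup>2) ^ k * (4 * real t * \<delta>\<^sup>2)" if k: "k \<in> {1..t}" for k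
  proof -
    have "\<bar>real k * \<delta>\<bar> \<le> real t * \<bar>\<delta>\<bar>" using k by (simp add: abs_mult mult_right_mono)
    then have "cosh (k * \<delta>) - 1 \<le> (k * \<delta>)\<^sup>2" using \<delta> by (intro cosh_minus_one_le) auto
    then have "?M ^ k * (cosh (k * \<delta>) - 1) \<le> ?M ^ k * (k * \<delta>)\<^sup>2"
      by (intro mult_left_mono) auto
    also have "\<dots> = ?M ^ k * (real k)\<^sup>2 * \<delta>\<^sup>2" by (simp add: power_mult_distrib)
    also have "\<dots> \<le> 4 * real t * (3 * (real t / 2)\<^sup>2) ^ k * \<delta>\<^sup>2"
      using k t by (intro mult_right_mono casimir_pow_le) auto
    finally show ?thesis by (simp add: mult_ac)
  qed
  then have "(\<Sum>k=1..t. \<bar>c k\<bar> * (?M ^ k * (cosh (k * \<delta>) - 1))) \<le>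
      (\<Sum>k=1..t. \<bar>c k\<bar> * ((3 * (real t / 2)\<^sup>2) ^ k * (4 * real t * \<delta>\<^sup>2)))"
    by (intro sum_mono mult_left_mono) auto
  also have "\<dots> = (\<Sum>k=1..t. \<bar>c k\<bar> * (3 * (real t / 2)\<^sup>2) ^ k) * (4 * real t * \<delta>\<^sup>2)"
    by (simp add: sum_distrib_left sum_distrib_right mult_ac)
  also have "\<dots> \<le> 1 * (4 * real t * \<delta>\<^sup>2)"
    using c by (intro mult_right_mono) auto
  finally show ?thesis by simp
qed

text \<open>Angles at neighbouring vertices differ by at most \<open>K\<close>, so
  \<open>real t * K \<le> 1\<close> makes the quadratic estimate valid on every edge.\<close>

lemma raising_correlation_bound:
  assumes spin: "spin_matrices t S" and t: "t \<ge> 1" and adm: "admissible t \<gamma> n E c" and \<beta>: "\<beta> > 0"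
    and x: "x < n" and y: "y < n" and A: "A \<in> carrier_mat (t + 1) (t + 1)"
    and K: "0 \<le> K" "real t * K \<le> 1"
  shows "cmod (gibbs_state \<beta> (hamiltonian t n E S c)
      (site_op (t + 1) n x (spin_raising S) * site_op (t + 1) n y A)) \<le>
    matrix_bound (spin_raising S) * matrix_bound A * (real (graph_dist E x y) + 1) powr (- (K - 4 * real t * \<gamma>\<^sup>2 * \<beta> * K\<^sup>2))"
proof -
  have graph: "finite_graph n E" and \<gamma>: "perimeter_constant n E = \<gamma>"
    and c: "\<And>x y. x < n \<Longrightarrow> y < n \<Longrightarrow> (\<Sum>k=1..t. \<bar>c k x y\<bar> * (3 * (real t / 2)\<^sup>2) ^ k) \<le> 1"
    using adm by (auto simp: admissible_def)
  define D where "D = graph_dist E x y"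
  define \<theta> where "\<theta> = (\<lambda>z. log_profile K D (graph_dist E x z))"
  define M where "M = real t / 2 * (real t / 2 + 1)"
  have diff: "\<bar>\<theta> u - \<theta> v\<bar> \<le> K" if uv: "{u, v} \<in> E" for u v
  proof -
    have "graph_dist E x u = graph_dist E x v \<or> graph_dist E x v = Suc (graph_dist E x u) \<or> graph_dist E x u = Suc (graph_dist E x v)"
      using graph_dist_edge[of u v E x] graph_dist_edge[of v u E x] uv by (simp add: insert_commute) linarith
    then show ?thesis
      using K(1) log_profile_step_le[OF K(1), of D "graph_dist E x u"] log_profile_step_le[OF K(1), of D "graph_dist E x v"]
      by (auto simp: \<theta>_def abs_minus_commute)
  qed
  have "(\<Sum>((u, v), k)\<in>edge_pairs E \<times> {1..t}. \<bar>c k u v\<bar> * (M ^ k * (cosh (k * (\<theta> u - \<theta> v)) - 1))) =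
      (\<Sum>(u, v)\<in>edge_pairs E. \<Sum>k=1..t. \<bar>c k u v\<bar> * (M ^ k * (cosh (k * (\<theta> u - \<theta> v)) - 1)))"
    by (simp add: sum.cartesian_product case_prod_unfold)
  also have "\<dots> \<le> (\<Sum>(u, v)\<in>edge_pairs E. 4 * real t * (\<theta> u - \<theta> v)\<^sup>2)"
  proof (rule sum_mono, clarify)
    fix u v assume "(u, v) \<in> edge_pairs E"
    note uv = edge_pairsD[OF graph this]
    have "real t * \<bar>\<theta> u - \<theta> v\<bar> \<le> 1"
      using mult_left_mono[OF diff[OF uv(4)], of "real t"] K(2) by linarith
    then show "(\<Sum>k=1..t. \<bar>c k u v\<bar> * (M ^ k * (cosh (k * (\<theta> u - \<theta> v)) - 1))) \<le> 4 * real t * (\<theta> u - \<theta> v)\<^sup>2"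
      unfolding M_def using c uv t by (intro edge_coupling_le) auto
  qed
  also have "\<dots> = 4 * real t * (\<Sum>(u, v)\<in>edge_pairs E. (\<theta> u - \<theta> v)\<^sup>2)"
    by (simp add: sum_distrib_left case_prod_unfold)
  also have "\<dots> \<le> 4 * real t * (\<gamma>\<^sup>2 * K\<^sup>2 * ln (real D + 1))"
    using edge_energy_le[OF graph x, of K D] unfolding \<theta>_def \<gamma> by (intro mult_left_mono) auto
  finally have "exp (\<beta> * (\<Sum>((u, v), k)\<in>edge_pairs E \<times> {1..t}. \<bar>c k u v\<bar> * (M ^ k * (cosh (k * (\<theta> u - \<theta> v)) - 1))))
      \<le> exp (\<beta> * (4 * real t * (\<gamma>\<^sup>2 * K\<^sup>2 * ln (real D + 1))))"
    using \<beta> by simp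
  moreover have "\<theta> y = 0" by (simp add: \<theta>_def D_def log_profile_ge)
  ultimately have "cmod (gibbs_state \<beta> (hamiltonian t n E S c)
      (site_op (t + 1) n x (spin_raising S) * site_op (t + 1) n y A)) \<le>
      exp (- \<theta> x) * (matrix_bound (spin_raising S) * matrix_bound A) * exp (\<beta> * (4 * real t * (\<gamma>\<^sup>2 * K\<^sup>2 * ln (real D + 1))))"
    using A by (intro order_trans[OF gibbs_rotation_bound[OF spin refl refl M_def graph \<beta> x y] mult_left_mono]) auto
  also have "\<dots> = matrix_bound (spin_raising S) * matrix_bound A *
      (exp (- \<theta> x) * exp (\<beta> * (4 * real t * (\<gamma>\<^sup>2 * K\<^sup>2 * ln (real D + 1)))))"
    by simp
  also have "exp (- \<theta> x) * exp (\<beta> * (4 * real t * (\<gamma>\<^sup>2 * K\<^sup>2 * ln (real D + 1)))) =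
      (real D + 1) powr (- (K - 4 * real t * \<gamma>\<^sup>2 * \<beta> * K\<^sup>2))"
    by (simp add: \<theta>_def log_profile_0 powr_def algebra_simps flip: exp_add)
  finally show ?thesis by (simp add: D_def)
qed

section \<open>Decay of correlations\<close>

lemma hamiltonian_carrier: "hamiltonian t n E S c \<in> carrier_mat ((t + 1) ^ n) ((t + 1) ^ n)"
  by (simp add: hamiltonian_def)

lemma hamiltonian_cong:
  "(\<And>x y. spin_dot t n S x y = spin_dot t n S' x y) \<Longrightarrow> hamiltonian t n E S c = hamiltonian t n E S' c"
  by (simp add: hamiltonian_def)

lemma gibbs_state_half_sum:
  assumes "H \<in> carrier_mat N N" "A \<in> carrier_mat N N" "B \<in> carrier_mat N N"
  shows "gibbs_state \<beta> H ((1 / 2) \<cdot>\<^sub>m A + (1 / 2) \<cdot>\<^sub>m B) = (gibbs_state \<beta> H A + gibbs_state \<beta> H B) / 2"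
proof -
  define X where "X = exp_mat (complex_of_real (- \<beta>) \<cdot>\<^sub>m H)"
  have X: "X \<in> carrier_mat N N" using assms by (simp add: X_def)
  have "trace_mat (((1 / 2) \<cdot>\<^sub>m A + (1 / 2) \<cdot>\<^sub>m B) * X) = (trace_mat (A * X) + trace_mat (B * X)) / 2"
    using assms X
    by (simp add: mat_add_left[of _ N] mat_smult_left[of _ N] trace_mat_add[of _ N] trace_mat_smult[of _ N])
  then show ?thesis by (simp add: gibbs_state_def X_def add_divide_distrib mult.commute)
qed

text \<open>Cyclic permutations preserve the commutation relations and the dot product, hence the
  Hamiltonian. They reduce the second and third component to the first.\<close>

lemma spin_matrices_rotate:
  assumes "spin_matrices t S"
  shows "spin_matrices t (S(1 := S 2, 2 := S 3, 3 := S 1))"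
    "spin_dot t n (S(1 := S 2, 2 := S 3, 3 := S 1)) x y = spin_dot t n S x y"
proof -
  note S = S_carrier[OF assms]
  have "S 2 * S 2 + S 3 * S 3 + S 1 * S 1 = S 1 * S 1 + S 2 * S 2 + S 3 * S 3"
    by (intro eq_matI) (use carrier_matD[OF S(1)] carrier_matD[OF S(2)] carrier_matD[OF S(3)] in auto)
  then show "spin_matrices t (S(1 := S 2, 2 := S 3, 3 := S 1))"
    using assms unfolding spin_matrices_def by auto
  show "spin_dot t n (S(1 := S 2, 2 := S 3, 3 := S 1)) x y = spin_dot t n S x y"
    by (intro eq_matI) (auto simp: spin_dot_def)
qed

text \<open>This rotation by \<open>\<pi>\<close> about the first axis exchanges the raising and the lowering operator.\<close>

lemma spin_matrices_reflect:
  assumes "spin_matrices t S"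
  shows "spin_matrices t (S(2 := (- 1) \<cdot>\<^sub>m S 2, 3 := (- 1) \<cdot>\<^sub>m S 3))"
    "spin_dot t n (S(2 := (- 1) \<cdot>\<^sub>m S 2, 3 := (- 1) \<cdot>\<^sub>m S 3)) x y = spin_dot t n S x y"
proof -
  define d where "d = t + 1"
  note S = S_carrier[OF assms, folded d_def]
  note dims = carrier_matD[OF S(1)] carrier_matD[OF S(2)] carrier_matD[OF S(3)]
  note sm = mat_smult_left[of _ d _ "- 1"] mat_smult_right[of _ d _ "- 1"]
  have adj: "mat_adjoint ((- 1) \<cdot>\<^sub>m S 2) = (- 1) \<cdot>\<^sub>m S 2" "mat_adjoint ((- 1) \<cdot>\<^sub>m S 3) = (- 1) \<cdot>\<^sub>m S 3"
    using S S_hermitian[OF assms] by (simp_all add: mat_adjoint_smult[of _ d])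
  have comm: "S 1 * S 2 - S 2 * S 1 = \<i> \<cdot>\<^sub>m S 3" "S 2 * S 3 - S 3 * S 2 = \<i> \<cdot>\<^sub>m S 1" "S 3 * S 1 - S 1 * S 3 = \<i> \<cdot>\<^sub>m S 2"
    using assms unfolding spin_matrices_def by blast+
  have neg: "(- 1) \<cdot>\<^sub>m A - (- 1) \<cdot>\<^sub>m B = (- 1) \<cdot>\<^sub>m (A - B)"
    if "A \<in> carrier_mat d d" "B \<in> carrier_mat d d" for A B :: "complex mat"
    using that by (intro eq_matI) auto
  have scal: "(- 1) \<cdot>\<^sub>m (\<i> \<cdot>\<^sub>m A) = \<i> \<cdot>\<^sub>m ((- 1) \<cdot>\<^sub>m A)" "(- 1) \<cdot>\<^sub>m ((- 1) \<cdot>\<^sub>m A) = A" for A :: "complex mat"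
    by (intro eq_matI; simp)+
  have mult [simp]: "S i * S j \<in> carrier_mat d d" if "i \<in> {1, 2, 3}" "j \<in> {1, 2, 3}" for i j
    using that S by (auto intro!: mult_carrier_mat[of _ d d])
  have 1: "S 1 * ((- 1) \<cdot>\<^sub>m S 2) - ((- 1) \<cdot>\<^sub>m S 2) * S 1 = \<i> \<cdot>\<^sub>m ((- 1) \<cdot>\<^sub>m S 3)"
    unfolding sm(1)[OF S(2,1)] sm(2)[OF S(1,2)] by (subst neg) (simp_all add: comm(1) scal(1))
  have 2: "((- 1) \<cdot>\<^sub>m S 2) * ((- 1) \<cdot>\<^sub>m S 3) - ((- 1) \<cdot>\<^sub>m S 3) * ((- 1) \<cdot>\<^sub>m S 2) = \<i> \<cdot>\<^sub>m S 1"
    using S comm(2) by (simp add: sm scal(2))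
  have 3: "((- 1) \<cdot>\<^sub>m S 3) * S 1 - S 1 * ((- 1) \<cdot>\<^sub>m S 3) = \<i> \<cdot>\<^sub>m ((- 1) \<cdot>\<^sub>m S 2)"
    unfolding sm(1)[OF S(3,1)] sm(2)[OF S(1,3)] by (subst neg) (simp_all add: comm(3) scal(1))
  have 4: "S 1 * S 1 + ((- 1) \<cdot>\<^sub>m S 2) * ((- 1) \<cdot>\<^sub>m S 2) + ((- 1) \<cdot>\<^sub>m S 3) * ((- 1) \<cdot>\<^sub>m S 3) = S 1 * S 1 + S 2 * S 2 + S 3 * S 3"
    using S by (simp add: sm scal(2))
  show "spin_matrices t (S(2 := (- 1) \<cdot>\<^sub>m S 2, 3 := (- 1) \<cdot>\<^sub>m S 3))"
    using assms adj 1 2 3 4 S unfolding spin_matrices_def d_def by simp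
  have site: "site_op d n z ((- 1) \<cdot>\<^sub>m S j) = (- 1) \<cdot>\<^sub>m site_op d n z (S j)" if "j \<in> {2, 3}" for z j
    using that S by (intro site_op_smult) (auto simp: d_def)
  have site_op_closed [simp]: "site_op d n z (S j) \<in> carrier_mat (d ^ n) (d ^ n)" for z j by (simp add: d_def)
  show "spin_dot t n (S(2 := (- 1) \<cdot>\<^sub>m S 2, 3 := (- 1) \<cdot>\<^sub>m S 3)) x y = spin_dot t n S x y"
    unfolding spin_dot_def d_def[symmetric]
    by (simp add: site mat_smult_left[of _ "d ^ n"] mat_smult_right[of _ "d ^ n"] scal(2))
qed

text \<open>\<open>C\<close> and \<open>\<xi>\<close> are arguments, outside the quantifiers over
  graph, couplings and temperature; this fixes the uniformity of the bound.\<close>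

definition decay_bound ::
  "nat \<Rightarrow> real \<Rightarrow> (nat \<Rightarrow> complex mat) \<Rightarrow> (real \<Rightarrow> real) \<Rightarrow> complex mat \<Rightarrow> complex mat \<Rightarrow> real \<Rightarrow> bool" where
  "decay_bound t \<gamma> S \<xi> B A C \<longleftrightarrow> (\<forall>n E c \<beta>. admissible t \<gamma> n E c \<longrightarrow> \<beta> > 0 \<longrightarrow> (\<forall>x<n. \<forall>y<n.
    cmod (gibbs_state \<beta> (hamiltonian t n E S c) (site_op (t + 1) n x B * site_op (t + 1) n y A))
      \<le> C * (real (graph_dist E x y) + 1) powr (- \<xi> \<beta>)))"

lemma decay_bound_mono: "decay_bound t \<gamma> S \<xi> B A C \<Longrightarrow> C \<le> C' \<Longrightarrow> decay_bound t \<gamma> S \<xi> B A C'"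
  unfolding decay_bound_def by (meson mult_right_mono order_trans powr_ge_zero)

text \<open>\<open>S 1\<close> is the mean of the raising and the lowering matrix, and the latter is
  the raising matrix of the reflected triple, which has the same Hamiltonian. Therefore the bound is
  assumed for all spin triples.\<close>

lemma decay_bound_first_component:
  assumes spin: "spin_matrices t S" and A: "A \<in> carrier_mat (t + 1) (t + 1)"
    and bound: "\<And>S. spin_matrices t S \<Longrightarrow>
      decay_bound t \<gamma> S \<xi> (spin_raising S) A (matrix_bound (spin_raising S) * matrix_bound A)"
  shows "\<exists>C>0. decay_bound t \<gamma> S \<xi> (S 1) A C"
proof -
  define d where "d = t + 1"
  have d_pos: "d > 0" by (simp add: d_def)
  define S' where "S' = S(2 := (- 1) \<cdot>\<^sub>m S 2, 3 := (- 1) \<cdot>\<^sub>m S 3)"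
  note S = S_carrier[OF spin, folded d_def]
  note spin' = spin_matrices_reflect(1)[OF spin, folded S'_def]
  note R = spin_raising_carrier[OF spin, folded d_def] spin_raising_carrier[OF spin', folded d_def]
  define W where "W = matrix_bound (spin_raising S) * matrix_bound A"
  define W' where "W' = matrix_bound (spin_raising S') * matrix_bound A"
  have S1: "S 1 = (1 / 2) \<cdot>\<^sub>m spin_raising S + (1 / 2) \<cdot>\<^sub>m spin_raising S'"
    using S by (intro eq_matI) (auto simp: spin_raising_def S'_def field_simps)
  have "decay_bound t \<gamma> S \<xi> (S 1) A ((W + W') / 2)"
    unfolding decay_bound_def
  proof (intro allI impI)
    fix n E c \<beta> x y
    assume asm: "admissible t \<gamma> n E c" "\<beta> > (0 :: real)" "x < n" "y < n"
    define N where "N = d ^ n"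
    have site_op_closed [simp]: "site_op d n z B \<in> carrier_mat N N" for z B by (simp add: d_def N_def)
    let ?H = "hamiltonian t n E S c" and ?p = "(real (graph_dist E x y) + 1) powr (- \<xi> \<beta>)"
    have H': "hamiltonian t n E S' c = ?H"
      by (rule hamiltonian_cong) (simp add: S'_def spin_matrices_reflect(2)[OF spin])
    have "site_op d n x (S 1) = (1 / 2) \<cdot>\<^sub>m site_op d n x (spin_raising S) + (1 / 2) \<cdot>\<^sub>m site_op d n x (spin_raising S')"
      unfolding S1 using R d_pos by (simp add: site_op_add site_op_smult)
    then have "site_op d n x (S 1) * site_op d n y A =
        (1 / 2) \<cdot>\<^sub>m (site_op d n x (spin_raising S) * site_op d n y A) +
        (1 / 2) \<cdot>\<^sub>m (site_op d n x (spin_raising S') * site_op d n y A)"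
      by (simp add: mat_add_left[of _ N] mat_smult_left[of _ N])
    then have "gibbs_state \<beta> ?H (site_op d n x (S 1) * site_op d n y A) =
        (gibbs_state \<beta> ?H (site_op d n x (spin_raising S) * site_op d n y A) +
         gibbs_state \<beta> ?H (site_op d n x (spin_raising S') * site_op d n y A)) / 2"
      using hamiltonian_carrier[of t n E S c]
      by (simp only:) (intro gibbs_state_half_sum[of _ N], simp_all add: N_def d_def)
    also have "cmod \<dots> \<le> (W * ?p + W' * ?p) / 2"
    proof -
      have "cmod (gibbs_state \<beta> ?H (site_op d n x (spin_raising S) * site_op d n y A)) \<le> W * ?p"
        using bound[OF spin] asm by (auto simp: decay_bound_def W_def d_def)
      moreover have "cmod (gibbs_state \<beta> ?H (site_op d n x (spin_raising S') * site_op d n y A)) \<le> W' * ?p"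
        using bound[OF spin'] asm H' unfolding decay_bound_def W'_def d_def by metis
      ultimately show ?thesis
        by (simp add: norm_divide) (smt (verit) norm_triangle_ineq)
    qed
    finally show "cmod (gibbs_state \<beta> ?H (site_op (t + 1) n x (S 1) * site_op (t + 1) n y A)) \<le> (W + W') / 2 * ?p"
      by (simp add: d_def algebra_simps)
  qed
  \<comment> \<open>The added 1 ensures a positive constant even if \<open>A\<close> is
    zero.\<close>
  then have "decay_bound t \<gamma> S \<xi> (S 1) A ((W + W') / 2 + 1)"
    by (rule decay_bound_mono) simp
  moreover have "(W + W') / 2 + 1 > 0"
    by (intro add_nonneg_pos) (simp_all add: W_def W'_def)
  ultimately show ?thesis by blast
qed

text \<open>For \<gamma> \<noteq> 0 the exponent is a parabola in the slope with vertex 1 / (8 t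
  \<gamma>^2 \<beta>); the cap 1 / t takes over for small \<beta>. Up to the vertex the quadratic
  term takes at most half of the linear one, hence positivity.\<close>

lemma optimal_slope:
  fixes t \<gamma> :: real
  assumes t: "t > 0"
  obtains K :: "real \<Rightarrow> real" where "\<And>\<beta>. \<beta> > 0 \<Longrightarrow> 0 \<le> K \<beta>" "\<And>\<beta>. \<beta> > 0 \<Longrightarrow> t * K \<beta> \<le> 1"
    "\<And>\<beta>. \<beta> > 0 \<Longrightarrow> K \<beta> - 4 * t * \<gamma>\<^sup>2 * \<beta> * (K \<beta>)\<^sup>2 > 0"
    "((\<lambda>\<beta>. ereal (\<beta> * (K \<beta> - 4 * t * \<gamma>\<^sup>2 * \<beta> * (K \<beta>)\<^sup>2))) \<longlongrightarrow> inverse (ereal (16 * t * \<gamma>\<^sup>2))) at_top"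
proof -
  define K where "K = (\<lambda>\<beta>. if \<gamma> = 0 then 1 / t else min (1 / t) (1 / (8 * t * \<gamma>\<^sup>2 * \<beta>)))"
  define \<xi> where "\<xi> = (\<lambda>\<beta>. K \<beta> - 4 * t * \<gamma>\<^sup>2 * \<beta> * (K \<beta>)\<^sup>2)"
  have K_pos: "K \<beta> > 0" and K_le: "t * K \<beta> \<le> 1" if "\<beta> > 0" for \<beta>
    using that t by (auto simp: K_def min_def field_simps)
  have \<xi>_pos: "\<xi> \<beta> > 0" if \<beta>: "\<beta> > 0" for \<beta>
  proof -
    have "4 * t * \<gamma>\<^sup>2 * \<beta> * K \<beta> \<le> 1 / 2"
    proof (cases "\<gamma> = 0")
      case False
      define X where "X = 8 * t * \<gamma>\<^sup>2 * \<beta>"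
      have "X > 0" using t \<beta> False by (simp add: X_def)
      moreover have "K \<beta> \<le> 1 / X" using False by (simp add: K_def X_def)
      ultimately have "X * K \<beta> \<le> 1" by (simp add: pos_le_divide_eq mult.commute)
      then show ?thesis by (simp add: X_def)
    qed simp
    then have "4 * t * \<gamma>\<^sup>2 * \<beta> * K \<beta> * K \<beta> \<le> 1 / 2 * K \<beta>"
      using K_pos[OF \<beta>] by (intro mult_right_mono) auto
    then show ?thesis using K_pos[OF \<beta>] by (simp add: \<xi>_def power2_eq_square)
  qed
  have lim: "((\<lambda>\<beta>. ereal (\<beta> * \<xi> \<beta>)) \<longlongrightarrow> inverse (ereal (16 * t * \<gamma>\<^sup>2))) at_top"
  proof (cases "\<gamma> = 0")
    case True
    \<comment> \<open>For \<gamma> = 0 the asserted limit is the inverse of 0, infinity in the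
      extended reals; the slope stays at \<open>1 / t\<close> and
      \<open>\<beta> * \<xi> \<beta>\<close> diverges.\<close>
    have "filterlim (\<lambda>\<beta>. \<beta> * (1 / t)) at_top at_top"
      using t by (intro filterlim_at_top_mult_tendsto_pos[OF tendsto_const] filterlim_ident) auto
    then show ?thesis
      using True by (simp add: \<xi>_def K_def tendsto_PInfty_eq_at_top flip: zero_ereal_def)
  next
    case False
    \<comment> \<open>From \<beta> = 1 / (8 \<gamma>^2) on the cap is inactive and
      \<open>\<beta> * \<xi> \<beta>\<close> is constant.\<close>
    have "eventually (\<lambda>\<beta>. ereal (\<beta> * \<xi> \<beta>) = inverse (ereal (16 * t * \<gamma>\<^sup>2))) at_top"
      using eventually_gt_at_top[of 0] eventually_ge_at_top[of "1 / (8 * \<gamma>\<^sup>2)"]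
    proof eventually_elim
      case (elim \<beta>)
      then have "1 / (8 * t * \<gamma>\<^sup>2 * \<beta>) \<le> 1 / t"
        using t False by (simp add: field_simps)
      then have K: "K \<beta> = 1 / (8 * t * \<gamma>\<^sup>2 * \<beta>)" using False by (simp add: K_def min_def)
      have "\<beta> * \<xi> \<beta> = 1 / (16 * t * \<gamma>\<^sup>2)"
        unfolding \<xi>_def K using elim t False by (simp add: field_simps power2_eq_square)
      then show ?case using t False by (simp add: inverse_eq_divide)
    qed
    then show ?thesis by (rule tendsto_eventually)
  qed
  show ?thesis
    by (rule that[OF less_imp_le[OF K_pos] K_le \<xi>_pos[unfolded \<xi>_def] lim[unfolded \<xi>_def]])
qed

theorem theorem2p1:
  fixes t :: nat and s \<gamma> :: real and S :: "nat \<Rightarrow> complex mat"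
  assumes "t \<ge> 1" and "s = real t / 2"
    and "spin_matrices t S"
  shows "\<exists>\<xi> :: real \<Rightarrow> real.
    (\<forall>\<beta>>0. \<xi> \<beta> > 0) \<and>
    ((\<lambda>\<beta>. ereal (\<beta> * \<xi> \<beta>)) \<longlongrightarrow> inverse (ereal (32 * s * \<gamma>\<^sup>2))) at_top \<and>
    (\<exists>C>0. \<forall>n E c \<beta>. admissible t \<gamma> n E c \<longrightarrow> \<beta> > 0 \<longrightarrow>
      (\<forall>x<n. \<forall>y<n. \<forall>j\<in>{1, 2, 3}.
        cmod (gibbs_state \<beta> (hamiltonian t n E S c)
                (site_op (t + 1) n x (S j) * site_op (t + 1) n y (S j)))
          \<le> C * (real (graph_dist E x y) + 1) powr (- \<xi> \<beta>))) \<and>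
    (\<forall>A\<in>carrier_mat (t + 1) (t + 1).
      \<exists>C>0. \<forall>n E c \<beta>. admissible t \<gamma> n E c \<longrightarrow> \<beta> > 0 \<longrightarrow>
      (\<forall>x<n. \<forall>y<n.
        cmod (gibbs_state \<beta> (hamiltonian t n E S c)
                (site_op (t + 1) n x (spin_raising S) * site_op (t + 1) n y A))
          \<le> C * (real (graph_dist E x y) + 1) powr (- \<xi> \<beta>)))"
proof -
  note spin = assms(3)
  have t: "real t > 0" using assms(1) by simp
  obtain K where slope: "\<And>\<beta>. \<beta> > 0 \<Longrightarrow> 0 \<le> K \<beta>" "\<And>\<beta>. \<beta> > 0 \<Longrightarrow> real t * K \<beta> \<le> 1"
    "\<And>\<beta>. \<beta> > 0 \<Longrightarrow> K \<beta> - 4 * real t * \<gamma>\<^sup>2 * \<beta> * (K \<beta>)\<^sup>2 > 0"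
    "((\<lambda>\<beta>. ereal (\<beta> * (K \<beta> - 4 * real t * \<gamma>\<^sup>2 * \<beta> * (K \<beta>)\<^sup>2))) \<longlongrightarrow> inverse (ereal (16 * real t * \<gamma>\<^sup>2))) at_top"
    using optimal_slope[OF t, of \<gamma>] by blast
  define \<xi> where "\<xi> = (\<lambda>\<beta>. K \<beta> - 4 * real t * \<gamma>\<^sup>2 * \<beta> * (K \<beta>)\<^sup>2)"
  have bound: "decay_bound t \<gamma> S \<xi> (spin_raising S) A (matrix_bound (spin_raising S) * matrix_bound A)"
    if "spin_matrices t S" "A \<in> carrier_mat (t + 1) (t + 1)" for S A
    unfolding decay_bound_def \<xi>_def
    by (intro allI impI raising_correlation_bound[OF that(1) assms(1) _ _ _ _ that(2)] slope(1,2))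
  \<comment> \<open>The shifts bring the second and the third component into first place; the
    operator at the other site may be any matrix, so \<open>S 2\<close> and \<open>S 3\<close> are
    used there.\<close>
  define S' where "S' = S(1 := S 2, 2 := S 3, 3 := S 1)"
  define S'' where "S'' = S'(1 := S' 2, 2 := S' 3, 3 := S' 1)"
  have spin': "spin_matrices t S'" "spin_matrices t S''"
    unfolding S''_def S'_def by (intro spin_matrices_rotate(1) spin)+
  have H1: "hamiltonian t n E S' c = hamiltonian t n E S c" for n E c
    by (rule hamiltonian_cong) (simp only: S'_def spin_matrices_rotate(2)[OF spin])
  have H2: "hamiltonian t n E S'' c = hamiltonian t n E S c" for n E c
    unfolding H1[symmetric]
    by (rule hamiltonian_cong) (simp only: S''_def spin_matrices_rotate(2)[OF spin'(1)])
  have eqs: "S' 1 = S 2" "S'' 1 = S 3" by (simp_all add: S''_def S'_def)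
  obtain C1 where C1: "C1 > 0" "decay_bound t \<gamma> S \<xi> (S 1) (S 1) C1"
    using decay_bound_first_component[OF spin _ bound, of "S 1"] S_carrier[OF spin] by blast
  obtain C2 where C2: "C2 > 0" "decay_bound t \<gamma> S' \<xi> (S' 1) (S 2) C2"
    using decay_bound_first_component[OF spin'(1) _ bound, of "S 2"] S_carrier[OF spin] by blast
  obtain C3 where C3: "C3 > 0" "decay_bound t \<gamma> S'' \<xi> (S'' 1) (S 3) C3"
    using decay_bound_first_component[OF spin'(2) _ bound, of "S 3"] S_carrier[OF spin] by blast
  define C where "C = C1 + C2 + C3"
  have "decay_bound t \<gamma> S \<xi> (S j) (S j) C" if "j \<in> {1, 2, 3}" for j
  proof -
    have "decay_bound t \<gamma> S \<xi> (S 1) (S 1) C"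
      using C1 C2 C3 by (intro decay_bound_mono[OF C1(2)]) (simp add: C_def)
    moreover have "decay_bound t \<gamma> S \<xi> (S 2) (S 2) C"
      using C1 C2 C3 decay_bound_mono[OF C2(2), of C] unfolding decay_bound_def H1 H2 eqs by (simp add: C_def)
    moreover have "decay_bound t \<gamma> S \<xi> (S 3) (S 3) C"
      using C1 C2 C3 decay_bound_mono[OF C3(2), of C] unfolding decay_bound_def H1 H2 eqs by (simp add: C_def)
    ultimately show ?thesis using that by auto
  qed
  then have components: "\<exists>C>0. \<forall>j\<in>{1, 2, 3}. decay_bound t \<gamma> S \<xi> (S j) (S j) C"
    using C1 C2 C3 by (intro exI[of _ C]) (simp add: C_def)
  have raising: "\<exists>C>0. decay_bound t \<gamma> S \<xi> (spin_raising S) A C" if A: "A \<in> carrier_mat (t + 1) (t + 1)" for A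
    by (rule exI[of _ "matrix_bound (spin_raising S) * matrix_bound A + 1"])
      (auto intro!: decay_bound_mono[OF bound[OF spin A]] add_nonneg_pos)
  have "inverse (ereal (32 * s * \<gamma>\<^sup>2)) = inverse (ereal (16 * real t * \<gamma>\<^sup>2))"
    by (simp add: assms(2))
  then have limit: "((\<lambda>\<beta>. ereal (\<beta> * \<xi> \<beta>)) \<longlongrightarrow> inverse (ereal (32 * s * \<gamma>\<^sup>2))) at_top"
    using slope(4) by (simp only: \<xi>_def)
  obtain C where C: "C > 0" "\<And>j. j \<in> {1, 2, 3} \<Longrightarrow> decay_bound t \<gamma> S \<xi> (S j) (S j) C"
    using components by blast
  show ?thesis
  proof (intro exI[of _ \<xi>] conjI ballI)
    show "\<forall>\<beta>>0. \<xi> \<beta> > 0" using slope(3) by (simp add: \<xi>_def)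
    show "\<exists>C>0. \<forall>n E c \<beta>. admissible t \<gamma> n E c \<longrightarrow> \<beta> > 0 \<longrightarrow>
      (\<forall>x<n. \<forall>y<n. \<forall>j\<in>{1, 2, 3}.
        cmod (gibbs_state \<beta> (hamiltonian t n E S c)
                (site_op (t + 1) n x (S j) * site_op (t + 1) n y (S j)))
          \<le> C * (real (graph_dist E x y) + 1) powr (- \<xi> \<beta>))"
      by (intro exI[of _ C] conjI allI impI ballI C(1))
        (rule C(2)[unfolded decay_bound_def, rule_format])
  qed (use limit raising[unfolded decay_bound_def] in simp_all)
qed

end
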